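(* Let $n\geq 1$, $\nu\geq 1$ and $0\leq p,q,r<n$. (a) Let $P=P_n(x_0x_p^{-1}x_q^{-1}x_r)$ be irreducible and non-redundant and let $G$ be the group defined by $P$. Then $P$ is $(2,4,\nu)$-special if and only if $n=4\nu$ and $(p,q,r)\equiv(\nu,-s,\nu-s)$ or $(3\nu,-s,3\nu-s)$ (mod $n$) for some integer $s$ with $\gcd(s,\nu)=1$, in which case $G$ contains a subgroup isomorphic to $F_2\times F_2$ and admits an epimorphism onto the free group of rank $\nu$, so is large if $\nu>1$. Moreover, if ($P$ is $(2,4,\nu)$-special and) $\nu=1$ then one of the following holds: (i) $G\cong G_4(x_0x_1^{-1}x_0^{-1}x_1)\cong F_2\times F_2$; or (ii) $G\cong G_4(x_0x_1^{-2}x_2)$, which has $F_5\times F_5$ as an index $16$ subgroup; or (iii) $G\cong G_4(x_0x_1^{-1}x_2^{-1}x_3)$, which has $F_3\times F_5$ as an index $8$ subgroup. (b) Let $P=P_n(x_0x_p^{-1}x_qx_r)$ be irreducible and let $G$ be the group defined by $P$. Then $P$ is $(2,4,\nu)$-special if and only if $\nu=1$, $n=4$, and one of the following holds: (i) $(p,q,r)\in\{(1,0,1),(3,0,3)\}$, in which case $G\cong G_4(x_0x_1^{-1}x_0x_1)$ and the (index $16$) derived subgroup $G'\cong F_5\times F_5$; (ii) $(p,q,r)\in\{(1,0,3),(3,0,1)\}$, in which case $G\cong G_4(x_0x_1^{-1}x_0x_3)$ and $G$ has $F_5\times F_5$ as an index $16$ subgroup; (iii) $(p,q,r)\in\{(1,2,0),(3,2,0),(1,2,2),(3,2,2)\}$,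 in which case $G\cong G_4(x_0^2x_1^{-1}x_2)$.
   Context: Cyclic presentations: $F_n$ is the free group with basis $x_0,\ldots,x_{n-1}$ (so $F_j$ denotes the free group of rank $j$) and $\theta:F_n\to F_n$ is the automorphism $\theta(x_i)=x_{i+1}$ (subscripts mod $n$). For a cyclically reduced word $w\in F_n$ (cyclic reducedness of the defining word is part of the definition), $P_n(w)=\langle x_0,\ldots,x_{n-1}\mid w,\theta(w),\ldots,\theta^{n-1}(w)\rangle$ and $G_n(w)$ is the group it defines. $P_n(w)$ is irreducible if the greatest common divisor of $n$ and the subscripts of the generators appearing in $w$ is $1$. A group is large if it has a finite index subgroup that has a non-abelian free homomorphic image. Non-redundant: a relator $r\in R$ of $\langle X\mid R\rangle$ is freely redundant if it is freely trivial or there is $s\in R$ such that $r,s$ are distinct elements of the free group on $X$ and $r$ is freely conjugate to $s$ or to $s^{-1}$. A presentation is non-redundant if it contains no freely redundant relator. Star graph: let $\tilde R$ be the set of all cyclic permutations of elements of $R\cup R^{-1}$. The star graph of $\langle X\mid R\rangle$ (all relators cyclically reduced) is the undirected graph, possibly with multiple edges, with vertex set $X\cup X^{-1}$ and an edge joining $x$ and $y$ for each distinct word of the form $xy^{-1}u$ in $\tilde R$, where the edges corresponding to the inverse pair $xy^{-1}u$, $yx^{-1}u^{-1}$ are identified. Special presentations: let $m\geq 2$, $k\geq 3$, $\nu\geq 1$. A finite presentation $\langle X\mid R\rangle$ is $(m,k,\nu)$-special if (a) its star graph has exactly $\nu$ connected components, which are pairwise isomorphic, each a connected bipartite graph of diameter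 $m$ and girth $2m$ in which each vertex has degree at least $3$; (b) each relator has length $k$; (c) if $m=2$ then $k\geq 4$. Girth is the length of a shortest closed path in which consecutive edges are never equal (so a pair of parallel edges gives such a path of length $2$). *)

theory Defs
  imports
    "HOL-Algebra.Generated_Groups"
    "HOL-Library.Extended_Nat"
    "HOL-Number_Theory.Cong"
begin

section \<open>Words and free groups\<close>

text \<open>\<open>Pos x\<close> is the generator \<open>x\<close> and \<open>Neg x\<close> its formal inverse.\<close>

datatype 'a letter = Pos (gen: 'a) | Neg (gen: 'a)

type_synonym 'a word = "'a letter list"

fun inv_letter :: "'a letter \<Rightarrow> 'a letter" where
  "inv_letter (Pos x) = Neg x"
| "inv_letter (Neg x) = Pos x"

definition inv_word :: "'a word \<Rightarrow> 'a word" where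
  "inv_word w = rev (map inv_letter w)"

definition word_gens :: "'a word \<Rightarrow> 'a set" where
  "word_gens w = gen ` set w"

definition reduced :: "'a word \<Rightarrow> bool" where
  "reduced w \<longleftrightarrow> successively (\<lambda>a b. b \<noteq> inv_letter a) w"

definition cyclically_reduced :: "'a word \<Rightarrow> bool" where
  "cyclically_reduced w \<longleftrightarrow> reduced w \<and> (w \<noteq> [] \<longrightarrow> hd w \<noteq> inv_letter (last w))"

fun push :: "'a letter \<Rightarrow> 'a word \<Rightarrow> 'a word" where
  "push a [] = [a]"
| "push a (b # w) = (if b = inv_letter a then w else a # b # w)"

text \<open>\<open>free_reduce w\<close> is the reduced word freely equal to \<open>w\<close>.\<close>

definition free_reduce :: "'a word \<Rightarrow> 'a word" where
  "free_reduce w = foldr push w []"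

definition free_group :: "'a set \<Rightarrow> 'a word monoid" where
  "free_group X =
    \<lparr>carrier = {w. reduced w \<and> word_gens w \<subseteq> X},
     monoid.mult = (\<lambda>u v. free_reduce (u @ v)),
     one = []\<rparr>"

abbreviation free_group_rank :: "nat \<Rightarrow> nat word monoid" where
  "free_group_rank k \<equiv> free_group {..<k}"

lemma inv_letter_inv_letter [simp]: "inv_letter (inv_letter a) = a"
  by (cases a) auto

lemma inv_letter_neq [simp]: "inv_letter a \<noteq> a" "a \<noteq> inv_letter a"
  by (cases a; auto)+

lemma gen_inv_letter [simp]: "gen (inv_letter a) = gen a"
  by (cases a) auto

lemma reduced_simps [simp]:
  "reduced []" "reduced [a]"
  "reduced (a # b # w) \<longleftrightarrow> b \<noteq> inv_letter a \<and> reduced (b # w)"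
  by (auto simp: reduced_def)

lemma reduced_ConsD: "reduced (a # w) \<Longrightarrow> reduced w"
  by (cases w) auto

lemma reduced_push: "reduced w \<Longrightarrow> reduced (push a w)"
  by (cases w) (auto dest: reduced_ConsD)

lemma push_reduced: "reduced (a # w) \<Longrightarrow> push a w = a # w"
  by (cases w) auto

lemma push_push_inv: "reduced w \<Longrightarrow> push a (push (inv_letter a) w) = w"
  by (cases w) (auto intro: push_reduced)

lemma reduced_foldr_push: "reduced z \<Longrightarrow> reduced (foldr push w z)"
  by (induction w) (auto intro: reduced_push)

lemma reduced_free_reduce [simp]: "reduced (free_reduce w)"
  by (simp add: free_reduce_def reduced_foldr_push)

lemma free_reduce_reduced: "reduced w \<Longrightarrow> free_reduce w = w"
proof (induction w)
  case (Cons a w)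
  then have "free_reduce w = w" by (blast dest: reduced_ConsD)
  with Cons.prems show ?case by (simp add: free_reduce_def push_reduced)
qed (simp add: free_reduce_def)

lemma foldr_push_push:
  "reduced z \<Longrightarrow> foldr push (push a w) z = push a (foldr push w z)"
proof (cases w)
  case (Cons b w')
  assume z: "reduced z"
  show ?thesis
    using Cons push_push_inv[OF reduced_foldr_push[OF z], of a w'] by auto
qed auto

lemma foldr_push_free_reduce:
  "reduced z \<Longrightarrow> foldr push (free_reduce w) z = foldr push w z"
  by (induction w) (auto simp: free_reduce_def foldr_push_push)

lemma free_reduce_append_left: "free_reduce (free_reduce u @ v) = free_reduce (u @ v)"
proof -
  have "reduced (foldr push v [])" by (rule reduced_foldr_push) simp
  then show ?thesis
    using foldr_push_free_reduce by (simp add: free_reduce_def)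
qed

lemma free_reduce_append_right: "free_reduce (u @ free_reduce v) = free_reduce (u @ v)"
proof -
  have "free_reduce (free_reduce v) = free_reduce v" by (simp add: free_reduce_reduced)
  then show ?thesis by (simp add: free_reduce_def)
qed

lemma word_gens_free_reduce: "word_gens (free_reduce w) \<subseteq> word_gens w"
proof (induction w)
  case (Cons a w)
  have "word_gens (push a v) \<subseteq> insert (gen a) (word_gens v)" for v
    by (cases v) (auto simp: word_gens_def)
  with Cons show ?case by (fastforce simp: free_reduce_def word_gens_def)
qed (simp add: free_reduce_def)

lemma free_reduce_inv_word: "free_reduce (inv_word w @ w) = []"
proof (induction w)
  case (Cons a w)
  have r: "reduced (foldr push w [])" by (rule reduced_foldr_push) simp
  have "push (inv_letter a) (push a (foldr push w [])) = foldr push w []"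
    using push_push_inv[OF r, of "inv_letter a"] by simp
  with Cons show ?case by (simp add: free_reduce_def inv_word_def)
qed (simp add: free_reduce_def inv_word_def)

lemma reduced_inv_word: "reduced w \<Longrightarrow> reduced (inv_word w)"
  unfolding reduced_def inv_word_def
  by (simp add: successively_map) (metis (mono_tags, lifting) inv_letter_inv_letter successively_mono)

lemma word_gens_inv_word [simp]: "word_gens (inv_word w) = word_gens w"
  by (simp add: word_gens_def inv_word_def image_image)

lemma group_free_group: "group (free_group X)"
proof (rule groupI)
  fix u v assume "u \<in> carrier (free_group X)" "v \<in> carrier (free_group X)"
  then have "word_gens (u @ v) \<subseteq> X" by (auto simp: free_group_def word_gens_def)
  then have "word_gens (free_reduce (u @ v)) \<subseteq> X"
    using word_gens_free_reduce by (rule subset_trans[rotated])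
  then show "u \<otimes>\<^bsub>free_group X\<^esub> v \<in> carrier (free_group X)"
    by (simp add: free_group_def)
next
  fix u assume u: "u \<in> carrier (free_group X)"
  then show "\<exists>v\<in>carrier (free_group X). v \<otimes>\<^bsub>free_group X\<^esub> u = \<one>\<^bsub>free_group X\<^esub>"
    by (intro bexI[of _ "inv_word u"])
       (auto simp: free_group_def free_reduce_inv_word reduced_inv_word)
qed (auto simp: free_group_def free_reduce_append_left free_reduce_append_right
  free_reduce_reduced word_gens_def)


section \<open>Presentations\<close>

record 'a presentation =
  generators :: "'a set"
  relators :: "'a word set"

definition normal_closure :: "('a, 'b) monoid_scheme \<Rightarrow> 'a set \<Rightarrow> 'a set" where
  "normal_closure G S = \<Inter>{N. N \<lhd> G \<and> S \<subseteq> N}"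

definition presented_group :: "'a presentation \<Rightarrow> 'a word set monoid" where
  "presented_group P =
    free_group (generators P) Mod normal_closure (free_group (generators P)) (relators P)"

definition conjugate_in :: "('a, 'b) monoid_scheme \<Rightarrow> 'a \<Rightarrow> 'a \<Rightarrow> bool" where
  "conjugate_in G a b \<longleftrightarrow> (\<exists>g\<in>carrier G. a = g \<otimes>\<^bsub>G\<^esub> b \<otimes>\<^bsub>G\<^esub> inv\<^bsub>G\<^esub> g)"

definition freely_redundant :: "'a presentation \<Rightarrow> 'a word \<Rightarrow> bool" where
  "freely_redundant P r \<longleftrightarrow>
    (let F = free_group (generators P)
     in r = \<one>\<^bsub>F\<^esub> \<or>
        (\<exists>s\<in>relators P. r \<noteq> s \<and> (conjugate_in F r s \<or> conjugate_in F r (inv\<^bsub>F\<^esub> s))))"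

definition non_redundant :: "'a presentation \<Rightarrow> bool" where
  "non_redundant P \<longleftrightarrow> (\<forall>r\<in>relators P. \<not> freely_redundant P r)"


section \<open>Cyclic presentations\<close>

text \<open>The automorphism \<open>\<theta>\<close> of the free group on \<open>{..<n}\<close> sends reduced words to reduced words
  letter by letter.\<close>

definition shift_word :: "nat \<Rightarrow> nat word \<Rightarrow> nat word" where
  "shift_word n = map (map_letter (\<lambda>i. (i + 1) mod n))"

text \<open>The defining word \<open>w\<close> is meant to be a cyclically reduced word on \<open>{..<n}\<close>.\<close>

definition cyclic_presentation :: "nat \<Rightarrow> nat word \<Rightarrow> nat presentation" where
  "cyclic_presentation n w =
    \<lparr>generators = {..<n}, relators = (\<lambda>i. (shift_word n ^^ i) w) ` {..<n}\<rparr>"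

abbreviation cyclic_group_of :: "nat \<Rightarrow> nat word \<Rightarrow> nat word set monoid" where
  "cyclic_group_of n w \<equiv> presented_group (cyclic_presentation n w)"

definition irreducible_cyclic :: "nat \<Rightarrow> nat word \<Rightarrow> bool" where
  "irreducible_cyclic n w \<longleftrightarrow> Gcd (insert n (word_gens w)) = 1"


section \<open>Undirected multigraphs\<close>

text \<open>\<open>ends G e\<close> is \<open>{u, v}\<close> for an edge joining \<open>u\<close> and \<open>v\<close>, and \<open>{v}\<close> for a loop at \<open>v\<close>.\<close>

record ('v, 'e) multigraph =
  verts :: "'v set"
  edges :: "'e set"
  ends :: "'e \<Rightarrow> 'v set"

fun walk :: "('v, 'e) multigraph \<Rightarrow> 'v \<Rightarrow> 'e list \<Rightarrow> 'v \<Rightarrow> bool" where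
  "walk G u [] v \<longleftrightarrow> u \<in> verts G \<and> u = v"
| "walk G u (e # es) v \<longleftrightarrow>
     u \<in> verts G \<and> e \<in> edges G \<and> (\<exists>x. ends G e = {u, x} \<and> walk G x es v)"

definition connected_graph :: "('v, 'e) multigraph \<Rightarrow> bool" where
  "connected_graph G \<longleftrightarrow> verts G \<noteq> {} \<and> (\<forall>u\<in>verts G. \<forall>v\<in>verts G. \<exists>es. walk G u es v)"

definition components :: "('v, 'e) multigraph \<Rightarrow> ('v, 'e) multigraph set" where
  "components G =
    (\<lambda>u. let C = {v. \<exists>es. walk G u es v}
          in \<lparr>verts = C, edges = {e \<in> edges G. ends G e \<subseteq> C}, ends = ends G\<rparr>) ` verts G"

definition graph_isomorphic :: "('v, 'e) multigraph \<Rightarrow> ('w, 'f) multigraph \<Rightarrow> bool" where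
  "graph_isomorphic G H \<longleftrightarrow>
    (\<exists>f g. bij_betw f (verts G) (verts H) \<and> bij_betw g (edges G) (edges H) \<and>
           (\<forall>e\<in>edges G. ends H (g e) = f ` ends G e))"

definition bipartite :: "('v, 'e) multigraph \<Rightarrow> bool" where
  "bipartite G \<longleftrightarrow>
    (\<exists>A B. A \<union> B = verts G \<and> A \<inter> B = {} \<and>
           (\<forall>e\<in>edges G. \<exists>a\<in>A. \<exists>b\<in>B. ends G e = {a, b}))"

text \<open>Loops count twice.\<close>

definition degree :: "('v, 'e) multigraph \<Rightarrow> 'v \<Rightarrow> nat" where
  "degree G v = card {e \<in> edges G. v \<in> ends G e} + card {e \<in> edges G. ends G e = {v}}"

definition graph_dist :: "('v, 'e) multigraph \<Rightarrow> 'v \<Rightarrow> 'v \<Rightarrow> enat" where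
  "graph_dist G u v = (INF es\<in>{es. walk G u es v}. enat (length es))"

definition graph_diameter :: "('v, 'e) multigraph \<Rightarrow> enat" where
  "graph_diameter G = (SUP u\<in>verts G. SUP v\<in>verts G. graph_dist G u v)"

text \<open>\<open>distinct_adj\<close> compares successive entries of the list only, not the last with the first.
  This does not affect the minimum: if the first and last of at least three edges agree, then
  removing both leaves a shorter closed path.\<close>

definition girth :: "('v, 'e) multigraph \<Rightarrow> enat" where
  "girth G =
    (INF es\<in>{es. es \<noteq> [] \<and> distinct_adj es \<and> (\<exists>v. walk G v es v)}. enat (length es))"


section \<open>Star graphs and special presentations\<close>

definition symmetrized_relators :: "'a presentation \<Rightarrow> 'a word set" where
  "symmetrized_relators P =
    {rotate i r | i r. r \<in> relators P \<union> inv_word ` relators P}"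

text \<open>An edge is the identified pair consisting of \<open>x y\<inverse> u\<close> and \<open>y x\<inverse> u\<inverse>\<close>. The first letters of
  these two words are \<open>x\<close> and \<open>y\<close>, so the image of the pair under \<^const>\<open>hd\<close> is the set of
  endpoints.\<close>

definition star_graph :: "'a presentation \<Rightarrow> ('a letter, 'a word set) multigraph" where
  "star_graph P =
    \<lparr>verts = Pos ` generators P \<union> Neg ` generators P,
     edges = {{x # inv_letter y # u, y # inv_letter x # inv_word u} | x y u.
                x # inv_letter y # u \<in> symmetrized_relators P},
     ends = (\<lambda>E. hd ` E)\<rparr>"

definition special :: "nat \<Rightarrow> nat \<Rightarrow> nat \<Rightarrow> 'a presentation \<Rightarrow> bool" where
  "special m k \<nu> P \<longleftrightarrow>
    2 \<le> m \<and> 3 \<le> k \<and> 1 \<le> \<nu> \<and>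
    finite (generators P) \<and> finite (relators P) \<and>
    (\<forall>r\<in>relators P. r \<in> carrier (free_group (generators P)) \<and> cyclically_reduced r) \<and>
    finite (components (star_graph P)) \<and> card (components (star_graph P)) = \<nu> \<and>
    (\<forall>C\<in>components (star_graph P). \<forall>D\<in>components (star_graph P). graph_isomorphic C D) \<and>
    (\<forall>C\<in>components (star_graph P).
       connected_graph C \<and> bipartite C \<and> graph_diameter C = enat m \<and> girth C = enat (2 * m) \<and>
       (\<forall>v\<in>verts C. 3 \<le> degree C v)) \<and>
    (\<forall>r\<in>relators P. length r = k) \<and>
    (m = 2 \<longrightarrow> 4 \<le> k)"


section \<open>Subgroups up to isomorphism and largeness\<close>

definition embeds_as_subgroup :: "('b, 'c) monoid_scheme \<Rightarrow> ('a, 'd) monoid_scheme \<Rightarrow> bool" where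
  "embeds_as_subgroup K G \<longleftrightarrow> (\<exists>H. subgroup H G \<and> G\<lparr>carrier := H\<rparr> \<cong> K)"

text \<open>The index \<open>d\<close> is meant to be positive: \<^const>\<open>card\<close> is 0 on infinite sets.\<close>

definition embeds_with_index ::
    "('b, 'c) monoid_scheme \<Rightarrow> nat \<Rightarrow> ('a, 'd) monoid_scheme \<Rightarrow> bool" where
  "embeds_with_index K d G \<longleftrightarrow>
    (\<exists>H. subgroup H G \<and> card (rcosets\<^bsub>G\<^esub> H) = d \<and> G\<lparr>carrier := H\<rparr> \<cong> K)"

text \<open>A basis of a free image of \<open>H\<close> has at most the cardinality of \<open>H\<close>, so nothing is lost by
  taking the basis \<open>S\<close> in the type of the elements of \<open>G\<close>.\<close>

definition large :: "('a, 'b) monoid_scheme \<Rightarrow> bool" where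
  "large G \<longleftrightarrow>
    (\<exists>H. subgroup H G \<and> finite (rcosets\<^bsub>G\<^esub> H) \<and>
         (\<exists>S :: 'a set. \<not> comm_group (free_group S) \<and> epi (G\<lparr>carrier := H\<rparr>) (free_group S) \<noteq> {}))"

end

theory Submission
  imports Defs
begin

text \<open>
  A connected bipartite graph of diameter 2 is complete bipartite, and the star graphs in question
  are 4-regular, so a \<open>(2, 4, \<nu>)\<close>-special presentation has a star graph with \<open>\<nu>\<close> components
  \<open>K\<^sub>4\<^sub>,\<^sub>4\<close>. Its edges join \<open>x\<^sub>i\<close> to \<open>x\<^sub>i\<^sub>+\<^sub>p\<close>, \<open>x\<^sub>i\<inverse>\<close> to \<open>x\<^sub>i\<^sub>+\<^sub>d\<inverse>\<close>, and \<open>x\<^sub>i\<close> to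
  \<open>x\<^sub>i\<^sub>+\<^sub>e\<inverse>\<close> and \<open>x\<^sub>i\<^sub>+\<^sub>f\<inverse>\<close>; since walks of length 3 join adjacent vertices and there are no
  parallel edges, \<open>p\<close> and \<open>d\<close> have order 4 modulo \<open>n\<close> and \<open>e - f = 2 d\<close>. Conversely these
  congruences exhibit the components.

  For the groups, put \<open>G = G\<^sub>n(x\<^sub>0 x\<^sub>p\<inverse> x\<^sub>q\<inverse> x\<^sub>p\<^sub>+\<^sub>q)\<close> and \<open>K = G\<^sub>n(y\<^sub>0 y\<^sub>p\<inverse> y\<^sub>0\<inverse> y\<^sub>p)\<close>. The substitution
  \<open>x\<^sub>i = y\<^sub>i t\<^sup>q\<close> identifies the split extensions of \<open>G\<close> and \<open>K\<close> by the shift \<open>t\<close>. Hence there is a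
  bijection \<open>\<Phi> : G \<rightarrow> K\<close> with \<open>\<Phi> (g h) = \<Phi> g \<cdot> \<theta>\<^sup>q\<^sup>\<sigma>\<^sup>(\<^sup>g\<^sup>) (\<Phi> h)\<close>, where \<open>\<sigma>\<close> is the exponent sum. It
  maps subgroups of \<open>G\<close> on which \<open>q \<sigma>\<close> vanishes modulo \<open>n\<close> isomorphically to subgroups of \<open>K\<close> of
  the same index. For \<open>n = 4\<close> the group \<open>K\<close> is \<open>F\<^sub>2 \<times> F\<^sub>2\<close>, and the required subgroups are given by
  exponent sums divisible by 2 or 4. In the same way \<open>G\<^sub>4(x\<^sub>0 x\<^sub>1\<inverse> x\<^sub>0 x\<^sub>3)\<close> is a twisted form of
  \<open>G\<^sub>4(x\<^sub>0 x\<^sub>1\<inverse> x\<^sub>0 x\<^sub>1)\<close>, and the latter is a twisted form of \<open>F\<^sub>2 \<times> F\<^sub>2\<close> by automorphisms which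
  invert generators; here the elements with all exponents even form \<open>F\<^sub>5 \<times> F\<^sub>5\<close>.
\<close>

text \<open>No split extension is ever formed. A machine reads a word letter by letter, keeps the
  acting element (a power of the shift, or a set of sign changes) as its state, and writes the
  untwisted word; relators are then checked from each state. The price is that \<open>\<Phi>\<close>
  is not a homomorphism. It is multiplicative once the left factor returns to the initial state,
  which suffices to carry right cosets, hence indices, across.

  For \<open>\<nu> > 1\<close> the group \<open>K\<close> is larger than
  \<open>F2 \<times> F2\<close>, and the twist by an arbitrary \<open>q\<close> has to vanish. A
  copy of \<open>F2 \<times> F2\<close> is therefore built inside the elements of exponent sum 0,
  from the four generators with subscripts divisible by \<open>\<nu>\<close>, and recognised by two
  retractions. Reading subscripts modulo \<open>\<nu>\<close> gives the free quotient.

  If \<open>2 p\<close> or \<open>2 d\<close> vanishes modulo \<open>n\<close>, two edges with the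
  same ends may be a single edge. In (a) this would make a relator conjugate to the inverse of a
  translate, which non-redundancy forbids; in (b) it contradicts the exponent sum 2 of the
  relators.\<close>

definition words :: "'a set \<Rightarrow> 'a word set" where
  "words X = {u. word_gens u \<subseteq> X}"

lemma words_simps [simp]:
  "[] \<in> words X" "l # u \<in> words X \<longleftrightarrow> gen l \<in> X \<and> u \<in> words X"
  "u @ v \<in> words X \<longleftrightarrow> u \<in> words X \<and> v \<in> words X"
  "inv_word u \<in> words X \<longleftrightarrow> u \<in> words X"
  "rev u \<in> words X \<longleftrightarrow> u \<in> words X"
  by (auto simp: words_def word_gens_def inv_word_def image_image)

lemma words_UNIV [simp]: "words UNIV = UNIV"
  by (simp add: words_def)

lemma words_free_reduce: "u \<in> words X \<Longrightarrow> free_reduce u \<in> words X"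
  using word_gens_free_reduce by (fastforce simp: words_def)

lemma carrier_free_group: "carrier (free_group X) = {u. reduced u \<and> u \<in> words X}"
  by (simp add: free_group_def words_def)

lemma mult_free_group: "u \<otimes>\<^bsub>free_group X\<^esub> v = free_reduce (u @ v)"
  by (simp add: free_group_def)

lemma one_free_group: "\<one>\<^bsub>free_group X\<^esub> = []"
  by (simp add: free_group_def)

lemma inv_word_simps [simp]:
  "inv_word [] = []" "inv_word (l # u) = inv_word u @ [inv_letter l]"
  "inv_word (u @ v) = inv_word v @ inv_word u" "inv_word (inv_word u) = u"
  by (induction u) (auto simp: inv_word_def)

lemma free_reduce_idem [simp]: "free_reduce (free_reduce u) = free_reduce u"
  by (simp add: free_reduce_reduced)

lemma free_reduce_in_carrier: "u \<in> words X \<Longrightarrow> free_reduce u \<in> carrier (free_group X)"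
  by (simp add: carrier_free_group words_free_reduce)

lemma inv_free_group:
  assumes "u \<in> carrier (free_group X)"
  shows "inv\<^bsub>free_group X\<^esub> u = inv_word u"
proof -
  interpret group "free_group X" by (rule group_free_group)
  show ?thesis
    using assms by (intro inv_equality)
      (auto simp: carrier_free_group mult_free_group one_free_group free_reduce_inv_word reduced_inv_word)
qed

lemma free_reduce_cancel: "free_reduce (u @ l # inv_letter l # v) = free_reduce (u @ v)"
  using push_push_inv[of "foldr push v []" l] reduced_foldr_push[of "[]" v]
  by (simp add: free_reduce_def)


section \<open>Words modulo relators and the elements of a presented group\<close>

section \<open>The word congruence of a presentation\<close>

text \<open>Equality in the presented group, phrased on arbitrary words: cancelling a pair or
  deleting a relator in context takes the place of reduced words and conjugates of relators.
  Intermediate words may use letters outside the generating set; \<open>word_class_eq_iff\<close>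
  shows that this identifies nothing new.\<close>

inductive weq :: "'a presentation \<Rightarrow> 'a word \<Rightarrow> 'a word \<Rightarrow> bool" for P where
  weq_refl [simp, intro]: "weq P u u"
| weq_sym: "weq P u v \<Longrightarrow> weq P v u"
| weq_trans [trans]: "weq P u v \<Longrightarrow> weq P v w \<Longrightarrow> weq P u w"
| weq_cancel: "weq P (u @ l # inv_letter l # v) (u @ v)"
| weq_relator: "r \<in> relators P \<Longrightarrow> weq P (u @ r @ v) (u @ v)"

lemma weq_context: "weq P u v \<Longrightarrow> weq P (a @ u @ b) (a @ v @ b)"
proof (induction rule: weq.induct)
  case (weq_cancel u l v)
  then show ?case using weq.weq_cancel[of P "a @ u" l "v @ b"] by simp
next
  case (weq_relator r u v)
  then show ?case using weq.weq_relator[of r P "a @ u" "v @ b"] by simp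
qed (auto intro: weq.intros)

lemma weq_append: "weq P u u' \<Longrightarrow> weq P v v' \<Longrightarrow> weq P (u @ v) (u' @ v')"
  using weq_context[of P u u' "[]" v] weq_context[of P v v' u' "[]"]
  by (auto intro: weq_trans)

lemma weq_Cons: "weq P u v \<Longrightarrow> weq P (l # u) (l # v)"
  using weq_append[of P "[l]" "[l]"] by simp

lemma weq_free_reduce: "weq P (free_reduce u) u"
proof (induction u)
  case (Cons l u)
  have "weq P (push l v) (l # v)" for v
  proof (cases v)
    case (Cons k w)
    then show ?thesis using weq_cancel[of P "[]" l w] by (auto intro: weq_sym)
  qed auto
  with weq_Cons[OF Cons, of l] show ?case
    by (auto simp: free_reduce_def intro: weq_trans)
qed (simp add: free_reduce_def)

lemma weq_free_reduceI: "free_reduce u = free_reduce v \<Longrightarrow> weq P u v"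
  by (metis weq_free_reduce weq_sym weq_trans)

lemma weq_inv_left: "weq P (inv_word u @ u) []"
  by (rule weq_free_reduceI) (simp only: free_reduce_inv_word, simp add: free_reduce_def)

lemma weq_inv_right: "weq P (u @ inv_word u) []"
  using weq_inv_left[of P "inv_word u"] by simp

text \<open>Conjugation by \<open>u\<close> carries \<open>u @ v\<close> to
  \<open>v @ u\<close>.\<close>

lemma weq_rotate_iff: "weq P (u @ v) [] \<longleftrightarrow> weq P (v @ u) []"
proof -
  have "weq P (v @ u) []" if "weq P (u @ v) []" for u v :: "'a word"
  proof -
    have "weq P (inv_word u @ (u @ v) @ u) (inv_word u @ u)"
      using weq_context[OF that, of "inv_word u" u] by simp
    moreover have "weq P (inv_word u @ (u @ v) @ u) (v @ u)"
      using weq_append[OF weq_inv_left[of P u], of "v @ u" "v @ u"] by simp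
    ultimately show ?thesis
      by (meson weq_inv_left weq_sym weq_trans)
  qed
  then show ?thesis by blast
qed

lemma weq_rotate: "weq P u [] \<Longrightarrow> weq P (rotate i u) []"
proof (induction i)
  case (Suc i)
  then have "weq P (rotate1 (rotate i u)) []"
    by (cases "rotate i u") (use weq_rotate_iff[of P "[_]"] in auto)
  then show ?case by simp
qed simp

text \<open>\<open>inv_word u @ v @ inv_word v\<close> equals \<open>inv_word u\<close> by
  cancelling on the right, and \<open>inv_word v\<close> after replacing \<open>v\<close> by
  \<open>u\<close>.\<close>

lemma weq_inv_word: "weq P u v \<Longrightarrow> weq P (inv_word u) (inv_word v)"
proof -
  assume a: "weq P u v"
  have "weq P (inv_word u @ v @ inv_word v) (inv_word u @ u @ inv_word v)"
    using weq_context[OF a, of "inv_word u" "inv_word v"] by (rule weq_sym)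
  moreover have "weq P (inv_word u @ v @ inv_word v) (inv_word u)"
    using weq_append[OF weq_refl[of P "inv_word u"] weq_inv_right[of P v]] by simp
  moreover have "weq P (inv_word u @ u @ inv_word v) (inv_word v)"
    using weq_append[OF weq_inv_left[of P u] weq_refl[of P "inv_word v"]] by simp
  ultimately show ?thesis by (meson weq_sym weq_trans)
qed

lemma weq_relatorI: "r \<in> relators P \<Longrightarrow> weq P r []"
  using weq_relator[of r P "[]" "[]"] by simp

section \<open>Evaluation of words in a group\<close>

definition letter_value :: "('g, 'h) monoid_scheme \<Rightarrow> ('a \<Rightarrow> 'g) \<Rightarrow> 'a letter \<Rightarrow> 'g" where
  "letter_value M f l = (case l of Pos x \<Rightarrow> f x | Neg x \<Rightarrow> inv\<^bsub>M\<^esub> (f x))"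

definition word_value :: "('g, 'h) monoid_scheme \<Rightarrow> ('a \<Rightarrow> 'g) \<Rightarrow> 'a word \<Rightarrow> 'g" where
  "word_value M f u = foldr (\<lambda>l. monoid.mult M (letter_value M f l)) u \<one>\<^bsub>M\<^esub>"

lemma word_value_simps [simp]:
  "word_value M f [] = \<one>\<^bsub>M\<^esub>"
  "word_value M f (Pos x # u) = f x \<otimes>\<^bsub>M\<^esub> word_value M f u"
  "word_value M f (Neg x # u) = inv\<^bsub>M\<^esub> (f x) \<otimes>\<^bsub>M\<^esub> word_value M f u"
  by (auto simp: word_value_def letter_value_def)

lemma word_value_Cons: "word_value M f (l # u) = letter_value M f l \<otimes>\<^bsub>M\<^esub> word_value M f u"
  by (simp add: word_value_def)

context group begin

lemma letter_value_closed: "f \<in> X \<rightarrow> carrier G \<Longrightarrow> gen l \<in> X \<Longrightarrow> letter_value G f l \<in> carrier G"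
  by (cases l) (auto simp: letter_value_def)

lemma letter_value_inv:
  "f \<in> X \<rightarrow> carrier G \<Longrightarrow> gen l \<in> X \<Longrightarrow> letter_value G f (inv_letter l) = inv (letter_value G f l)"
  by (cases l) (auto simp: letter_value_def Pi_def)

lemma word_value_closed: "f \<in> X \<rightarrow> carrier G \<Longrightarrow> u \<in> words X \<Longrightarrow> word_value G f u \<in> carrier G"
  by (induction u) (auto simp: word_value_Cons intro!: letter_value_closed)

lemma word_value_append:
  assumes "f \<in> X \<rightarrow> carrier G" "u \<in> words X" "v \<in> words X"
  shows "word_value G f (u @ v) = word_value G f u \<otimes> word_value G f v"
  using assms(2)
proof (induction u)
  case Nil
  then show ?case using word_value_closed[OF assms(1,3)] by simp
next
  case (Cons l u)
  then show ?case using assms(1,3)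
    by (simp add: word_value_Cons m_assoc letter_value_closed word_value_closed)
qed

text \<open>Letters outside \<open>X\<close> are filtered out since \<^const>\<open>weq\<close> does not restrict the letters.\<close>

lemma word_value_weq:
  assumes f: "f \<in> generators P \<rightarrow> carrier G"
    and R: "relators P \<subseteq> words (generators P)" "\<And>r. r \<in> relators P \<Longrightarrow> word_value G f r = \<one>"
    and "weq P u v"
  shows "word_value G f (filter (\<lambda>l. gen l \<in> generators P) u)
    = word_value G f (filter (\<lambda>l. gen l \<in> generators P) v)"
proof -
  let ?X = "generators P"
  let ?\<phi> = "filter (\<lambda>l. gen l \<in> ?X)"
  have w: "?\<phi> u \<in> words ?X" for u by (auto simp: words_def word_gens_def)
  have c: "word_value G f u \<in> carrier G" if "u \<in> words ?X" for u
    using that f word_value_closed by blast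
  note app = word_value_append[OF f]
  from \<open>weq P u v\<close> show ?thesis
  proof (induction rule: weq.induct)
    case (weq_cancel u l v)
    have "word_value G f (l # inv_letter l # ?\<phi> v) = word_value G f (?\<phi> v)" if "gen l \<in> ?X"
      using that f letter_value_closed[OF f that]
      by (simp add: word_value_Cons letter_value_inv[OF f that] w c m_assoc[symmetric])
    then show ?case
      by (simp add: app w)
  next
    case (weq_relator r u v)
    then have r: "r \<in> words ?X" using R by auto
    then have "?\<phi> r = r" by (auto simp: words_def word_gens_def intro!: filter_True)
    then show ?case using r weq_relator by (simp add: app w R c)
  qed auto
qed

lemma word_value_weq':
  assumes "f \<in> generators P \<rightarrow> carrier G"
    and "relators P \<subseteq> words (generators P)" "\<And>r. r \<in> relators P \<Longrightarrow> word_value G f r = \<one>"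
    and "weq P u v" "u \<in> words (generators P)" "v \<in> words (generators P)"
  shows "word_value G f u = word_value G f v"
proof -
  have "filter (\<lambda>l. gen l \<in> generators P) u = u" if "u \<in> words (generators P)" for u
    using that by (auto simp: words_def word_gens_def intro!: filter_True)
  then show ?thesis using word_value_weq[OF assms(1-4)] assms(5,6) by simp
qed

end

section \<open>Elements of a presented group\<close>

definition word_class :: "'a presentation \<Rightarrow> 'a word \<Rightarrow> 'a word set" where
  "word_class P u = normal_closure (free_group (generators P)) (relators P)
     #>\<^bsub>free_group (generators P)\<^esub> free_reduce u"

definition well_formed :: "'a presentation \<Rightarrow> bool" where
  "well_formed P \<longleftrightarrow> (\<forall>r\<in>relators P. reduced r \<and> r \<in> words (generators P))"

lemma (in group) normal_normal_closure:
  assumes "S \<subseteq> carrier G"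
  shows "normal_closure G S \<lhd> G" "S \<subseteq> normal_closure G S"
proof -
  let ?A = "{N. N \<lhd> G \<and> S \<subseteq> N}"
  have "carrier G \<lhd> G" using normal_inv_iff subgroup_self by blast
  then have ne: "?A \<noteq> {}" using assms by blast
  have "subgroup (\<Inter>?A) G"
    by (rule subgroups_Inter) (use ne in \<open>auto simp: normal_imp_subgroup\<close>)
  then show "normal_closure G S \<lhd> G"
    unfolding normal_closure_def
    by (auto simp: normal_inv_iff)
  show "S \<subseteq> normal_closure G S" by (auto simp: normal_closure_def)
qed

locale wf_presentation =
  fixes P :: "'a presentation"
  assumes wf: "well_formed P"
begin

abbreviation "F \<equiv> free_group (generators P)"
abbreviation "N \<equiv> normal_closure F (relators P)"

sublocale F: group F by (rule group_free_group)

lemma relators_words: "relators P \<subseteq> words (generators P)"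
  using wf by (auto simp: well_formed_def)

lemma relators_carrier: "relators P \<subseteq> carrier F"
  using wf by (auto simp: well_formed_def carrier_free_group)

sublocale N: normal N F
  using F.normal_normal_closure[OF relators_carrier] by simp

lemma relators_N: "relators P \<subseteq> N"
  using F.normal_normal_closure[OF relators_carrier] by simp

text \<open>The elements of the free group that are congruent to the empty word form a normal
  subgroup containing the relators, so they include the normal closure.\<close>

lemma N_weq: "u \<in> N \<Longrightarrow> weq P u []"
proof -
  let ?M = "{u \<in> carrier F. weq P u []}"
  have "subgroup ?M F"
  proof
    show "x \<otimes>\<^bsub>F\<^esub> y \<in> ?M" if "x \<in> ?M" "y \<in> ?M" for x y
    proof -
      have "weq P (free_reduce (x @ y)) []"
        using weq_trans[OF weq_free_reduce weq_append[of P x "[]" y "[]"]] that by simp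
      then show ?thesis using that F.m_closed[of x y] by (simp add: mult_free_group)
    qed
    show "inv\<^bsub>F\<^esub> x \<in> ?M" if "x \<in> ?M" for x
      using that weq_inv_word[of P x "[]"] F.inv_closed[of x] by (auto simp: inv_free_group)
  qed (auto simp: one_free_group carrier_free_group)
  moreover have "x \<otimes>\<^bsub>F\<^esub> h \<otimes>\<^bsub>F\<^esub> inv\<^bsub>F\<^esub> x \<in> ?M" if x: "x \<in> carrier F" and h: "h \<in> ?M" for x h
  proof -
    have "weq P (x @ h @ inv_word x) (x @ inv_word x)"
      using weq_context[of P h "[]" x "inv_word x"] h by simp
    then have "weq P (x @ h @ inv_word x) []" using weq_inv_right weq_trans by blast
    moreover have "x \<otimes>\<^bsub>F\<^esub> h \<otimes>\<^bsub>F\<^esub> inv\<^bsub>F\<^esub> x = free_reduce (x @ h @ inv_word x)"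
      using x by (simp add: inv_free_group mult_free_group free_reduce_append_left)
    moreover have "x \<otimes>\<^bsub>F\<^esub> h \<otimes>\<^bsub>F\<^esub> inv\<^bsub>F\<^esub> x \<in> carrier F" using x h by auto
    ultimately show ?thesis using weq_trans[OF weq_free_reduce] by auto
  qed
  ultimately have "?M \<lhd> F" by (simp add: F.normal_inv_iff)
  then have "N \<subseteq> ?M" using relators_carrier weq_relatorI
    by (fastforce simp: normal_closure_def)
  then show "u \<in> N \<Longrightarrow> weq P u []" by auto
qed

abbreviation "G \<equiv> presented_group P"

lemma group_G: "group G"
  unfolding presented_group_def by (rule N.factorgroup_is_group)

sublocale G: group G by (rule group_G)

lemma carrier_G: "carrier G = word_class P ` words (generators P)"
proof -
  have "carrier G = (\<lambda>u. N #>\<^bsub>F\<^esub> u) ` carrier F"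
    by (auto simp: presented_group_def FactGroup_def RCOSETS_def)
  also have "\<dots> = word_class P ` words (generators P)"
  proof -
    have "\<exists>v\<in>words (generators P). N #>\<^bsub>F\<^esub> u = word_class P v" if "u \<in> carrier F" for u
      using that by (intro bexI[of _ u]) (simp_all add: carrier_free_group word_class_def free_reduce_reduced)
    moreover have "\<exists>v\<in>carrier F. word_class P u = N #>\<^bsub>F\<^esub> v" if "u \<in> words (generators P)" for u
      using that by (intro bexI[of _ "free_reduce u"]) (simp_all add: word_class_def free_reduce_in_carrier)
    ultimately show ?thesis by blast
  qed
  finally show ?thesis .
qed

lemma word_class_closed [simp]: "u \<in> words (generators P) \<Longrightarrow> word_class P u \<in> carrier G"
  by (simp add: carrier_G)

lemma word_class_mult:
  "u \<in> words (generators P) \<Longrightarrow> v \<in> words (generators P)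
    \<Longrightarrow> word_class P u \<otimes>\<^bsub>G\<^esub> word_class P v = word_class P (u @ v)"
  by (simp add: presented_group_def FactGroup_def word_class_def N.rcos_sum
      free_reduce_in_carrier mult_free_group free_reduce_append_left free_reduce_append_right)

text \<open>A relator inserted in context amounts to multiplication by a conjugate of it, which the
  coset of \<open>N\<close> absorbs.\<close>

lemma word_class_weq:
  assumes "weq P u v" "u \<in> words (generators P)" "v \<in> words (generators P)"
  shows "word_class P u = word_class P v"
proof -
  let ?\<phi> = "filter (\<lambda>l. gen l \<in> generators P)"
  have w: "?\<phi> u \<in> words (generators P)" for u by (auto simp: words_def word_gens_def)
  \<comment> \<open>A derivation may pass through foreign letters, so the induction runs on the
    words with these letters deleted.\<close>
  have "word_class P (?\<phi> u) = word_class P (?\<phi> v)"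
    using assms(1)
  proof (induction rule: weq.induct)
    case (weq_cancel u l v)
    then show ?case by (simp add: word_class_def free_reduce_cancel)
  next
    case (weq_relator r u v)
    then have r: "r \<in> words (generators P)" using relators_words by auto
    then have r': "?\<phi> r = r" by (auto simp: words_def word_gens_def intro!: filter_True)
    have rN: "r \<in> N" "r \<in> carrier F" using weq_relator relators_N relators_carrier by auto
    have u: "free_reduce (?\<phi> u) \<in> carrier F" and v: "free_reduce (?\<phi> v) \<in> carrier F"
      using w free_reduce_in_carrier by auto
    let ?u = "free_reduce (?\<phi> u)" and ?v = "free_reduce (?\<phi> v)"
    have "free_reduce (?\<phi> (u @ r @ v)) = (?u \<otimes>\<^bsub>F\<^esub> r) \<otimes>\<^bsub>F\<^esub> ?v"
      by (simp add: mult_free_group free_reduce_append_left free_reduce_append_right r')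
    also have "\<dots> = (?u \<otimes>\<^bsub>F\<^esub> r \<otimes>\<^bsub>F\<^esub> inv\<^bsub>F\<^esub> ?u) \<otimes>\<^bsub>F\<^esub> (?u \<otimes>\<^bsub>F\<^esub> ?v)"
    proof -
      have "inv\<^bsub>F\<^esub> ?u \<otimes>\<^bsub>F\<^esub> (?u \<otimes>\<^bsub>F\<^esub> ?v) = ?v"
        using u v F.m_assoc[symmetric, of "inv\<^bsub>F\<^esub> ?u" ?u ?v] by simp
      then show ?thesis using u v rN by (simp add: F.m_assoc)
    qed
    finally have eq: "free_reduce (?\<phi> (u @ r @ v)) = \<dots>" .
    have "?u \<otimes>\<^bsub>F\<^esub> r \<otimes>\<^bsub>F\<^esub> inv\<^bsub>F\<^esub> ?u \<in> N" using rN u N.inv_op_closed2 by blast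
    then have "N #>\<^bsub>F\<^esub> (?u \<otimes>\<^bsub>F\<^esub> r \<otimes>\<^bsub>F\<^esub> inv\<^bsub>F\<^esub> ?u) = N"
      using u rN by (intro F.coset_join2 N.subgroup_axioms) auto
    then have "N #>\<^bsub>F\<^esub> (?u \<otimes>\<^bsub>F\<^esub> r \<otimes>\<^bsub>F\<^esub> inv\<^bsub>F\<^esub> ?u \<otimes>\<^bsub>F\<^esub> (?u \<otimes>\<^bsub>F\<^esub> ?v)) = N #>\<^bsub>F\<^esub> (?u \<otimes>\<^bsub>F\<^esub> ?v)"
      using F.coset_mult_assoc[OF N.subset, of "?u \<otimes>\<^bsub>F\<^esub> r \<otimes>\<^bsub>F\<^esub> inv\<^bsub>F\<^esub> ?u" "?u \<otimes>\<^bsub>F\<^esub> ?v"] u v rN by simp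
    moreover have "?u \<otimes>\<^bsub>F\<^esub> ?v = free_reduce (?\<phi> (u @ v))"
      by (simp add: mult_free_group free_reduce_append_left free_reduce_append_right)
    ultimately show ?case unfolding word_class_def eq by (simp only:)
  qed auto
  moreover have "?\<phi> u = u" if "u \<in> words (generators P)" for u
    using that by (auto simp: words_def word_gens_def intro!: filter_True)
  ultimately show ?thesis using assms by simp
qed

lemma word_class_eq_iff:
  assumes "u \<in> words (generators P)" "v \<in> words (generators P)"
  shows "word_class P u = word_class P v \<longleftrightarrow> weq P u v"
proof
  assume "word_class P u = word_class P v"
  then have "free_reduce u \<in> N #>\<^bsub>F\<^esub> free_reduce v"
    using assms F.rcos_self[OF _ N.subgroup_axioms, of "free_reduce u"]
    by (simp add: word_class_def free_reduce_in_carrier)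
  then obtain h where h: "h \<in> N" "free_reduce u = free_reduce (h @ free_reduce v)"
    by (auto simp: r_coset_def mult_free_group)
  have "weq P u (h @ free_reduce v)" using h(2)
    by (intro weq_free_reduceI) simp
  also have "weq P (h @ free_reduce v) v"
    using weq_append[OF N_weq[OF h(1)] weq_free_reduce[of P v]] by simp
  finally show "weq P u v" .
qed (use assms word_class_weq in blast)

lemma one_G: "\<one>\<^bsub>G\<^esub> = word_class P []"
proof -
  have "free_reduce [] = ([] :: 'a word)" by (simp add: free_reduce_def)
  then show ?thesis
    using F.coset_mult_one[of N] N.subset by (simp add: presented_group_def FactGroup_def word_class_def one_free_group)
qed

lemma inv_G: "u \<in> words (generators P) \<Longrightarrow> inv\<^bsub>G\<^esub> word_class P u = word_class P (inv_word u)"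
  by (rule G.inv_equality)
     (auto simp: word_class_mult one_G word_class_eq_iff weq_inv_left)

text \<open>Von Dyck's theorem. Elements are cosets, so the homomorphism evaluates a chosen word;
  \<open>word_value_weq'\<close> makes the choice immaterial.\<close>

lemma ex_hom:
  assumes M: "group M" and f: "f \<in> generators P \<rightarrow> carrier M"
    and R: "\<And>r. r \<in> relators P \<Longrightarrow> word_value M f r = \<one>\<^bsub>M\<^esub>"
  obtains h where "h \<in> hom G M" "\<And>u. u \<in> words (generators P) \<Longrightarrow> h (word_class P u) = word_value M f u"
proof -
  interpret M: group M by (rule M)
  define h where "h C = word_value M f (SOME u. u \<in> words (generators P) \<and> word_class P u = C)" for C
  have h: "h (word_class P u) = word_value M f u" if u: "u \<in> words (generators P)" for u
  proof -
    let ?v = "SOME v. v \<in> words (generators P) \<and> word_class P v = word_class P u"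
    have v: "?v \<in> words (generators P) \<and> word_class P ?v = word_class P u"
      by (rule someI[of _ u]) (use u in auto)
    then have "weq P ?v u" using u word_class_eq_iff by blast
    then show ?thesis unfolding h_def
      using M.word_value_weq'[OF f relators_words R] v u by blast
  qed
  moreover have "h \<in> hom G M"
    by (rule homI)
      (auto simp: carrier_G h word_class_mult M.word_value_append[OF f] M.word_value_closed[OF f])
  ultimately show thesis using that by blast
qed

end

section \<open>Bijections between groups defined by letter machines\<close>

section \<open>Letter machines between presentations\<close>

text \<open>Together with \<open>transduce\<close> this is a Mealy machine on letters: the state
  reached and the word written.\<close>

fun run :: "('s \<Rightarrow> 'a letter \<Rightarrow> 's) \<Rightarrow> 's \<Rightarrow> 'a word \<Rightarrow> 's" where
  "run nxt s [] = s"
| "run nxt s (l # u) = run nxt (nxt s l) u"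

fun transduce :: "('s \<Rightarrow> 'a letter \<Rightarrow> 's) \<Rightarrow> ('s \<Rightarrow> 'a letter \<Rightarrow> 'b letter) \<Rightarrow> 's \<Rightarrow> 'a word \<Rightarrow> 'b word" where
  "transduce nxt out s [] = []"
| "transduce nxt out s (l # u) = out s l # transduce nxt out (nxt s l) u"

lemma run_append: "run nxt s (u @ v) = run nxt (run nxt s u) v"
  by (induction u arbitrary: s) auto

lemma transduce_append:
  "transduce nxt out s (u @ v) = transduce nxt out s u @ transduce nxt out (run nxt s u) v"
  by (induction u arbitrary: s) auto

text \<open>The relator conditions range over all states because a relator can occur anywhere in a
  word; \<open>nxt_inv\<close> and \<open>out_inv\<close> make cancelling pairs produce cancelling
  pairs.\<close>

locale word_machine =
  fixes P :: "'a presentation" and Q :: "'b presentation"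
    and S :: "'s set" and nxt :: "'s \<Rightarrow> 'a letter \<Rightarrow> 's" and out :: "'s \<Rightarrow> 'a letter \<Rightarrow> 'b letter"
  assumes nxt_closed: "s \<in> S \<Longrightarrow> nxt s l \<in> S"
    and nxt_inv: "s \<in> S \<Longrightarrow> nxt (nxt s l) (inv_letter l) = s"
    and out_inv: "s \<in> S \<Longrightarrow> out (nxt s l) (inv_letter l) = inv_letter (out s l)"
    and out_gen: "s \<in> S \<Longrightarrow> gen l \<in> generators P \<Longrightarrow> gen (out s l) \<in> generators Q"
    and run_relator: "s \<in> S \<Longrightarrow> r \<in> relators P \<Longrightarrow> run nxt s r = s"
    and transduce_relator: "s \<in> S \<Longrightarrow> r \<in> relators P \<Longrightarrow> weq Q (transduce nxt out s r) []"
begin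

lemma run_closed: "s \<in> S \<Longrightarrow> run nxt s u \<in> S"
  by (induction u arbitrary: s) (auto intro: nxt_closed)

lemma transduce_words: "s \<in> S \<Longrightarrow> u \<in> words (generators P) \<Longrightarrow> transduce nxt out s u \<in> words (generators Q)"
  by (induction u arbitrary: s) (auto intro: nxt_closed out_gen)

lemma transduce_weq: "weq P u v \<Longrightarrow> s \<in> S \<Longrightarrow> weq Q (transduce nxt out s u) (transduce nxt out s v)"
proof (induction arbitrary: s rule: weq.induct)
  case (weq_cancel u l v)
  let ?t = "run nxt s u"
  have "?t \<in> S" using weq_cancel run_closed by blast
  then show ?case
    using weq.weq_cancel[of Q "transduce nxt out s u" "out ?t l" "transduce nxt out ?t v"]
    by (simp add: transduce_append nxt_inv out_inv)
next
  case (weq_relator r u v)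
  let ?t = "run nxt s u"
  have t: "?t \<in> S" using weq_relator run_closed by blast
  have "weq Q (transduce nxt out s u @ transduce nxt out ?t r @ transduce nxt out ?t v)
     (transduce nxt out s u @ [] @ transduce nxt out ?t v)"
    by (intro weq_context transduce_relator t weq_relator)
  then show ?case
    using run_relator[OF t] weq_relator by (simp add: transduce_append)
qed (auto intro: weq.intros)

end

text \<open>A pair of mutually inverse machines yields a bijection \<open>\<Phi>\<close> of the presented groups which
  satisfies \<open>\<Phi> (u v) = \<Phi> u \<cdot> \<Phi>\<^sub>s v\<close>, where \<open>s\<close> is the state reached after reading \<open>u\<close>. It is a
  homomorphism on the elements that lead back to the initial state.\<close>

locale machine_pair =
  P: wf_presentation P + Q: wf_presentation Q +
  word_machine P Q S nxt out + inv: word_machine Q P S nxt' out'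
  for P :: "'a presentation" and Q :: "'b presentation" and S :: "'s set"
    and nxt out nxt' out' +
  fixes s0 :: 's
  assumes s0: "s0 \<in> S"
    and nxt'_out: "s \<in> S \<Longrightarrow> gen l \<in> generators P \<Longrightarrow> nxt' s (out s l) = nxt s l"
    and out'_out: "s \<in> S \<Longrightarrow> gen l \<in> generators P \<Longrightarrow> out' s (out s l) = l"
    and out_out': "s \<in> S \<Longrightarrow> gen m \<in> generators Q \<Longrightarrow> out s (out' s m) = m"
begin

lemma run'_transduce:
  "s \<in> S \<Longrightarrow> u \<in> words (generators P) \<Longrightarrow> run nxt' s (transduce nxt out s u) = run nxt s u"
  by (induction u arbitrary: s) (auto simp: nxt'_out nxt_closed)

lemma transduce'_transduce:
  "s \<in> S \<Longrightarrow> u \<in> words (generators P) \<Longrightarrow> transduce nxt' out' s (transduce nxt out s u) = u"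
  by (induction u arbitrary: s) (auto simp: nxt'_out out'_out nxt_closed)

lemma nxt_out': "s \<in> S \<Longrightarrow> gen m \<in> generators Q \<Longrightarrow> nxt s (out' s m) = nxt' s m"
  using nxt'_out[of s "out' s m"] out_out'[of s m] inv.out_gen[of s m] by simp

lemma transduce_transduce':
  "s \<in> S \<Longrightarrow> v \<in> words (generators Q) \<Longrightarrow> transduce nxt out s (transduce nxt' out' s v) = v"
  by (induction v arbitrary: s) (auto simp: nxt_out' out_out' inv.nxt_closed)

definition \<Phi> :: "'a word set \<Rightarrow> 'b word set" where
  "\<Phi> C = word_class Q (transduce nxt out s0 (SOME u. u \<in> words (generators P) \<and> word_class P u = C))"

lemma \<Phi>_word_class:
  assumes u: "u \<in> words (generators P)"
  shows "\<Phi> (word_class P u) = word_class Q (transduce nxt out s0 u)"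
proof -
  let ?v = "SOME v. v \<in> words (generators P) \<and> word_class P v = word_class P u"
  have v: "?v \<in> words (generators P) \<and> word_class P ?v = word_class P u"
    by (rule someI[of _ u]) (use u in auto)
  then have "weq P ?v u" using u P.word_class_eq_iff by blast
  then have "weq Q (transduce nxt out s0 ?v) (transduce nxt out s0 u)"
    using transduce_weq s0 by blast
  then show ?thesis unfolding \<Phi>_def
    using Q.word_class_weq transduce_words[OF s0] u v by blast
qed

lemma bij_\<Phi>: "bij_betw \<Phi> (carrier P.G) (carrier Q.G)"
  unfolding bij_betw_def
proof
  show "inj_on \<Phi> (carrier P.G)"
  proof (rule inj_onI)
    fix C D assume "C \<in> carrier P.G" "D \<in> carrier P.G" "\<Phi> C = \<Phi> D"
    then obtain u v where uv: "u \<in> words (generators P)" "v \<in> words (generators P)"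
      "C = word_class P u" "D = word_class P v"
      "weq Q (transduce nxt out s0 u) (transduce nxt out s0 v)"
      by (auto simp: P.carrier_G \<Phi>_word_class Q.word_class_eq_iff transduce_words s0)
    have "weq P u v" using inv.transduce_weq[OF uv(5) s0] uv
      by (simp add: transduce'_transduce s0)
    then show "C = D" using uv P.word_class_eq_iff by simp
  qed
  show "\<Phi> ` carrier P.G = carrier Q.G"
  proof
    show "\<Phi> ` carrier P.G \<subseteq> carrier Q.G"
      by (auto simp: P.carrier_G \<Phi>_word_class transduce_words s0)
    show "carrier Q.G \<subseteq> \<Phi> ` carrier P.G"
    proof
      fix D assume "D \<in> carrier Q.G"
      then obtain v where v: "v \<in> words (generators Q)" "D = word_class Q v"
        by (auto simp: Q.carrier_G)
      then have "D = \<Phi> (word_class P (transduce nxt' out' s0 v))"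
        by (simp add: \<Phi>_word_class inv.transduce_words s0 transduce_transduce')
      then show "D \<in> \<Phi> ` carrier P.G" using v inv.transduce_words[OF s0] by simp
    qed
  qed
qed

text \<open>Words for elements of \<open>L\<close> lead back to \<open>s0\<close>, so
  \<open>\<Phi>\<close> restricts to an isomorphism from the preimage of \<open>L\<close> onto
  \<open>L\<close>. The last conclusion keeps membership computable on words, as is needed when two
  machines are chained.\<close>

lemma subgroup_transfer:
  assumes L: "subgroup L Q.G"
    and stab: "\<And>v. v \<in> words (generators Q) \<Longrightarrow> word_class Q v \<in> L \<Longrightarrow> run nxt' s0 v = s0"
  obtains H where "subgroup H P.G"
    "P.G\<lparr>carrier := H\<rparr> \<cong> Q.G\<lparr>carrier := L\<rparr>"
    "card (rcosets\<^bsub>P.G\<^esub> H) = card (rcosets\<^bsub>Q.G\<^esub> L)"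
    "\<And>u. u \<in> words (generators P) \<Longrightarrow> word_class P u \<in> H \<longleftrightarrow> word_class Q (transduce nxt out s0 u) \<in> L"
proof -
  interpret L: subgroup L Q.G by (rule L)
  define H where "H = {C \<in> carrier P.G. \<Phi> C \<in> L}"
  have inj: "inj_on \<Phi> (carrier P.G)" and surj: "\<Phi> ` carrier P.G = carrier Q.G"
    using bij_\<Phi> by (auto simp: bij_betw_def)
  \<comment> \<open>Only the left factor has to lie in \<open>H\<close>; the right factor is
    arbitrary, which is why whole cosets are mapped to cosets below.\<close>
  have mult: "\<Phi> (C \<otimes>\<^bsub>P.G\<^esub> D) = \<Phi> C \<otimes>\<^bsub>Q.G\<^esub> \<Phi> D" if CD: "C \<in> H" "D \<in> carrier P.G" for C D
  proof -
    obtain u v where uv: "u \<in> words (generators P)" "v \<in> words (generators P)"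
      "C = word_class P u" "D = word_class P v"
      using CD by (auto simp: P.carrier_G H_def)
    have "run nxt' s0 (transduce nxt out s0 u) = s0"
      using CD uv by (intro stab) (auto simp: transduce_words s0 H_def \<Phi>_word_class)
    then have "run nxt s0 u = s0" using uv by (simp add: run'_transduce s0)
    then show ?thesis using uv
      by (simp add: P.word_class_mult Q.word_class_mult \<Phi>_word_class transduce_append transduce_words s0)
  qed
  have one: "\<Phi> \<one>\<^bsub>P.G\<^esub> = \<one>\<^bsub>Q.G\<^esub>"
    by (simp add: P.one_G Q.one_G \<Phi>_word_class)
  have clos: "\<Phi> C \<in> carrier Q.G" if "C \<in> carrier P.G" for C using that surj by blast
  have sub: "subgroup H P.G"
  proof
    show "inv\<^bsub>P.G\<^esub> C \<in> H" if "C \<in> H" for C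
    proof -
      have C: "C \<in> carrier P.G" using that by (simp add: H_def)
      have "\<Phi> C \<otimes>\<^bsub>Q.G\<^esub> \<Phi> (inv\<^bsub>P.G\<^esub> C) = \<one>\<^bsub>Q.G\<^esub>"
        using mult[OF that, of "inv\<^bsub>P.G\<^esub> C"] C one by simp
      then have "\<Phi> (inv\<^bsub>P.G\<^esub> C) = inv\<^bsub>Q.G\<^esub> (\<Phi> C)"
        using C clos by (metis Q.G.inv_equality Q.G.inv_inv P.G.inv_closed Q.G.inv_closed)
      then show ?thesis using that C by (simp add: H_def)
    qed
  qed (auto simp: one mult H_def intro: L.m_closed)
  have img: "\<Phi> ` H = L"
  proof
    show "L \<subseteq> \<Phi> ` H"
    proof
      fix D assume D: "D \<in> L"
      then obtain C where "C \<in> carrier P.G" "D = \<Phi> C" using L.subset surj by blast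
      then show "D \<in> \<Phi> ` H" using D by (auto simp: H_def)
    qed
  qed (auto simp: H_def)
  have "\<Phi> \<in> iso (P.G\<lparr>carrier := H\<rparr>) (Q.G\<lparr>carrier := L\<rparr>)"
    unfolding iso_def hom_def bij_betw_def
    using img inj mult by (auto simp: H_def inj_on_def)
  then have iso: "P.G\<lparr>carrier := H\<rparr> \<cong> Q.G\<lparr>carrier := L\<rparr>" by (rule is_isoI)
  have coset: "\<Phi> ` (H #>\<^bsub>P.G\<^esub> C) = L #>\<^bsub>Q.G\<^esub> \<Phi> C" if "C \<in> carrier P.G" for C
  proof -
    have "\<Phi> ` (H #>\<^bsub>P.G\<^esub> C) = (\<lambda>h. \<Phi> h \<otimes>\<^bsub>Q.G\<^esub> \<Phi> C) ` H"
      using mult that by (force simp: r_coset_def)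
    also have "\<dots> = L #>\<^bsub>Q.G\<^esub> \<Phi> C"
      unfolding img[symmetric] by (force simp: r_coset_def)
    finally show ?thesis .
  qed
  have "rcosets\<^bsub>Q.G\<^esub> L = (\<lambda>D. L #>\<^bsub>Q.G\<^esub> D) ` \<Phi> ` carrier P.G"
    unfolding surj by (auto simp: RCOSETS_def)
  also have "\<dots> = (`) \<Phi> ` (rcosets\<^bsub>P.G\<^esub> H)"
    using coset by (auto simp: RCOSETS_def image_iff)
  finally have "rcosets\<^bsub>Q.G\<^esub> L = (`) \<Phi> ` (rcosets\<^bsub>P.G\<^esub> H)" .
  moreover have "inj_on ((`) \<Phi>) (rcosets\<^bsub>P.G\<^esub> H)"
  proof -
    have "rcosets\<^bsub>P.G\<^esub> H \<subseteq> Pow (carrier P.G)"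
      using P.G.rcosets_subset_PowG[OF sub] .
    then show ?thesis using inj by (meson inj_on_image_Pow inj_on_subset)
  qed
  ultimately have "card (rcosets\<^bsub>P.G\<^esub> H) = card (rcosets\<^bsub>Q.G\<^esub> L)"
    by (simp add: card_image)
  moreover have "word_class P u \<in> H \<longleftrightarrow> word_class Q (transduce nxt out s0 u) \<in> L"
    if "u \<in> words (generators P)" for u
    using that by (simp add: H_def \<Phi>_word_class)
  ultimately show thesis using that sub iso by blast
qed

end

text \<open>A machine with a single state renames letters without any twist: stability is trivial
  and the whole group is transferred.\<close>

lemma presented_group_iso:
  fixes f :: "'a letter \<Rightarrow> 'b letter"
  assumes wf: "well_formed P" "well_formed Q"
    and f: "\<And>l. f (inv_letter l) = inv_letter (f l)" "\<And>l. gen l \<in> generators P \<Longrightarrow> gen (f l) \<in> generators Q"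
    and g: "\<And>l. g (inv_letter l) = inv_letter (g l)" "\<And>l. gen l \<in> generators Q \<Longrightarrow> gen (g l) \<in> generators P"
    and gf: "\<And>l. gen l \<in> generators P \<Longrightarrow> g (f l) = l" "\<And>l. gen l \<in> generators Q \<Longrightarrow> f (g l) = l"
    and rel: "\<And>r. r \<in> relators P \<Longrightarrow> weq Q (map f r) []" "\<And>r. r \<in> relators Q \<Longrightarrow> weq P (map g r) []"
  shows "presented_group P \<cong> presented_group Q"
proof -
  have r [simp]: "run (\<lambda>_ _. ()) s u = s" for s :: unit and u :: "'c word" by simp
  have t [simp]: "transduce (\<lambda>_ _. ()) (\<lambda>_. h) s u = map h u" for s :: unit and h and u :: "'c word"
    by (induction u) auto
  have t' [simp]: "transduce (\<lambda>_ _. ()) (\<lambda>_. h) s u = map h u" for s :: unit and h and u :: "'d word"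
    by (induction u) auto
  interpret machine_pair P Q "UNIV :: unit set" "\<lambda>_ _. ()" "\<lambda>_. f" "\<lambda>_ _. ()" "\<lambda>_. g" "()"
    by unfold_locales (use assms in auto)
  have full: "subgroup (carrier Q.G) Q.G" by (rule Q.G.subgroup_self)
  obtain H where H: "subgroup H P.G" "P.G\<lparr>carrier := H\<rparr> \<cong> Q.G\<lparr>carrier := carrier Q.G\<rparr>"
    "\<And>u. u \<in> words (generators P) \<Longrightarrow> word_class P u \<in> H \<longleftrightarrow>
       word_class Q (transduce (\<lambda>_ _. ()) (\<lambda>_. f) () u) \<in> carrier Q.G"
    using subgroup_transfer[OF full] by auto
  have "H = carrier P.G"
    using H(1,3) transduce_words[OF s0] by (auto simp: P.carrier_G dest: subgroup.mem_carrier)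
  then show ?thesis using H(2) by simp
qed

section \<open>Reidemeister-Schreier rewriting in free groups\<close>

section \<open>Subgroups of finite index in free groups\<close>

abbreviation free_eq :: "'a word \<Rightarrow> 'a word \<Rightarrow> bool" where
  "free_eq u v \<equiv> free_reduce u = free_reduce v"

lemma free_eq_append: "free_eq u u' \<Longrightarrow> free_eq v v' \<Longrightarrow> free_eq (u @ v) (u' @ v')"
  by (metis free_reduce_append_left free_reduce_append_right)

lemma free_eq_inv_left: "free_eq (inv_word u @ u @ v) v"
  using free_eq_append[of "inv_word u @ u" "[]" v v]
  by (simp add: free_reduce_inv_word) (simp add: free_reduce_def)

lemma free_eq_inv_right: "free_eq (u @ inv_word u) []"
  using free_reduce_inv_word[of "inv_word u"] by (simp add: free_reduce_def)

lemma free_eq_inv_word: "free_eq u v \<Longrightarrow> free_eq (inv_word u) (inv_word v)"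
proof -
  assume "free_eq u v"
  then have "free_eq (inv_word u) (inv_word u @ u @ inv_word v)"
    using free_eq_append[OF refl[of "free_reduce (inv_word u)"], of "[]" "u @ inv_word v"]
      free_eq_append[of u v "inv_word v" "inv_word v"] free_eq_inv_right[of v] by simp
  then show ?thesis using free_eq_inv_left by metis
qed

definition subst :: "('b \<Rightarrow> 'a word) \<Rightarrow> 'b word \<Rightarrow> 'a word" where
  "subst b u = concat (map (\<lambda>l. case l of Pos x \<Rightarrow> b x | Neg x \<Rightarrow> inv_word (b x)) u)"

lemma subst_simps [simp]:
  "subst b [] = []" "subst b (Pos x # u) = b x @ subst b u"
  "subst b (Neg x # u) = inv_word (b x) @ subst b u"
  "subst b (u @ v) = subst b u @ subst b v"
  by (auto simp: subst_def)

lemma subst_inv_word [simp]: "subst b (inv_word u) = inv_word (subst b u)"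
proof (induction u)
  case (Cons l u) then show ?case by (cases l) auto
qed simp

lemma subst_words: "(\<And>x. x \<in> X \<Longrightarrow> b x \<in> words Y) \<Longrightarrow> u \<in> words X \<Longrightarrow> subst b u \<in> words Y"
proof (induction u)
  case (Cons l u) then show ?case by (cases l) auto
qed simp

text \<open>It suffices to treat one \<open>push\<close>: it either prepends the letter or cancels
  an inverse pair, whose images cancel too.\<close>

lemma free_eq_subst: "free_eq u v \<Longrightarrow> free_eq (subst b u) (subst b v)"
proof -
  have push: "free_eq (subst b (push l v)) (subst b [l] @ subst b v)" for l v
  proof (cases v)
    case (Cons k w)
    show ?thesis
    proof (cases "k = inv_letter l")
      case True
      have "subst b [inv_letter l] = inv_word (subst b [l])"
        using subst_inv_word[of b "[l]"] by simp
      then have "free_eq (subst b [l] @ subst b [inv_letter l] @ subst b w) (subst b w)"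
        using free_eq_inv_left[of "subst b [inv_letter l]"] by simp
      moreover have "subst b (k # w) = subst b [k] @ subst b w"
        using subst_simps(4)[of b "[k]" w] by simp
      ultimately show ?thesis using Cons True by simp
    next
      case False
      then show ?thesis using Cons subst_simps(4)[of b "[l]" v] by simp
    qed
  qed simp
  have "free_eq (subst b (free_reduce u)) (subst b u)" for u
  proof (induction u)
    case (Cons l u)
    have "free_eq (subst b (free_reduce (l # u))) (subst b [l] @ subst b (free_reduce u))"
      using push by (simp add: free_reduce_def)
    also have "\<dots> = free_reduce (subst b [l] @ subst b u)"
      using Cons by (intro free_eq_append) auto
    finally show ?case using subst_simps(4)[of b "[l]" u] by simp
  qed (simp add: free_reduce_def)
  then show "free_eq u v \<Longrightarrow> ?thesis" by metis
qed

text \<open>Lets an index be counted as the number of values of a function that separates right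
  cosets; below, this function is the state reached by a word.\<close>

lemma (in group) card_rcosets_eq_card_image:
  assumes H: "subgroup H G"
    and f: "\<And>g h. g \<in> carrier G \<Longrightarrow> h \<in> carrier G \<Longrightarrow> f g = f h \<longleftrightarrow> g \<otimes> inv h \<in> H"
  shows "card (rcosets H) = card (f ` carrier G)"
proof -
  interpret subgroup H G by (rule H)
  have eq: "H #> g = H #> h \<longleftrightarrow> f g = f h" if "g \<in> carrier G" "h \<in> carrier G" for g h
    using that f[of g h] rcos_module[OF is_group, of h g]
    by (metis H repr_independence rcos_self)
  have "rcosets H = (\<lambda>y. H #> (SOME g. g \<in> carrier G \<and> f g = y)) ` f ` carrier G"
  proof -
    have "H #> (SOME h. h \<in> carrier G \<and> f h = f g) = H #> g" if "g \<in> carrier G" for g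
    proof -
      have "(SOME h. h \<in> carrier G \<and> f h = f g) \<in> carrier G \<and> f (SOME h. h \<in> carrier G \<and> f h = f g) = f g"
        by (rule someI[of _ g]) (use that in auto)
      then show ?thesis using eq that by blast
    qed
    then show ?thesis by (auto simp: RCOSETS_def image_image)
  qed
  moreover have "inj_on (\<lambda>y. H #> (SOME g. g \<in> carrier G \<and> f g = y)) (f ` carrier G)"
  proof (rule inj_onI)
    fix y z assume y: "y \<in> f ` carrier G" and z: "z \<in> f ` carrier G"
      and e: "H #> (SOME g. g \<in> carrier G \<and> f g = y) = H #> (SOME g. g \<in> carrier G \<and> f g = z)"
    have *: "(SOME g. g \<in> carrier G \<and> f g = y) \<in> carrier G \<and> f (SOME g. g \<in> carrier G \<and> f g = y) = y"
      if "y \<in> f ` carrier G" for y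
      by (rule someI_ex) (use that in auto)
    show "y = z" using *[OF y] *[OF z] e eq by metis
  qed
  ultimately show ?thesis by (simp add: card_image)
qed

fun label_word :: "('s \<Rightarrow> 'a letter \<Rightarrow> 's) \<Rightarrow> ('s \<Rightarrow> 'a letter \<Rightarrow> 'b word) \<Rightarrow> 's \<Rightarrow> 'a word \<Rightarrow> 'b word" where
  "label_word nxt lab t [] = []"
| "label_word nxt lab t (l # u) = lab t l @ label_word nxt lab (nxt t l) u"

lemma label_word_append:
  "label_word nxt lab t (u @ v) = label_word nxt lab t u @ label_word nxt lab (run nxt t u) v"
  by (induction u arbitrary: t) auto

text \<open>Reidemeister--Schreier rewriting: \<open>T\<close> is the coset space, \<open>rep\<close> a transversal, \<open>b\<close> the
  Schreier generators, and \<open>lab\<close> the rewriting of a letter read at a coset.\<close>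

locale schreier =
  fixes Y :: "'a set" and X :: "'b set" and T :: "'s set" and t0 :: 's
    and nxt :: "'s \<Rightarrow> 'a letter \<Rightarrow> 's" and lab :: "'s \<Rightarrow> 'a letter \<Rightarrow> 'b word"
    and rep :: "'s \<Rightarrow> 'a word" and b :: "'b \<Rightarrow> 'a word"
  assumes t0: "t0 \<in> T"
    and nxt_closed: "t \<in> T \<Longrightarrow> nxt t l \<in> T"
    and nxt_inv: "t \<in> T \<Longrightarrow> nxt (nxt t l) (inv_letter l) = t"
    and lab_inv: "t \<in> T \<Longrightarrow> lab (nxt t l) (inv_letter l) = inv_word (lab t l)"
    and lab_words: "t \<in> T \<Longrightarrow> gen l \<in> Y \<Longrightarrow> lab t l \<in> words X"
    and rep: "t \<in> T \<Longrightarrow> rep t \<in> words Y" "t \<in> T \<Longrightarrow> run nxt t0 (rep t) = t" "rep t0 = []"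
    and b: "x \<in> X \<Longrightarrow> b x \<in> words Y" "x \<in> X \<Longrightarrow> run nxt t0 (b x) = t0"
      "x \<in> X \<Longrightarrow> free_eq (label_word nxt lab t0 (b x)) [Pos x]"
    and subst_lab: "t \<in> T \<Longrightarrow> gen l \<in> Y \<Longrightarrow>
      free_eq (subst b (lab t l)) (rep t @ [l] @ inv_word (rep (nxt t l)))"
begin

abbreviation "H \<equiv> {u \<in> carrier (free_group Y). run nxt t0 u = t0}"

abbreviation "\<rho> \<equiv> label_word nxt lab"

sublocale Y: group "free_group Y" by (rule group_free_group)
sublocale X: group "free_group X" by (rule group_free_group)

lemma run_closed: "t \<in> T \<Longrightarrow> run nxt t u \<in> T"
  by (induction u arbitrary: t) (auto intro: nxt_closed)

lemma run_push: "t \<in> T \<Longrightarrow> run nxt t (push l u) = run nxt t (l # u)"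
  using nxt_inv by (cases u) auto

lemma run_free_reduce: "t \<in> T \<Longrightarrow> run nxt t (free_reduce u) = run nxt t u"
proof (induction u arbitrary: t)
  case (Cons l u)
  have "free_reduce (l # u) = push l (free_reduce u)" by (simp add: free_reduce_def)
  then show ?case using Cons.prems Cons.IH nxt_closed by (simp add: run_push)
qed (simp add: free_reduce_def)

lemma run_inv_word: "t \<in> T \<Longrightarrow> run nxt (run nxt t u) (inv_word u) = t"
  using run_append[of nxt t u "inv_word u"] run_free_reduce[of t "u @ inv_word u"] free_eq_inv_right[of u]
  by (simp add: free_reduce_def)

lemma label_push: "t \<in> T \<Longrightarrow> free_eq (\<rho> t (push l u)) (\<rho> t (l # u))"
proof (cases u)
  case (Cons k w)
  assume t: "t \<in> T"
  show ?thesis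
  proof (cases "k = inv_letter l")
    case True
    then show ?thesis using Cons t nxt_inv lab_inv free_eq_inv_left[of "inv_word (lab t l)" "\<rho> t w"] by simp
  qed (use Cons in simp)
qed simp

lemma label_free_reduce: "t \<in> T \<Longrightarrow> free_eq (\<rho> t (free_reduce u)) (\<rho> t u)"
proof (induction u arbitrary: t)
  case (Cons l u)
  have "free_reduce (l # u) = push l (free_reduce u)" by (simp add: free_reduce_def)
  then have "free_eq (\<rho> t (free_reduce (l # u))) (lab t l @ \<rho> (nxt t l) (free_reduce u))"
    using Cons.prems label_push by simp
  also have "\<dots> = free_reduce (lab t l @ \<rho> (nxt t l) u)"
    using Cons nxt_closed by (intro free_eq_append) auto
  finally show ?case by simp
qed (simp add: free_reduce_def)

lemma label_words: "t \<in> T \<Longrightarrow> u \<in> words Y \<Longrightarrow> \<rho> t u \<in> words X"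
  by (induction u arbitrary: t) (auto intro: lab_words nxt_closed)

lemma label_inv_word: "t \<in> T \<Longrightarrow> \<rho> (run nxt t u) (inv_word u) = inv_word (\<rho> t u)"
proof (induction u arbitrary: t)
  case (Cons l u)
  then show ?case
    using run_inv_word[of "nxt t l" u] by (simp add: label_word_append nxt_closed lab_inv)
qed simp

lemma run_subst: "u \<in> words X \<Longrightarrow> run nxt t0 (subst b u) = t0"
proof (induction u)
  case (Cons l u)
  then show ?case using b(2) run_inv_word[OF t0, of "b (gen l)"]
    by (cases l) (auto simp: run_append)
qed simp

lemma label_subst: "u \<in> words X \<Longrightarrow> free_eq (\<rho> t0 (subst b u)) u"
proof (induction u)
  case (Cons l u)
  have x: "gen l \<in> X" using Cons by simp
  show ?case
  proof (cases l)
    case (Pos x)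
    then show ?thesis
      using Cons x b(2,3)[of x] free_eq_append[of "\<rho> t0 (b x)" "[Pos x]" "\<rho> t0 (subst b u)" u]
      by (simp add: label_word_append)
  next
    case (Neg x)
    have "\<rho> t0 (inv_word (b x)) = inv_word (\<rho> t0 (b x))" "run nxt t0 (inv_word (b x)) = t0"
      using label_inv_word[OF t0, of "b x"] run_inv_word[OF t0, of "b x"] b(2)[of x] x Neg by auto
    moreover have "free_eq (inv_word (\<rho> t0 (b x))) [Neg x]"
      using free_eq_inv_word[OF b(3)[of x]] x Neg by simp
    ultimately show ?thesis
      using Neg Cons free_eq_append[of "inv_word (\<rho> t0 (b x))" "[Neg x]" "\<rho> t0 (subst b u)" u]
      by (simp add: label_word_append)
  qed
qed simp

text \<open>A telescoping product: the inverse representative that ends the contribution of one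
  letter cancels the representative that starts the next.\<close>

lemma subst_label:
  "t \<in> T \<Longrightarrow> u \<in> words Y \<Longrightarrow> free_eq (subst b (\<rho> t u)) (rep t @ u @ inv_word (rep (run nxt t u)))"
proof (induction u arbitrary: t)
  case Nil
  then show ?case using free_eq_inv_right[of "rep t"] by simp
next
  case (Cons l u)
  let ?t = "nxt t l"
  have "free_eq (subst b (lab t l) @ subst b (\<rho> ?t u))
     ((rep t @ [l] @ inv_word (rep ?t)) @ (rep ?t @ u @ inv_word (rep (run nxt ?t u))))"
    using Cons nxt_closed subst_lab by (intro free_eq_append) auto
  also have "\<dots> = free_reduce ((rep t @ [l]) @ u @ inv_word (rep (run nxt ?t u)))"
    using free_eq_append[OF refl[of "free_reduce (rep t @ [l])"] free_eq_inv_left[of "rep ?t" "u @ inv_word (rep (run nxt ?t u))"]]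
    by simp
  finally show ?case by simp
qed

lemma subgroup_H: "subgroup H (free_group Y)"
proof
  show "x \<otimes>\<^bsub>free_group Y\<^esub> y \<in> H" if "x \<in> H" "y \<in> H" for x y
    using that Y.m_closed[of x y] t0 by (simp add: mult_free_group run_free_reduce run_append)
  show "inv\<^bsub>free_group Y\<^esub> x \<in> H" if "x \<in> H" for x
    using that Y.inv_closed[of x] run_inv_word[OF t0, of x] by (auto simp: inv_free_group)
qed (auto simp: one_free_group carrier_free_group)

lemma H_iso: "free_group Y\<lparr>carrier := H\<rparr> \<cong> free_group X"
proof -
  let ?f = "\<lambda>u. free_reduce (\<rho> t0 u)" and ?g = "\<lambda>v. free_reduce (subst b v)"
  have "?f \<in> hom (free_group Y\<lparr>carrier := H\<rparr>) (free_group X)"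
  proof (rule homI)
    show "?f u \<in> carrier (free_group X)" if "u \<in> carrier (free_group Y\<lparr>carrier := H\<rparr>)" for u
      using that by (simp add: carrier_free_group words_free_reduce label_words t0)
    show "?f (u \<otimes>\<^bsub>free_group Y\<lparr>carrier := H\<rparr>\<^esub> v) = ?f u \<otimes>\<^bsub>free_group X\<^esub> ?f v"
      if "u \<in> carrier (free_group Y\<lparr>carrier := H\<rparr>)" "v \<in> carrier (free_group Y\<lparr>carrier := H\<rparr>)" for u v
      using that by (simp add: mult_free_group label_free_reduce t0 label_word_append
          free_reduce_append_left free_reduce_append_right)
  qed
  moreover have "bij_betw ?f H (carrier (free_group X))"
  proof (rule bij_betw_byWitness[where f' = ?g])
    show "\<forall>u\<in>H. ?g (?f u) = u"
    proof
      fix u assume u: "u \<in> H"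
      have "free_eq (subst b (?f u)) (subst b (\<rho> t0 u))" by (rule free_eq_subst) simp
      \<comment> \<open>A word in \<open>H\<close> is a closed path at \<open>t0\<close>, where the
        representative is empty, so \<open>subst_label\<close> returns the word itself.\<close>
      also have "free_reduce (subst b (\<rho> t0 u)) = free_reduce u"
        using subst_label[OF t0, of u] u by (simp add: carrier_free_group rep)
      finally show "?g (?f u) = u" using u by (simp add: carrier_free_group free_reduce_reduced)
    qed
    show "\<forall>v\<in>carrier (free_group X). ?f (?g v) = v"
      using label_free_reduce[OF t0] label_subst by (simp add: carrier_free_group free_reduce_reduced)
    show "?f ` H \<subseteq> carrier (free_group X)"
      by (auto simp: carrier_free_group words_free_reduce label_words t0)
    show "?g ` carrier (free_group X) \<subseteq> H"
      using subst_words[of X b Y] b(1) by (auto simp: carrier_free_group words_free_reduce run_free_reduce t0 run_subst)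
  qed
  ultimately show ?thesis by (auto simp: is_iso_def iso_def)
qed

text \<open>Reading \<open>inv_word h\<close> reverses the path of \<open>h\<close>, so right cosets
  of \<open>H\<close> correspond to final states, and the transversal reaches every state.\<close>

lemma index_H: "card (rcosets\<^bsub>free_group Y\<^esub> H) = card T"
proof -
  have "card (rcosets\<^bsub>free_group Y\<^esub> H) = card (run nxt t0 ` carrier (free_group Y))"
  proof (rule Y.card_rcosets_eq_card_image[OF subgroup_H])
    fix g h assume g: "g \<in> carrier (free_group Y)" and h: "h \<in> carrier (free_group Y)"
    let ?s = "run nxt t0 g" and ?t = "run nxt t0 h"
    have "run nxt ?s (inv_word h) = t0 \<longleftrightarrow> ?s = ?t"
    proof
      assume "run nxt ?s (inv_word h) = t0"
      then show "?s = ?t"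
        using run_inv_word[OF run_closed[OF t0, of g], of "inv_word h"] by simp
    qed (simp add: run_inv_word t0)
    then show "?s = ?t \<longleftrightarrow> g \<otimes>\<^bsub>free_group Y\<^esub> inv\<^bsub>free_group Y\<^esub> h \<in> H"
      using g h Y.m_closed[OF g Y.inv_closed[OF h]]
      by (simp add: inv_free_group mult_free_group run_free_reduce t0 run_append)
  qed
  also have "run nxt t0 ` carrier (free_group Y) = T"
  proof
    show "T \<subseteq> run nxt t0 ` carrier (free_group Y)"
    proof
      fix t assume "t \<in> T"
      then have "t = run nxt t0 (free_reduce (rep t))" "free_reduce (rep t) \<in> carrier (free_group Y)"
        using rep t0 by (auto simp: run_free_reduce free_reduce_in_carrier)
      then show "t \<in> run nxt t0 ` carrier (free_group Y)" by blast
    qed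
  qed (use run_closed t0 in auto)
  finally show ?thesis .
qed

end

section \<open>Exponent sums, letter counts and three subgroups of finite index in
  \<open>F2\<close>\<close>

definition esum :: "'a word \<Rightarrow> int" where
  "esum u = (\<Sum>l\<leftarrow>u. case l of Pos _ \<Rightarrow> 1 | Neg _ \<Rightarrow> - 1)"

lemma esum_simps [simp]:
  "esum [] = 0" "esum (Pos x # u) = 1 + esum u" "esum (Neg x # u) = esum u - 1"
  "esum (u @ v) = esum u + esum v"
  by (auto simp: esum_def)

definition count_gen :: "'a \<Rightarrow> 'a word \<Rightarrow> nat" where
  "count_gen x u = length (filter (\<lambda>l. gen l = x) u)"

lemma count_gen_simps [simp]:
  "count_gen x [] = 0" "count_gen x (l # u) = (if gen l = x then 1 else 0) + count_gen x u"
  "count_gen x (u @ v) = count_gen x u + count_gen x v"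
  by (auto simp: count_gen_def)

lemma lessThan_3: "{..<3::nat} = {0, 1, 2}" and lessThan_4: "{..<4::nat} = {0, 1, 2, 3}"
  and lessThan_5: "{..<5::nat} = {0, 1, 2, 3, 4}" and lessThan_2: "{..<2::nat} = {0, 1}"
  by auto

text \<open>The summand \<open>m - 1\<close> plays the role of \<open>- 1\<close>, since states are
  natural numbers.\<close>

definition cyc_nxt :: "nat \<Rightarrow> nat \<Rightarrow> 'a letter \<Rightarrow> nat" where
  "cyc_nxt m t l = (case l of Pos _ \<Rightarrow> (t + 1) mod m | Neg _ \<Rightarrow> (t + (m - 1)) mod m)"

lemma run_cyc_nxt: "m > 0 \<Longrightarrow> int (run (cyc_nxt m) t u) mod int m = (int t + esum u) mod int m"
proof (induction u arbitrary: t)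
  case (Cons l u)
  have "int (cyc_nxt m t l) mod int m = (int t + esum [l]) mod int m"
  proof (cases l)
    case (Neg x)
    have "(int t + int (m - 1)) mod int m = (int t - 1 + int m) mod int m"
      using Cons.prems by (simp add: of_nat_diff algebra_simps)
    also have "\<dots> = (int t - 1) mod int m" by (rule mod_add_self2)
    finally show ?thesis using Neg by (simp add: cyc_nxt_def zmod_int)
  qed (simp add: cyc_nxt_def zmod_int add.commute)
  then have "(int (cyc_nxt m t l) + esum u) mod int m = (int t + esum [l] + esum u) mod int m"
    by (metis mod_add_left_eq)
  then show ?case using Cons.IH[of "cyc_nxt m t l"] Cons.prems
    by (cases l) (simp_all add: algebra_simps)
qed simp

text \<open>Write \<open>a\<close>, \<open>b\<close> for the letters 0, 1. The transversal consists
  of the powers \<open>a^t\<close>, so reading \<open>a\<close> is free of charge except at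
  \<open>t = m - 1\<close>, where the cycle closes. A negative letter is the inverse of the label at
  the coset it leads to.\<close>

definition cyc_lab :: "nat \<Rightarrow> nat \<Rightarrow> nat letter \<Rightarrow> nat word" where
  "cyc_lab m t l = (case l of
     Pos g \<Rightarrow> if g = 0 then (if t = m - 1 then [Pos m] else []) else [Pos t]
   | Neg g \<Rightarrow> let t = (t + (m - 1)) mod m in if g = 0 then (if t = m - 1 then [Neg m] else []) else [Neg t])"

text \<open>The number \<open>m\<close> names \<open>a^m\<close>, and \<open>x < m\<close> names
  \<open>a^x b a^-(x+1)\<close>, with the last exponent taken modulo \<open>m\<close>. These are
  \<open>m + 1\<close> generators, as Schreier's rank formula predicts for index \<open>m\<close> in
  rank two.\<close>

definition cyc_gen :: "nat \<Rightarrow> nat \<Rightarrow> nat word" where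
  "cyc_gen m x = (if x = m then replicate m (Pos 0)
     else replicate x (Pos 0) @ [Pos 1] @ replicate ((x + 1) mod m) (Neg 0))"

lemma replicate_small [simp]:
  "replicate 2 x = [x, x]" "replicate 3 x = [x, x, x]" "replicate 4 x = [x, x, x, x]"
  by (simp_all add: numeral_eq_Suc)

lemma funpow_small: "(f ^^ 2) x = f (f x)" "(f ^^ 3) x = f (f (f x))"
  by (simp_all add: numeral_eq_Suc)

lemma schreier_cyc_2:
  "schreier {..<2} {..<3} {..<2} 0 (cyc_nxt 2) (cyc_lab 2) (\<lambda>t. replicate t (Pos 0)) (cyc_gen 2)"
proof
  fix t :: nat and l :: "nat letter" assume t: "t \<in> {..<2}"
  show "cyc_nxt 2 (cyc_nxt 2 t l) (inv_letter l) = t"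
    "cyc_lab 2 (cyc_nxt 2 t l) (inv_letter l) = inv_word (cyc_lab 2 t l)"
    using t by (cases l; auto simp: lessThan_2 cyc_nxt_def cyc_lab_def)+
  assume "gen l \<in> {..<2}"
  then have l: "l \<in> {Pos 0, Neg 0, Pos 1, Neg 1}" by (cases l) (auto simp: lessThan_2)
  show "cyc_lab 2 t l \<in> words {..<3}"
    using t l by (auto simp: lessThan_2 cyc_lab_def)
  show "free_eq (subst (cyc_gen 2) (cyc_lab 2 t l)) (replicate t (Pos 0) @ [l] @ inv_word (replicate (cyc_nxt 2 t l) (Pos 0)))"
    using t l by (auto simp: lessThan_2 cyc_nxt_def cyc_lab_def cyc_gen_def free_reduce_def)
qed (auto simp: lessThan_2 lessThan_3 cyc_nxt_def cyc_lab_def cyc_gen_def free_reduce_def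
  split: letter.splits)

lemma schreier_cyc_4:
  "schreier {..<2} {..<5} {..<4} 0 (cyc_nxt 4) (cyc_lab 4) (\<lambda>t. replicate t (Pos 0)) (cyc_gen 4)"
proof
  fix t :: nat and l :: "nat letter" assume t: "t \<in> {..<4}"
  show "cyc_nxt 4 (cyc_nxt 4 t l) (inv_letter l) = t"
    "cyc_lab 4 (cyc_nxt 4 t l) (inv_letter l) = inv_word (cyc_lab 4 t l)"
    using t by (cases l; auto simp: lessThan_4 cyc_nxt_def cyc_lab_def)+
  assume "gen l \<in> {..<2}"
  then have l: "l \<in> {Pos 0, Neg 0, Pos 1, Neg 1}" by (cases l) (auto simp: lessThan_2)
  show "cyc_lab 4 t l \<in> words {..<5}"
    using t l by (auto simp: lessThan_4 cyc_lab_def)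
  show "free_eq (subst (cyc_gen 4) (cyc_lab 4 t l)) (replicate t (Pos 0) @ [l] @ inv_word (replicate (cyc_nxt 4 t l) (Pos 0)))"
    using t l by (auto simp: lessThan_4 cyc_nxt_def cyc_lab_def cyc_gen_def free_reduce_def funpow_small)
qed (auto simp: lessThan_2 lessThan_4 lessThan_5 cyc_nxt_def cyc_lab_def cyc_gen_def free_reduce_def
  split: letter.splits)

text \<open>The state \<open>i + 2 j\<close> records the parities \<open>i\<close> and \<open>j\<close> of the two letter counts.\<close>

definition par_nxt :: "nat \<Rightarrow> nat letter \<Rightarrow> nat" where
  "par_nxt t l = (if gen l = 0 then (if even t then t + 1 else t - 1) else (t + 2) mod 4)"

text \<open>For positive letters, the three empty labels belong to the edges of the spanning tree
  with vertices \<open>1\<close>, \<open>a\<close>, \<open>b\<close>, \<open>ab\<close>; each of the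
  other five edges carries its own free generator, whence rank 5.\<close>

definition par_lab :: "nat \<Rightarrow> nat letter \<Rightarrow> nat word" where
  "par_lab t l = (let
     tab = (\<lambda>t g. if g = 0 then [[], [Pos 0], [Pos 1], [Pos 3]] ! t else [[], [], [Pos 2], [Pos 4]] ! t)
   in case l of Pos g \<Rightarrow> tab t g | Neg g \<Rightarrow> inv_word (tab (par_nxt t l) g))"

definition par_rep :: "nat \<Rightarrow> nat word" where
  "par_rep t = [[], [Pos 0], [Pos 1], [Pos 0, Pos 1]] ! t"

definition par_gen :: "nat \<Rightarrow> nat word" where
  "par_gen x = [[Pos 0, Pos 0], [Pos 1, Pos 0, Neg 1, Neg 0], [Pos 1, Pos 1],
     [Pos 0, Pos 1, Pos 0, Neg 1], [Pos 0, Pos 1, Pos 1, Neg 0]] ! x"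

lemma schreier_par: "schreier {..<2} {..<5} {..<4} 0 par_nxt par_lab par_rep par_gen"
proof
  fix t :: nat and l :: "nat letter" assume t: "t \<in> {..<4}"
  show "par_nxt (par_nxt t l) (inv_letter l) = t"
    "par_lab (par_nxt t l) (inv_letter l) = inv_word (par_lab t l)"
    using t by (cases l; auto simp: lessThan_4 par_nxt_def par_lab_def Let_def)+
  assume "gen l \<in> {..<2}"
  then have l: "l \<in> {Pos 0, Neg 0, Pos 1, Neg 1}" by (cases l) (auto simp: lessThan_2)
  show "par_lab t l \<in> words {..<5}"
    using t l by (auto simp: lessThan_4 par_lab_def par_nxt_def Let_def)
  show "free_eq (subst par_gen (par_lab t l)) (par_rep t @ [l] @ inv_word (par_rep (par_nxt t l)))"
    using t l by (auto simp: lessThan_4 par_nxt_def par_lab_def par_rep_def par_gen_def free_reduce_def Let_def)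
qed (auto simp: lessThan_2 lessThan_4 lessThan_5 par_nxt_def par_lab_def par_rep_def par_gen_def free_reduce_def Let_def
  split: letter.splits)

lemma run_par_nxt:
  "t \<in> {..<4} \<Longrightarrow> u \<in> words {..<2} \<Longrightarrow>
    run par_nxt t u \<in> {..<4} \<and> (odd (run par_nxt t u) \<longleftrightarrow> odd (t + count_gen 0 u)) \<and>
    (odd (run par_nxt t u div 2) \<longleftrightarrow> odd (t div 2 + count_gen 1 u))"
proof (induction u arbitrary: t)
  case (Cons l u)
  have l: "gen l = 0 \<or> gen l = 1" using Cons.prems by auto
  have "par_nxt t l \<in> {..<4}" using Cons.prems l by (auto simp: lessThan_4 par_nxt_def)
  moreover have "odd (par_nxt t l) \<longleftrightarrow> odd (t + (if gen l = 0 then 1 else 0))"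
    "odd (par_nxt t l div 2) \<longleftrightarrow> odd (t div 2 + (if gen l = 1 then 1 else 0))"
    using Cons.prems(1) l by (auto simp: lessThan_4 par_nxt_def)
  moreover have "u \<in> words {..<2}" using Cons.prems by simp
  ultimately show ?case using Cons.IH[of "par_nxt t l"] l
    by (cases "gen l = 0"; simp del: lessThan_iff; blast)
qed simp

lemma run_par_nxt_0:
  assumes "u \<in> words {..<2}"
  shows "run par_nxt 0 u = 0 \<longleftrightarrow> even (count_gen 0 u) \<and> even (count_gen 1 u)"
proof -
  have "run par_nxt 0 u = 0 \<longleftrightarrow> even (run par_nxt 0 u) \<and> even (run par_nxt 0 u div 2)"
    using run_par_nxt[OF _ assms, of 0] by (auto simp: lessThan_4)
  then show ?thesis using run_par_nxt[OF _ assms, of 0] by simp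
qed

lemma run_cyc_nxt_0: "m > 0 \<Longrightarrow> run (cyc_nxt m) 0 u = 0 \<longleftrightarrow> int m dvd esum u"
proof -
  assume m: "m > 0"
  have "run (cyc_nxt m) t u < m" if "t < m" for t
    using that m by (induction u arbitrary: t) (auto simp: cyc_nxt_def split: letter.splits)
  then have "run (cyc_nxt m) 0 u mod m = run (cyc_nxt m) 0 u" using m by simp
  then show ?thesis using run_cyc_nxt[OF m, of 0 u]
    by (metis add_0 dvd_eq_mod_eq_0 of_nat_0 of_nat_eq_0_iff zmod_int)
qed

lemma free_group_esum_2:
  "subgroup {u \<in> carrier (free_group {..<2::nat}). 2 dvd esum u} (free_group {..<2})"
  "free_group {..<2::nat}\<lparr>carrier := {u \<in> carrier (free_group {..<2}). 2 dvd esum u}\<rparr> \<cong> free_group {..<3::nat}"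
  "card (rcosets\<^bsub>free_group {..<2::nat}\<^esub> {u \<in> carrier (free_group {..<2}). 2 dvd esum u}) = 2"
proof -
  interpret schreier "{..<2::nat}" "{..<3::nat}" "{..<2::nat}" 0 "cyc_nxt 2" "cyc_lab 2" "\<lambda>t. replicate t (Pos 0)" "cyc_gen 2"
    by (rule schreier_cyc_2)
  have eq: "H = {u \<in> carrier (free_group {..<2::nat}). 2 dvd esum u}"
    using run_cyc_nxt_0[of 2] by auto
  show "subgroup {u \<in> carrier (free_group {..<2::nat}). 2 dvd esum u} (free_group {..<2})"
    using subgroup_H unfolding eq .
  show "free_group {..<2::nat}\<lparr>carrier := {u \<in> carrier (free_group {..<2}). 2 dvd esum u}\<rparr> \<cong> free_group {..<3::nat}"
    using H_iso unfolding eq .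
  show "card (rcosets\<^bsub>free_group {..<2::nat}\<^esub> {u \<in> carrier (free_group {..<2}). 2 dvd esum u}) = 2"
    using index_H unfolding eq by simp
qed

lemma free_group_esum_4:
  "subgroup {u \<in> carrier (free_group {..<2::nat}). 4 dvd esum u} (free_group {..<2})"
  "free_group {..<2::nat}\<lparr>carrier := {u \<in> carrier (free_group {..<2}). 4 dvd esum u}\<rparr> \<cong> free_group {..<5::nat}"
  "card (rcosets\<^bsub>free_group {..<2::nat}\<^esub> {u \<in> carrier (free_group {..<2}). 4 dvd esum u}) = 4"
proof -
  interpret schreier "{..<2::nat}" "{..<5::nat}" "{..<4::nat}" 0 "cyc_nxt 4" "cyc_lab 4" "\<lambda>t. replicate t (Pos 0)" "cyc_gen 4"
    by (rule schreier_cyc_4)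
  have eq: "H = {u \<in> carrier (free_group {..<2::nat}). 4 dvd esum u}"
    using run_cyc_nxt_0[of 4] by auto
  show "subgroup {u \<in> carrier (free_group {..<2::nat}). 4 dvd esum u} (free_group {..<2})"
    using subgroup_H unfolding eq .
  show "free_group {..<2::nat}\<lparr>carrier := {u \<in> carrier (free_group {..<2}). 4 dvd esum u}\<rparr> \<cong> free_group {..<5::nat}"
    using H_iso unfolding eq .
  show "card (rcosets\<^bsub>free_group {..<2::nat}\<^esub> {u \<in> carrier (free_group {..<2}). 4 dvd esum u}) = 4"
    using index_H unfolding eq by simp
qed

lemma free_group_parities:
  defines "E \<equiv> {u \<in> carrier (free_group {..<2::nat}). even (count_gen 0 u) \<and> even (count_gen 1 u)}"
  shows "subgroup E (free_group {..<2})"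
  "free_group {..<2::nat}\<lparr>carrier := E\<rparr> \<cong> free_group {..<5::nat}"
  "card (rcosets\<^bsub>free_group {..<2::nat}\<^esub> E) = 4"
proof -
  interpret schreier "{..<2::nat}" "{..<5::nat}" "{..<4::nat}" 0 par_nxt par_lab par_rep par_gen
    by (rule schreier_par)
  have eq: "H = E"
    using run_par_nxt_0 by (auto simp: E_def carrier_free_group)
  show "subgroup E (free_group {..<2})" using subgroup_H unfolding eq .
  show "free_group {..<2::nat}\<lparr>carrier := E\<rparr> \<cong> free_group {..<5::nat}" using H_iso unfolding eq .
  show "card (rcosets\<^bsub>free_group {..<2::nat}\<^esub> E) = 4" using index_H unfolding eq by simp
qed

section \<open>Products and embeddings\<close>

text \<open>A coset of the product is the product of two cosets, and it determines both.\<close>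

lemma card_rcosets_DirProd:
  assumes "group G" "group K" and H: "subgroup H G" and M: "subgroup M K"
  shows "card (rcosets\<^bsub>G \<times>\<times> K\<^esub> (H \<times> M)) = card (rcosets\<^bsub>G\<^esub> H) * card (rcosets\<^bsub>K\<^esub> M)"
proof -
  interpret G: group G by fact
  interpret K: group K by fact
  interpret H: subgroup H G by fact
  interpret M: subgroup M K by fact
  have c: "(H \<times> M) #>\<^bsub>G \<times>\<times> K\<^esub> (g, k) = (H #>\<^bsub>G\<^esub> g) \<times> (M #>\<^bsub>K\<^esub> k)" for g k
  proof (rule Set.set_eqI)
    fix z
    show "z \<in> (H \<times> M) #>\<^bsub>G \<times>\<times> K\<^esub> (g, k) \<longleftrightarrow> z \<in> (H #>\<^bsub>G\<^esub> g) \<times> (M #>\<^bsub>K\<^esub> k)"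
    proof (cases z)
      case (Pair a b)
      then show ?thesis by (simp add: r_coset_def)
    qed
  qed
  have "rcosets\<^bsub>G \<times>\<times> K\<^esub> (H \<times> M)
      = (\<lambda>p. (H #>\<^bsub>G\<^esub> fst p) \<times> (M #>\<^bsub>K\<^esub> snd p)) ` (carrier G \<times> carrier K)"
    by (simp add: RCOSETS_def UNION_singleton_eq_range c split_paired_all cong: image_cong)
       (rule image_cong, auto simp: c)
  also have "\<dots> = (\<lambda>(A, B). A \<times> B) ` (((\<lambda>g. H #>\<^bsub>G\<^esub> g) ` carrier G) \<times> ((\<lambda>k. M #>\<^bsub>K\<^esub> k) ` carrier K))"
    by force
  also have "\<dots> = (\<lambda>(A, B). A \<times> B) ` ((rcosets\<^bsub>G\<^esub> H) \<times> (rcosets\<^bsub>K\<^esub> M))"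
    by (simp add: RCOSETS_def UNION_singleton_eq_range)
  finally have "rcosets\<^bsub>G \<times>\<times> K\<^esub> (H \<times> M) = (\<lambda>(A, B). A \<times> B) ` ((rcosets\<^bsub>G\<^esub> H) \<times> (rcosets\<^bsub>K\<^esub> M))" .
  moreover have "inj_on (\<lambda>(A, B). A \<times> B) ((rcosets\<^bsub>G\<^esub> H) \<times> (rcosets\<^bsub>K\<^esub> M))"
  proof -
    \<comment> \<open>Nonemptiness matters: a product with an empty factor would not determine the
      other factor.\<close>
    have "A \<noteq> {}" if "A \<in> rcosets\<^bsub>G\<^esub> H" for A using that H.rcosets_non_empty by blast
    moreover have "B \<noteq> {}" if "B \<in> rcosets\<^bsub>K\<^esub> M" for B using that M.rcosets_non_empty by blast
    ultimately show ?thesis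
      unfolding inj_on_def by (simp add: split_paired_all times_eq_iff)
  qed
  ultimately show ?thesis by (simp add: card_image card_cartesian_product)
qed

lemma DirProd_restrict: "(G \<times>\<times> K)\<lparr>carrier := H \<times> M\<rparr> = G\<lparr>carrier := H\<rparr> \<times>\<times> K\<lparr>carrier := M\<rparr>"
  by (simp add: DirProd_def)

lemma subgroup_iso_image:
  assumes G: "group G" and K: "group K" and h: "h \<in> iso G K" and H: "subgroup H K"
  defines "L \<equiv> {g \<in> carrier G. h g \<in> H}"
  shows "subgroup L G" "G\<lparr>carrier := L\<rparr> \<cong> K\<lparr>carrier := H\<rparr>"
    "card (rcosets\<^bsub>G\<^esub> L) = card (rcosets\<^bsub>K\<^esub> H)"
proof -
  interpret group_hom G K h
    using G K h by (simp add: group_hom_def group_hom_axioms_def iso_def)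
  interpret H: subgroup H K by (rule H)
  have inj: "inj_on h (carrier G)" and surj: "h ` carrier G = carrier K"
    using h by (auto simp: iso_def bij_betw_def)
  show sub: "subgroup L G"
  proof (rule G.subgroupI)
    have "\<one>\<^bsub>G\<^esub> \<in> L" by (simp add: L_def)
    then show "L \<noteq> {}" by blast
  qed (auto simp: L_def)
  have img: "h ` L = H"
  proof
    show "H \<subseteq> h ` L"
    proof
      fix y assume y: "y \<in> H"
      then obtain g where "g \<in> carrier G" "y = h g" using surj H.subset by blast
      then show "y \<in> h ` L" using y by (auto simp: L_def)
    qed
  qed (auto simp: L_def)
  have "h \<in> iso (G\<lparr>carrier := L\<rparr>) (K\<lparr>carrier := H\<rparr>)"
    using img inj by (auto simp: iso_def hom_def bij_betw_def L_def inj_on_def)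
  then show "G\<lparr>carrier := L\<rparr> \<cong> K\<lparr>carrier := H\<rparr>" by (rule is_isoI)
  have coset: "h ` (L #>\<^bsub>G\<^esub> g) = H #>\<^bsub>K\<^esub> h g" if "g \<in> carrier G" for g
  proof -
    have "h ` (L #>\<^bsub>G\<^esub> g) = (\<lambda>x. h x \<otimes>\<^bsub>K\<^esub> h g) ` L"
      using that by (force simp: r_coset_def L_def)
    also have "\<dots> = H #>\<^bsub>K\<^esub> h g"
      unfolding img[symmetric] by (force simp: r_coset_def)
    finally show ?thesis .
  qed
  have "rcosets\<^bsub>K\<^esub> H = (\<lambda>D. H #>\<^bsub>K\<^esub> D) ` h ` carrier G"
    unfolding surj by (auto simp: RCOSETS_def)
  also have "\<dots> = (`) h ` (rcosets\<^bsub>G\<^esub> L)"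
    using coset by (auto simp: RCOSETS_def image_iff)
  finally have "rcosets\<^bsub>K\<^esub> H = (`) h ` (rcosets\<^bsub>G\<^esub> L)" .
  moreover have "inj_on ((`) h) (rcosets\<^bsub>G\<^esub> L)"
    using G.rcosets_subset_PowG[OF sub] inj by (meson inj_on_image_Pow inj_on_subset)
  ultimately show "card (rcosets\<^bsub>G\<^esub> L) = card (rcosets\<^bsub>K\<^esub> H)"
    by (simp add: card_image)
qed

section \<open>Cyclic presentations\<close>

text \<open>Closed form of the \<open>i\<close>-th power of the shift, for every natural
  \<open>i\<close>.\<close>

definition shift_by :: "nat \<Rightarrow> nat \<Rightarrow> nat word \<Rightarrow> nat word" where
  "shift_by n i = map (map_letter (\<lambda>j. (j + i) mod n))"

lemma shift_by_simps [simp]: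
  "shift_by n i [] = []" "shift_by n i (Pos j # u) = Pos ((j + i) mod n) # shift_by n i u"
  "shift_by n i (Neg j # u) = Neg ((j + i) mod n) # shift_by n i u"
  by (auto simp: shift_by_def)

lemma gen_map_letter [simp]: "gen (map_letter f l) = f (gen l)"
  by (cases l) auto

lemma map_letter_inv_letter: "map_letter f (inv_letter l) = inv_letter (map_letter f l)"
  by (cases l) auto

lemma shift_word_power:
  assumes "w \<in> words {..<n}"
  shows "(shift_word n ^^ i) w = shift_by n i w"
proof (induction i)
  case 0
  show ?case using assms
  proof (induction w)
    case (Cons l w) then show ?case by (cases l) auto
  qed simp
next
  case (Suc i)
  have "map_letter (\<lambda>i. (i + 1) mod n) (map_letter (\<lambda>j. (j + i) mod n) l) = map_letter (\<lambda>j. (j + Suc i) mod n) l" for l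
    by (cases l) (auto simp: mod_simps)
  with Suc show ?case by (simp add: shift_word_def shift_by_def)
qed

lemma generators_cyclic [simp]: "generators (cyclic_presentation n w) = {..<n}"
  by (simp add: cyclic_presentation_def)

lemma relators_cyclic:
  "w \<in> words {..<n} \<Longrightarrow> relators (cyclic_presentation n w) = (\<lambda>i. shift_by n i w) ` {..<n}"
  by (simp add: cyclic_presentation_def shift_word_power)

lemma shift_by_relator:
  "n > 0 \<Longrightarrow> w \<in> words {..<n} \<Longrightarrow> shift_by n i w \<in> relators (cyclic_presentation n w)"
proof -
  assume n: "n > 0" and w: "w \<in> words {..<n}"
  have "shift_by n i w = shift_by n (i mod n) w"
    by (auto simp: shift_by_def mod_simps intro!: letter.map_cong)
  then show ?thesis using n by (simp add: relators_cyclic[OF w])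
qed

lemma inj_on_shift: "inj_on (\<lambda>j. (j + i) mod n) {..<n}" for i n :: nat
proof (rule inj_onI)
  fix x y assume "x \<in> {..<n}" "y \<in> {..<n}" "(x + i) mod n = (y + i) mod n"
  then have "[x + i = y + i] (mod n)" by (simp add: cong_def)
  then have "[x = y] (mod n)" by (simp add: cong_add_rcancel_nat)
  then show "x = y" using \<open>x \<in> _\<close> \<open>y \<in> _\<close> by (simp add: cong_def)
qed

lemma shift_letter_inj:
  fixes i n :: nat
  assumes "gen a < n" "gen b < n" "map_letter (\<lambda>j. (j + i) mod n) a = map_letter (\<lambda>j. (j + i) mod n) b"
  shows "a = b"
proof -
  have "(gen a + i) mod n = (gen b + i) mod n"
    using arg_cong[OF assms(3), of gen] unfolding gen_map_letter .
  from inj_onD[OF inj_on_shift this] assms(1,2) have "gen a = gen b" by simp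
  moreover have "(a = Pos (gen a)) \<longleftrightarrow> (b = Pos (gen b))" using assms(3) by (cases a; cases b) simp_all
  ultimately show ?thesis by (cases a; cases b) simp_all
qed

lemma reduced_shift_by: "w \<in> words {..<n} \<Longrightarrow> reduced w \<Longrightarrow> reduced (shift_by n i w)"
proof (induction w rule: induct_list012)
  case (3 a b w)
  have "map_letter (\<lambda>j. (j + i) mod n) b \<noteq> inv_letter (map_letter (\<lambda>j. (j + i) mod n) a)"
    using shift_letter_inj[of b n "inv_letter a" i] 3 by (auto simp: map_letter_inv_letter)
  then show ?case using 3 by (auto simp: shift_by_def)
qed (simp_all add: shift_by_def)

lemma shift_by_words: "n > 0 \<Longrightarrow> shift_by n i w \<in> words {..<n}"
  by (auto simp: shift_by_def words_def word_gens_def)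

lemma well_formed_cyclic:
  "w \<in> words {..<n} \<Longrightarrow> reduced w \<Longrightarrow> well_formed (cyclic_presentation n w)"
  by (cases "n = 0") (auto simp: well_formed_def relators_cyclic reduced_shift_by shift_by_words)

lemma relators_cyclic_4:
  "w \<in> words {..<4} \<Longrightarrow> relators (cyclic_presentation 4 w) = set (map (\<lambda>i. shift_by 4 i w) [0, 1, 2, 3])"
  by (simp add: relators_cyclic lessThan_4)

text \<open>Rotations by 0 to 3 exhaust all rotations of words of length four, the only ones
  compared below; \<open>cyclic_match_4\<close> turns the relation into a finite check.\<close>

definition cyclic_match :: "'a word \<Rightarrow> 'a word \<Rightarrow> bool" where
  "cyclic_match z r \<longleftrightarrow> (\<exists>i\<in>{0, 1, 2, 3}. z = rotate i r \<or> z = rotate i (inv_word r))"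

lemma cyclic_match_weq: "cyclic_match z r \<Longrightarrow> weq P r [] \<Longrightarrow> weq P z []"
  using weq_rotate[of P r] weq_rotate[of P "inv_word r"] weq_inv_word[of P r "[]"]
  unfolding cyclic_match_def by fastforce

lemma cyclic_match_4:
  "cyclic_match z [a, b, c, d] \<longleftrightarrow> z \<in> {[a, b, c, d], [b, c, d, a], [c, d, a, b], [d, a, b, c],
     [inv_letter d, inv_letter c, inv_letter b, inv_letter a],
     [inv_letter c, inv_letter b, inv_letter a, inv_letter d],
     [inv_letter b, inv_letter a, inv_letter d, inv_letter c],
     [inv_letter a, inv_letter d, inv_letter c, inv_letter b]}"
proof -
  have "rotate 2 [x, y, z, w] = [z, w, x, y]" "rotate 3 [x, y, z, w] = [w, x, y, z]" for x y z w :: "'a letter"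
    by (simp_all add: numeral_eq_Suc)
  then show ?thesis unfolding cyclic_match_def by auto
qed

text \<open>The renaming \<open>f\<close> is an involution on the letters in question, so one map
  serves in both directions.\<close>

lemma cyclic_4_iso:
  fixes f :: "nat letter \<Rightarrow> nat letter"
  assumes w: "w \<in> words {..<4}" "reduced w" "w' \<in> words {..<4}" "reduced w'"
    and f: "\<And>l. f (inv_letter l) = inv_letter (f l)" "\<And>l. gen l < 4 \<Longrightarrow> gen (f l) < 4"
      "\<And>l. gen l < 4 \<Longrightarrow> f (f l) = l"
    and "\<forall>i\<in>{0, 1, 2, 3}. \<exists>j\<in>{0, 1, 2, 3}. cyclic_match (map f (shift_by 4 i w)) (shift_by 4 j w')"
    and "\<forall>i\<in>{0, 1, 2, 3}. \<exists>j\<in>{0, 1, 2, 3}. cyclic_match (map f (shift_by 4 i w')) (shift_by 4 j w)"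
  shows "cyclic_group_of 4 w \<cong> cyclic_group_of 4 w'"
proof -
  have r: "weq (cyclic_presentation 4 w') (map f r) []"
    if r: "r \<in> relators (cyclic_presentation 4 w)" and w: "w \<in> words {..<4}" "w' \<in> words {..<4}"
    and m: "\<forall>i\<in>{0, 1, 2, 3}. \<exists>j\<in>{0, 1, 2, 3}. cyclic_match (map f (shift_by 4 i w)) (shift_by 4 j w')"
    for r w w'
  proof -
    obtain i where "i \<in> {0, 1, 2, 3}" "r = shift_by 4 i w"
      using r by (auto simp: relators_cyclic_4[OF w(1)])
    then obtain j where "cyclic_match (map f r) (shift_by 4 j w')" using m by blast
    moreover have "weq (cyclic_presentation 4 w') (shift_by 4 j w') []"
      by (rule weq_relatorI[OF shift_by_relator]) (use w in auto)
    ultimately show ?thesis by (rule cyclic_match_weq)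
  qed
  show ?thesis
    by (rule presented_group_iso[where f = f and g = f])
       (use w f r[OF _ w(1,3) assms(8)] r[OF _ w(3,1) assms(9)] in \<open>auto intro: well_formed_cyclic\<close>)
qed

section \<open>Commuting words\<close>

lemma weq_eqI: "weq P (u @ inv_word v) [] \<Longrightarrow> weq P u v"
proof -
  assume a: "weq P (u @ inv_word v) []"
  have "weq P u (u @ inv_word v @ v)"
    using weq_sym[OF weq_context[OF weq_inv_left[of P v], of u "[]"]] by simp
  also have "weq P (u @ inv_word v @ v) v"
    using weq_append[OF a weq_refl[of P v]] by simp
  finally show ?thesis .
qed

lemma weq_eqD: "weq P u v \<Longrightarrow> weq P (u @ inv_word v) []"
  using weq_append[of P u v "inv_word v" "inv_word v"] weq_inv_right weq_trans by blast

definition commutes :: "'a presentation \<Rightarrow> 'a word \<Rightarrow> 'a word \<Rightarrow> bool" where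
  "commutes P u v \<longleftrightarrow> weq P (u @ v) (v @ u)"

lemma commutes_sym: "commutes P u v \<Longrightarrow> commutes P v u"
  by (simp add: commutes_def weq_sym)

lemma commutes_inv: "commutes P u v \<Longrightarrow> commutes P (inv_word u) v"
proof -
  assume a: "commutes P u v"
  have "weq P (inv_word u @ v) (inv_word u @ (v @ u) @ inv_word u)"
    using weq_sym[OF weq_context[OF weq_inv_right[of P u], of "inv_word u @ v" "[]"]] by simp
  also have "weq P (inv_word u @ (v @ u) @ inv_word u) (inv_word u @ (u @ v) @ inv_word u)"
    using a weq_context weq_sym unfolding commutes_def by blast
  also have "weq P (inv_word u @ (u @ v) @ inv_word u) (v @ inv_word u)"
    using weq_append[OF weq_inv_left[of P u] weq_refl[of P "v @ inv_word u"]] by simp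
  finally show ?thesis by (simp add: commutes_def)
qed

text \<open>The relator says that \<open>x\<close> commutes with the inverse of \<open>y\<close>;
  the other combinations of signs follow by inverting either side.\<close>

lemma commutes_letters:
  assumes "weq P [Pos x, Neg y, Neg x, Pos y] []" "gen k = x" "gen l = y"
  shows "commutes P [k] [l]"
proof -
  have xy: "commutes P [Pos x] [Neg y]"
    unfolding commutes_def by (rule weq_eqI) (use assms(1) in simp)
  have xy': "commutes P [Pos x] [Pos y]"
    using commutes_sym[OF commutes_inv[OF commutes_sym[OF xy]]] by simp
  show ?thesis using xy xy' commutes_inv[OF xy] commutes_inv[OF xy'] assms(2,3)
    by (cases k; cases l) auto
qed

lemma commutes_append: "commutes P u v \<Longrightarrow> commutes P u' v \<Longrightarrow> commutes P (u @ u') v"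
proof -
  assume a: "commutes P u v" "commutes P u' v"
  have "weq P (u @ u' @ v) (u @ v @ u')"
    using weq_context[of P "u' @ v" "v @ u'" u "[]"] a(2) by (simp add: commutes_def)
  also have "weq P (u @ v @ u') (v @ u @ u')"
    using weq_context[of P "u @ v" "v @ u" "[]" u'] a(1) by (simp add: commutes_def)
  finally show ?thesis by (simp add: commutes_def)
qed

lemma commutes_words:
  "(\<And>k l. k \<in> set u \<Longrightarrow> l \<in> set v \<Longrightarrow> commutes P [k] [l]) \<Longrightarrow> commutes P u v"
proof (induction u)
  case (Cons k u)
  have "commutes P [k] v" using Cons.prems
  proof (induction v)
    case (Cons l v)
    then have "commutes P ([l] @ v) [k]"
      by (intro commutes_append commutes_sym[of P "[k]"]) auto
    then show ?case using commutes_sym by simp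
  qed (simp add: commutes_def)
  then show ?case using Cons commutes_append[of P "[k]" v u] by simp
qed (simp add: commutes_def)


section \<open>The direct product of two free groups of rank two\<close>

abbreviation "F2 \<equiv> free_group {..<2::nat}"

text \<open>The right-angled Artin group of the 4-cycle: the generators 0 and 2 commute with 1 and
  3, and there are no relations inside either pair.\<close>

definition K4 :: "nat presentation" where
  "K4 = cyclic_presentation 4 [Pos 0, Neg 1, Neg 0, Pos 1]"

lemma generators_K4 [simp]: "generators K4 = {..<4}"
  by (simp add: K4_def)

lemma relators_K4: "relators K4 = set (map (\<lambda>i. shift_by 4 i [Pos 0, Neg 1, Neg 0, Pos 1]) [0, 1, 2, 3])"
  unfolding K4_def by (rule relators_cyclic_4) simp

text \<open>Projection to the factor generated by 0 and 2, renamed to 0 and 1;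
  \<open>odd_part\<close> does the same for 1 and 3.\<close>

definition even_part :: "nat word \<Rightarrow> nat word" where
  "even_part u = map (map_letter (\<lambda>i. i div 2)) (filter (\<lambda>l. even (gen l)) u)"

definition odd_part :: "nat word \<Rightarrow> nat word" where
  "odd_part u = map (map_letter (\<lambda>i. i div 2)) (filter (\<lambda>l. odd (gen l)) u)"

lemma parts_simps [simp]:
  "even_part [] = []" "even_part (l # u) = (if even (gen l) then [map_letter (\<lambda>i. i div 2) l] else []) @ even_part u"
  "odd_part [] = []" "odd_part (l # u) = (if odd (gen l) then [map_letter (\<lambda>i. i div 2) l] else []) @ odd_part u"
  by (auto simp: even_part_def odd_part_def)

lemma parts_append [simp]:
  "even_part (u @ v) = even_part u @ even_part v" "odd_part (u @ v) = odd_part u @ odd_part v"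
  by (auto simp: even_part_def odd_part_def)

lemma parts_words: "u \<in> words {..<4} \<Longrightarrow> even_part u \<in> words {..<2} \<and> odd_part u \<in> words {..<2}"
  by (induction u) auto

lemma subst_even_part: "subst (\<lambda>i. [Pos (2 * i)]) (even_part u) = filter (\<lambda>l. even (gen l)) u"
proof (induction u)
  case (Cons l u) then show ?case by (cases l) auto
qed simp

lemma subst_odd_part: "subst (\<lambda>i. [Pos (2 * i + 1)]) (odd_part u) = filter (\<lambda>l. odd (gen l)) u"
proof (induction u)
  case (Cons l u) then show ?case by (cases l) auto
qed simp

lemma parts_subst [simp]:
  "even_part (subst (\<lambda>i. [Pos (2 * i)]) u) = u" "odd_part (subst (\<lambda>i. [Pos (2 * i)]) u) = []"
  "odd_part (subst (\<lambda>i. [Pos (2 * i + 1)]) u) = u" "even_part (subst (\<lambda>i. [Pos (2 * i + 1)]) u) = []"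
  "odd_part (subst (\<lambda>i. [Pos (Suc (2 * i))]) u) = u" "even_part (subst (\<lambda>i. [Pos (Suc (2 * i))]) u) = []"
proof (induction u)
  case (Cons l u)
  { case 1 show ?case using Cons by (cases l) auto }
  { case 2 show ?case using Cons by (cases l) auto }
  { case 3 show ?case using Cons by (cases l) auto }
  { case 4 show ?case using Cons by (cases l) auto }
  { case 5 show ?case using Cons by (cases l) auto }
  { case 6 show ?case using Cons by (cases l) auto }
qed auto

lemma wf_cyclic_4 [simp]: "w \<in> words {..<4} \<Longrightarrow> reduced w \<Longrightarrow> wf_presentation (cyclic_presentation 4 w)"
  by (simp add: wf_presentation_def well_formed_cyclic)

lemma K4_commutes:
  assumes "gen k \<in> {0, 2}" "gen l \<in> {1, 3}"
  shows "commutes K4 [k] [l]"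
proof -
  have r: "weq K4 (shift_by 4 i [Pos 0, Neg 1, Neg 0, Pos 1]) []" for i
    unfolding K4_def by (rule weq_relatorI[OF shift_by_relator]) auto
  have *: "commutes K4 [k] [l]" if "(gen k, gen l) = (i, (1 + i) mod 4)" "i < 4" for k l i
    using r[of i] that by (intro commutes_letters[of K4 "gen k" "gen l"]) (auto simp: mod_less)
  consider "gen k = 0" "gen l = 1" | "gen k = 0" "gen l = 3" | "gen k = 2" "gen l = 1" | "gen k = 2" "gen l = 3"
    using assms by auto
  then show ?thesis
  proof cases
    case 1 then show ?thesis using *[of k l 0] by simp
  next
    case 2 then show ?thesis using commutes_sym[OF *[of l k 3]] by simp
  next
    case 3 then show ?thesis using commutes_sym[OF *[of l k 1]] by simp
  next
    case 4 then show ?thesis using *[of k l 2] by simp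
  qed
qed

text \<open>By induction, an odd first letter is moved to the right past all even letters.\<close>

lemma K4_split: "u \<in> words {..<4} \<Longrightarrow> weq K4 u (filter (\<lambda>l. even (gen l)) u @ filter (\<lambda>l. odd (gen l)) u)"
proof (induction u)
  case (Cons l u)
  let ?e = "filter (\<lambda>l. even (gen l)) u" and ?o = "filter (\<lambda>l. odd (gen l)) u"
  have l: "weq K4 (l # u) ([l] @ ?e @ ?o)" using Cons weq_Cons by auto
  show ?case
  proof (cases "even (gen l)")
    case False
    then have "gen l \<in> {1, 3}" using Cons.prems by (auto simp: lessThan_4)
    moreover have "gen k \<in> {0, 2}" if "k \<in> set ?e" for k
      using that Cons.prems by (auto simp: words_def word_gens_def lessThan_4)
    ultimately have "commutes K4 ?e [l]"
      using K4_commutes by (intro commutes_words[of ?e]) simp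
    then have "weq K4 ([l] @ ?e @ ?o) (?e @ [l] @ ?o)"
      using weq_context[of K4 "[l] @ ?e" "?e @ [l]" "[]" ?o] by (simp add: commutes_def weq_sym)
    then show ?thesis using weq_trans[OF l] False by simp
  qed (use l in simp)
qed simp

text \<open>\<open>K4_split\<close> recovers an element from its two parts, which gives injectivity;
  renaming \<open>i\<close> to \<open>2 * i\<close> and \<open>2 * i + 1\<close> gives
  preimages.\<close>

lemma K4_iso:
  obtains h where "h \<in> iso (presented_group K4) (F2 \<times>\<times> F2)"
    "\<And>u. u \<in> words {..<4} \<Longrightarrow> h (word_class K4 u) = (free_reduce (even_part u), free_reduce (odd_part u))"
proof -
  interpret wf_presentation K4 unfolding K4_def by (rule wf_cyclic_4) auto
  interpret F2: group F2 by (rule group_free_group)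
  interpret FF: group "F2 \<times>\<times> F2" by (intro DirProd_group group_free_group)
  define f :: "nat \<Rightarrow> nat word \<times> nat word" where
    "f i = (if even i then ([Pos (i div 2)], []) else ([], [Pos (i div 2)]))" for i
  have f: "f \<in> generators K4 \<rightarrow> carrier (F2 \<times>\<times> F2)"
    by (auto simp: f_def carrier_free_group)
  have v: "word_value (F2 \<times>\<times> F2) f u = (free_reduce (even_part u), free_reduce (odd_part u))"
    if "u \<in> words {..<4}" for u
    using that
  proof (induction u)
    case (Cons l u)
    have c: "[Pos (gen l div 2)] \<in> carrier F2" "[] \<in> carrier F2"
      using Cons.prems by (auto simp: carrier_free_group)
    have "letter_value (F2 \<times>\<times> F2) f l = (even_part [l], odd_part [l])"
      using c by (cases l) (auto simp: letter_value_def f_def inv_DirProd group_free_group inv_free_group)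
    then show ?case using Cons
      by (simp add: word_value_Cons mult_free_group free_reduce_append_right)
  qed (simp add: free_reduce_def one_free_group)
  have "word_value (F2 \<times>\<times> F2) f r = \<one>\<^bsub>F2 \<times>\<times> F2\<^esub>" if "r \<in> relators K4" for r
  proof -
    have "r \<in> words {..<4}" using that relators_words by auto
    moreover have "r \<in> set (map (\<lambda>i. shift_by 4 i [Pos 0, Neg 1, Neg 0, Pos 1]) [0, 1, 2, 3])"
      using that unfolding relators_K4 .
    ultimately show ?thesis
      by (auto simp: v one_free_group free_reduce_def)
  qed
  then obtain h where h: "h \<in> hom G (F2 \<times>\<times> F2)"
    "\<And>u. u \<in> words {..<4} \<Longrightarrow> h (word_class K4 u) = (free_reduce (even_part u), free_reduce (odd_part u))"
    using ex_hom[OF FF.is_group f] v by (metis generators_K4)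
  have "inj_on h (carrier G)"
  proof (rule inj_onI)
    fix C D assume "C \<in> carrier G" "D \<in> carrier G" and e: "h C = h D"
    then obtain u v where uv: "u \<in> words {..<4}" "v \<in> words {..<4}" "C = word_class K4 u" "D = word_class K4 v"
      by (auto simp: carrier_G)
    then have fe: "free_eq (even_part u) (even_part v)" "free_eq (odd_part u) (odd_part v)"
      using e h(2) by auto
    have "weq K4 u (filter (\<lambda>l. even (gen l)) u @ filter (\<lambda>l. odd (gen l)) u)"
      using K4_split uv by blast
    also have "weq K4 \<dots> (filter (\<lambda>l. even (gen l)) v @ filter (\<lambda>l. odd (gen l)) v)"
      using free_eq_subst[OF fe(1), of "\<lambda>i. [Pos (2 * i)]"] free_eq_subst[OF fe(2), of "\<lambda>i. [Pos (2 * i + 1)]"]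
      unfolding subst_even_part subst_odd_part by (intro weq_append weq_free_reduceI)
    also have "weq K4 \<dots> v" using K4_split uv weq_sym by blast
    finally show "C = D" using uv by (simp add: word_class_eq_iff)
  qed
  moreover have "carrier (F2 \<times>\<times> F2) \<subseteq> h ` carrier G"
  proof
    fix z assume "z \<in> carrier (F2 \<times>\<times> F2)"
    then obtain u v where z: "z = (u, v)" "u \<in> carrier F2" "v \<in> carrier F2" by auto
    let ?w = "subst (\<lambda>i. [Pos (2 * i)]) u @ subst (\<lambda>i. [Pos (2 * i + 1)]) v"
    have "?w \<in> words {..<4}"
      using z subst_words[of "{..<2}" "\<lambda>i. [Pos (2 * i)]" "{..<4::nat}" u] subst_words[of "{..<2}" "\<lambda>i. [Pos (2 * i + 1)]" "{..<4::nat}" v]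
      by (simp add: carrier_free_group)
    moreover from this have "h (word_class K4 ?w) = z"
      using z by (simp add: h(2) carrier_free_group free_reduce_reduced)
    ultimately show "z \<in> h ` carrier G" using word_class_closed by force
  qed
  ultimately have "h \<in> iso G (F2 \<times>\<times> F2)"
    using h(1) hom_in_carrier[OF h(1)] by (simp add: iso_iff subset_antisym image_subsetI del: carrier_DirProd)
  then show thesis using h(2) that by blast
qed

text \<open>The criterion by even and odd part is what later translates membership into exponent
  sums and letter counts.\<close>

lemma K4_subgroup:
  assumes H1: "subgroup H1 F2" "F2\<lparr>carrier := H1\<rparr> \<cong> A1" and H2: "subgroup H2 F2" "F2\<lparr>carrier := H2\<rparr> \<cong> A2"
  obtains L where "subgroup L (presented_group K4)"
    "presented_group K4\<lparr>carrier := L\<rparr> \<cong> A1 \<times>\<times> A2"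
    "card (rcosets\<^bsub>presented_group K4\<^esub> L) = card (rcosets\<^bsub>F2\<^esub> H1) * card (rcosets\<^bsub>F2\<^esub> H2)"
    "\<And>u. u \<in> words {..<4} \<Longrightarrow> word_class K4 u \<in> L \<longleftrightarrow> free_reduce (even_part u) \<in> H1 \<and> free_reduce (odd_part u) \<in> H2"
proof -
  interpret wf_presentation K4 unfolding K4_def by (rule wf_cyclic_4) auto
  interpret FF: group "F2 \<times>\<times> F2" by (intro DirProd_group group_free_group)
  obtain h where h: "h \<in> iso G (F2 \<times>\<times> F2)"
    "\<And>u. u \<in> words {..<4} \<Longrightarrow> h (word_class K4 u) = (free_reduce (even_part u), free_reduce (odd_part u))"
    using K4_iso by blast
  have sub: "subgroup (H1 \<times> H2) (F2 \<times>\<times> F2)"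
    by (rule DirProd_subgroups) (use H1 H2 group_free_group in auto)
  define L where "L = {g \<in> carrier G. h g \<in> H1 \<times> H2}"
  note * = subgroup_iso_image[OF G.is_group FF.is_group h(1) sub, folded L_def]
  have "F2\<lparr>carrier := H1\<rparr> \<times>\<times> F2\<lparr>carrier := H2\<rparr> \<cong> A1 \<times>\<times> A2"
    using group.DirProd_iso_trans[OF subgroup.subgroup_is_group[OF H1(1) group_free_group] H1(2) H2(2)] .
  then have "G\<lparr>carrier := L\<rparr> \<cong> A1 \<times>\<times> A2"
    using *(2) iso_trans unfolding DirProd_restrict by blast
  moreover have "card (rcosets\<^bsub>G\<^esub> L) = card (rcosets\<^bsub>F2\<^esub> H1) * card (rcosets\<^bsub>F2\<^esub> H2)"
    using *(3) card_rcosets_DirProd[OF group_free_group group_free_group H1(1) H2(1)] by simp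
  moreover have "word_class K4 u \<in> L \<longleftrightarrow> free_reduce (even_part u) \<in> H1 \<and> free_reduce (odd_part u) \<in> H2"
    if "u \<in> words {..<4}" for u
    using that by (simp add: L_def h(2))
  ultimately show thesis using that *(1) by blast
qed

lemma esum_push: "esum (push l u) = esum [l] + esum u"
proof (cases u)
  case (Cons k w)
  then show ?thesis by (cases l; cases k) auto
qed simp

lemma esum_free_reduce [simp]: "esum (free_reduce u) = esum u"
proof (induction u)
  case (Cons l u)
  have "free_reduce (l # u) = push l (free_reduce u)" by (simp add: free_reduce_def)
  then show ?case using Cons by (cases l) (simp_all add: esum_push)
qed (simp add: free_reduce_def)

text \<open>Letters are counted regardless of sign, so a cancellation removes two of them or none,
  and the parity survives.\<close>

lemma even_count_gen_free_reduce [simp]: "even (count_gen x (free_reduce u)) \<longleftrightarrow> even (count_gen x u)"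
proof (induction u)
  case (Cons l u)
  have "even (count_gen x (push l v)) \<longleftrightarrow> even (count_gen x (l # v))" for v
    by (cases v) auto
  moreover have "free_reduce (l # u) = push l (free_reduce u)" by (simp add: free_reduce_def)
  ultimately show ?case using Cons by simp
qed (simp add: free_reduce_def)

lemma esum_parts: "esum u = esum (even_part u) + esum (odd_part u)"
proof (induction u)
  case (Cons l u) then show ?case by (cases l) auto
qed simp

lemma count_gen_parts:
  "count_gen g (even_part u) = count_gen (2 * g) u" "count_gen g (odd_part u) = count_gen (2 * g + 1) u"
proof (induction u)
  case (Cons l u)
  have e: "gen l div 2 = g \<longleftrightarrow> gen l = 2 * g" if "even (gen l)" using that by auto
  have o: "gen l div 2 = g \<longleftrightarrow> gen l = 2 * g + 1" if "odd (gen l)" using that by (auto elim!: oddE)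
  have ne: "gen l \<noteq> 2 * g + 1" if "even (gen l)" using that by auto
  { case 1 show ?case using Cons e by auto }
  { case 2 show ?case using Cons o ne by auto }
qed auto


section \<open>Twisted forms of \<open>F2 \<times> F2\<close>, by rotation and by sign
  changes\<close>

section \<open>The rotation machine\<close>

text \<open>In the split extension of the target group by a cyclic group with generator \<open>t\<close> which acts
  by \<open>t x\<^sub>i t\<inverse> = x\<^sub>i\<^sub>+\<^sub>1\<close>, the machine multiplies out a word in the elements \<open>x\<^sub>i t\<^sup>c\<close>.
  The state is the exponent of \<open>t\<close>.\<close>

definition rot_nxt :: "nat \<Rightarrow> nat \<Rightarrow> nat \<Rightarrow> nat letter \<Rightarrow> nat" where
  "rot_nxt n c s l = (case l of Pos _ \<Rightarrow> (s + c) mod n | Neg _ \<Rightarrow> (s + (n - c)) mod n)"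

text \<open>The inverse of \<open>x_i t^c\<close> is \<open>t^-c x_i^-1\<close>: at a negative
  letter the state changes before the letter is written, so the next state enters the
  subscript.\<close>

definition rot_out :: "nat \<Rightarrow> nat \<Rightarrow> nat \<Rightarrow> nat letter \<Rightarrow> nat letter" where
  "rot_out n c s l = (case l of Pos i \<Rightarrow> Pos ((i + s) mod n) | Neg i \<Rightarrow> Neg ((i + rot_nxt n c s l) mod n))"

definition rot_in :: "nat \<Rightarrow> nat \<Rightarrow> nat \<Rightarrow> nat letter \<Rightarrow> nat letter" where
  "rot_in n c s l = (case l of Pos i \<Rightarrow> Pos ((i + (n - s)) mod n) | Neg i \<Rightarrow> Neg ((i + (n - rot_nxt n c s l)) mod n))"

lemma mod_eq_shift: "x = y + k * n \<Longrightarrow> x mod n = y mod n" for x y k n :: nat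
  by simp

locale rotation =
  fixes n c :: nat
  assumes n: "n > 0" and c: "c < n"
begin

lemma nxt_less: "rot_nxt n c s l < n"
  using n by (auto simp: rot_nxt_def split: letter.splits)

lemma add_sub_mod:
  assumes "s < n" "i < n"
  shows "((i + s) mod n + (n - s)) mod n = i" "((i + (n - s)) mod n + s) mod n = i"
    "((i + s) mod n + n - s) mod n = i" "((i + n - s) mod n + s) mod n = i"
proof -
  show *: "((i + s) mod n + (n - s)) mod n = i" "((i + (n - s)) mod n + s) mod n = i"
    using assms by (simp_all only: mod_add_left_eq) simp_all
  show "((i + s) mod n + n - s) mod n = i" "((i + n - s) mod n + s) mod n = i"
    using * assms by simp_all
qed

lemma nxt_nxt_inv: "s < n \<Longrightarrow> rot_nxt n c (rot_nxt n c s l) (inv_letter l) = s"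
  using c by (cases l) (auto simp: rot_nxt_def add_sub_mod)

lemma out_nxt_inv: "s < n \<Longrightarrow> rot_out n c (rot_nxt n c s l) (inv_letter l) = inv_letter (rot_out n c s l)"
  using nxt_nxt_inv[of s l] by (cases l) (auto simp: rot_out_def)

lemma in_nxt_inv: "s < n \<Longrightarrow> rot_in n c (rot_nxt n c s l) (inv_letter l) = inv_letter (rot_in n c s l)"
  using nxt_nxt_inv[of s l] by (cases l) (auto simp: rot_in_def)

lemma nxt_out: "rot_nxt n c s (rot_out n c s l) = rot_nxt n c s l" "rot_nxt n c s (rot_in n c s l) = rot_nxt n c s l"
  by (cases l; simp add: rot_nxt_def rot_out_def rot_in_def)+

lemma in_out: "s < n \<Longrightarrow> gen l < n \<Longrightarrow> rot_in n c s (rot_out n c s l) = l"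
  using nxt_out(1)[of s l] nxt_less[of s l]
  by (cases l) (auto simp: rot_in_def rot_out_def add_sub_mod)

lemma out_in: "s < n \<Longrightarrow> gen l < n \<Longrightarrow> rot_out n c s (rot_in n c s l) = l"
  using nxt_out(2)[of s l] nxt_less[of s l]
  by (cases l) (auto simp: rot_in_def rot_out_def add_sub_mod)

lemma run_less: "s < n \<Longrightarrow> run (rot_nxt n c) s u < n"
  by (induction u arbitrary: s) (auto intro: nxt_less)

lemma run_mod: "int (run (rot_nxt n c) s u) mod int n = (int s + int c * esum u) mod int n"
proof (induction u arbitrary: s)
  case (Cons l u)
  have "int (rot_nxt n c s l) mod int n = (int s + int c * esum [l]) mod int n"
  proof (cases l)
    case (Neg x)
    have "(int s + int (n - c)) mod int n = (int s - int c + int n) mod int n"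
      using c by (simp add: of_nat_diff algebra_simps)
    also have "\<dots> = (int s - int c) mod int n" by (rule mod_add_self2)
    finally show ?thesis using Neg by (simp add: rot_nxt_def zmod_int)
  qed (simp add: rot_nxt_def zmod_int)
  then have "(int (rot_nxt n c s l) + int c * esum u) mod int n = (int s + int c * esum [l] + int c * esum u) mod int n"
    by (metis mod_add_left_eq)
  then show ?case using Cons.IH[of "rot_nxt n c s l"]
    by (cases l) (simp_all add: algebra_simps)
qed simp

lemma run_eq_iff: "s < n \<Longrightarrow> run (rot_nxt n c) s u = s \<longleftrightarrow> int n dvd int c * esum u"
proof -
  assume s: "s < n"
  have "run (rot_nxt n c) s u = s \<longleftrightarrow> int (run (rot_nxt n c) s u) mod int n = int s mod int n"
    using s run_less[OF s, of u] by (simp add: mod_less zmod_int[symmetric])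
  also have "\<dots> \<longleftrightarrow> int n dvd int c * esum u"
    unfolding run_mod using mod_eq_dvd_iff[of "int s + int c * esum u" "int n" "int s"] by simp
  finally show ?thesis .
qed

lemma esum_shift_by: "esum (shift_by n i u) = esum u"
proof (induction u)
  case (Cons l u) then show ?case by (cases l) auto
qed simp

lemma run_transduce: "run (rot_nxt n c) s (transduce (rot_nxt n c) (rot_out n c) s u) = run (rot_nxt n c) s u"
  by (induction u arbitrary: s) (auto simp: nxt_out)

lemma transduce_in_out:
  "s < n \<Longrightarrow> u \<in> words {..<n} \<Longrightarrow> transduce (rot_nxt n c) (rot_in n c) s (transduce (rot_nxt n c) (rot_out n c) s u) = u"
  by (induction u arbitrary: s) (auto simp: nxt_out in_out nxt_less)

text \<open>\<open>trans\<close> makes the machine send relators to relators from every state,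
  \<open>sum\<close> brings the state back after each relator, and \<open>stab\<close> confines
  \<open>L\<close> to exponent sums on which the twist by \<open>c\<close> is trivial.\<close>

lemma subgroup_transfer_cyclic:
  assumes w: "w \<in> words {..<n}" "reduced w" "w' \<in> words {..<n}" "reduced w'"
    and sum: "int n dvd int c * esum w"
    and trans: "\<And>s i. s < n \<Longrightarrow> transduce (rot_nxt n c) (rot_out n c) s (shift_by n i w) = shift_by n (i + s) w'"
    and L: "subgroup L (cyclic_group_of n w')"
    and stab: "\<And>v. v \<in> words {..<n} \<Longrightarrow> word_class (cyclic_presentation n w') v \<in> L \<Longrightarrow> int n dvd int c * esum v"
  obtains H where "subgroup H (cyclic_group_of n w)"
    "cyclic_group_of n w\<lparr>carrier := H\<rparr> \<cong> cyclic_group_of n w'\<lparr>carrier := L\<rparr>"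
    "card (rcosets\<^bsub>cyclic_group_of n w\<^esub> H) = card (rcosets\<^bsub>cyclic_group_of n w'\<^esub> L)"
proof -
  let ?P = "cyclic_presentation n w" and ?Q = "cyclic_presentation n w'"
  have run: "run (rot_nxt n c) s (shift_by n i w) = s" if "s < n" for s i
    using that sum by (simp add: run_eq_iff esum_shift_by)
  \<comment> \<open>Every shift of \<open>w'\<close> is written as an image of a shift of
    \<open>w\<close>, with \<open>n - s\<close> standing for \<open>- s\<close>, so that
    \<open>trans\<close> can be read backwards.\<close>
  have eq: "shift_by n i w' = shift_by n (i + (n - s) + s) w'" if "s < n" for i s
  proof -
    have "i + (n - s) + s = i + n" using that by simp
    moreover have "(z + (i + n)) mod n = (z + i) mod n" for z by (simp flip: add.assoc)
    ultimately show ?thesis by (simp add: shift_by_def)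
  qed
  have trans': "transduce (rot_nxt n c) (rot_in n c) s (shift_by n i w') = shift_by n (i + (n - s)) w"
    if "s < n" for s i
    unfolding eq[OF that, of i] trans[OF that, symmetric]
    using transduce_in_out[OF that] shift_by_words[OF n] by blast
  have run': "run (rot_nxt n c) s (shift_by n i w') = s" if "s < n" for s i
    unfolding eq[OF that, of i] trans[OF that, symmetric] run_transduce using run[OF that] .
  have weq: "weq ?Q (shift_by n i w') []" "weq ?P (shift_by n i w) []" for i
    using w n by (auto intro: weq_relatorI shift_by_relator)
  interpret machine_pair ?P ?Q "{..<n}" "rot_nxt n c" "rot_out n c" "rot_nxt n c" "rot_in n c" 0
  proof
    show "well_formed ?P" "well_formed ?Q" using w by (auto intro: well_formed_cyclic)
    show "gen (rot_out n c s l) \<in> generators ?Q" "gen (rot_in n c s l) \<in> generators ?P" for s l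
      using n by (cases l; simp add: rot_out_def rot_in_def)+
    show "weq ?Q (transduce (rot_nxt n c) (rot_out n c) s r) []"
      if "s \<in> {..<n}" "r \<in> relators ?P" for s r
      using that weq by (auto simp: relators_cyclic[OF w(1)] trans)
    show "weq ?P (transduce (rot_nxt n c) (rot_in n c) s r) []"
      if "s \<in> {..<n}" "r \<in> relators ?Q" for s r
      using that weq by (auto simp: relators_cyclic[OF w(3)] trans')
    show "run (rot_nxt n c) s r = s" if "s \<in> {..<n}" "r \<in> relators ?P" for s r
      using that by (auto simp: relators_cyclic[OF w(1)] run)
    show "run (rot_nxt n c) s r = s" if "s \<in> {..<n}" "r \<in> relators ?Q" for s r
      using that by (auto simp: relators_cyclic[OF w(3)] run')
  qed (auto simp: nxt_less nxt_nxt_inv out_nxt_inv in_nxt_inv nxt_out in_out out_in n)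
  show thesis
    using subgroup_transfer[OF L] that stab n by (metis generators_cyclic run_eq_iff)
qed

end

text \<open>Put \<open>x_i = y_i t^c\<close>. In the first two letters the powers of
  \<open>t\<close> cancel; the last two become \<open>t^-c y_c^-1 y_r t^c\<close>, and the
  conjugation lowers their subscripts by \<open>c\<close>, to 0 and \<open>p\<close>.\<close>

lemma (in rotation) transduce_commutator:
  assumes r: "[r = p + c] (mod n)" and s: "s < n"
  shows "transduce (rot_nxt n c) (rot_out n c) s (shift_by n i [Pos 0, Neg p, Neg c, Pos r])
    = shift_by n (i + s) [Pos 0, Neg p, Neg 0, Pos p]"
proof -
  define d where "d = n - c"
  have nd: "n = c + d" using c by (simp add: d_def)
  let ?w = "shift_by n i [Pos 0, Neg p, Neg c, Pos r]"
  have s1: "rot_nxt n c s (Pos x) = (s + c) mod n" "rot_nxt n c ((s + c) mod n) (Neg x) = s"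
    "rot_nxt n c s (Neg x) = (s + d) mod n" for x
    using nxt_nxt_inv[OF s, of "Pos x"] by (simp_all add: rot_nxt_def d_def)
  have "(i mod n + s) mod n = (0 + (i + s)) mod n" by (simp add: mod_simps)
  moreover have "((p + i) mod n + s) mod n = (p + (i + s)) mod n" by (simp add: mod_simps add.assoc)
  moreover have "((c + i) mod n + (s + d) mod n) mod n = (0 + (i + s)) mod n"
  proof -
    have "c + i + (s + d) = 0 + (i + s) + 1 * n" using nd by simp
    then show ?thesis using mod_eq_shift by (simp only: mod_add_eq)
  qed
  moreover have "((r + i) mod n + (s + d) mod n) mod n = (p + (i + s)) mod n"
  proof -
    have "[r + i + (s + d) = p + c + i + (s + d)] (mod n)"
      using r by (intro cong_add cong_refl)
    moreover have "p + c + i + (s + d) = p + (i + s) + 1 * n" using nd by simp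
    ultimately show ?thesis unfolding cong_def by (metis mod_add_eq mod_eq_shift)
  qed
  ultimately show ?thesis
    by (simp add: rot_out_def s1)
qed

lemma embeds_with_index_rotation:
  assumes "rotation 4 c" and r: "[r = 1 + c] (mod 4)" "r < 4" and c: "c \<noteq> r"
    and H1: "subgroup H1 F2" "F2\<lparr>carrier := H1\<rparr> \<cong> A1" and H2: "subgroup H2 F2" "F2\<lparr>carrier := H2\<rparr> \<cong> A2"
    and stab: "\<And>u v. u \<in> H1 \<Longrightarrow> v \<in> H2 \<Longrightarrow> 4 dvd int c * (esum u + esum v)"
  shows "embeds_with_index (A1 \<times>\<times> A2) (card (rcosets\<^bsub>F2\<^esub> H1) * card (rcosets\<^bsub>F2\<^esub> H2))
    (cyclic_group_of 4 [Pos 0, Neg 1, Neg c, Pos r])"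
proof -
  interpret rotation 4 c by fact
  obtain L where L: "subgroup L (presented_group K4)" "presented_group K4\<lparr>carrier := L\<rparr> \<cong> A1 \<times>\<times> A2"
    "card (rcosets\<^bsub>presented_group K4\<^esub> L) = card (rcosets\<^bsub>F2\<^esub> H1) * card (rcosets\<^bsub>F2\<^esub> H2)"
    "\<And>u. u \<in> words {..<4} \<Longrightarrow> word_class K4 u \<in> L \<longleftrightarrow> free_reduce (even_part u) \<in> H1 \<and> free_reduce (odd_part u) \<in> H2"
    using K4_subgroup[OF H1 H2] by blast
  have "int 4 dvd int c * esum v" if "v \<in> words {..<4}" "word_class K4 v \<in> L" for v
    using that L(4)[of v] stab[of "free_reduce (even_part v)" "free_reduce (odd_part v)"] esum_parts[of v] by simp
  then have stab': "int 4 dvd int c * esum v"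
    if "v \<in> words {..<4}" "word_class (cyclic_presentation 4 [Pos 0, Neg 1, Neg 0, Pos 1]) v \<in> L" for v
    using that unfolding K4_def by blast
  have L1: "subgroup L (cyclic_group_of 4 [Pos 0, Neg 1, Neg 0, Pos 1])"
    using L(1) unfolding K4_def .
  let ?w = "[Pos 0, Neg 1, Neg c, Pos r]" and ?w' = "[Pos 0, Neg 1, Neg 0, Pos 1 :: nat letter]"
  have w: "?w \<in> words {..<4}" "reduced ?w" "?w' \<in> words {..<4}" "reduced ?w'" "int 4 dvd int c * esum ?w"
    using assms(1) r assms(4) by (auto simp: rotation_def)
  obtain H where H: "subgroup H (cyclic_group_of 4 ?w)"
    "cyclic_group_of 4 ?w\<lparr>carrier := H\<rparr> \<cong> presented_group K4\<lparr>carrier := L\<rparr>"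
    "card (rcosets\<^bsub>cyclic_group_of 4 ?w\<^esub> H) = card (rcosets\<^bsub>presented_group K4\<^esub> L)"
    unfolding K4_def
    by (rule subgroup_transfer_cyclic[OF w transduce_commutator[OF r(1)] L1 stab'])
  then show ?thesis
    unfolding embeds_with_index_def by (intro exI[of _ H] conjI H(1) iso_trans[OF H(2) L(2)]) (simp only: H(3) L(3))
qed

text \<open>For \<open>c = 1\<close> the exponent sum must be divisible by 4. Imposing this in each
  factor gives rank 5 twice and index \<open>4 * 4\<close>.\<close>

lemma embeds_F5_F5_a:
  "embeds_with_index (free_group_rank 5 \<times>\<times> free_group_rank 5) 16 (cyclic_group_of 4 [Pos 0, Neg 1, Neg 1, Pos 2])"
proof -
  let ?E = "{u \<in> carrier F2. 4 dvd esum u}"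
  have "embeds_with_index (free_group_rank 5 \<times>\<times> free_group_rank 5) (card (rcosets\<^bsub>F2\<^esub> ?E) * card (rcosets\<^bsub>F2\<^esub> ?E))
      (cyclic_group_of 4 [Pos 0, Neg 1, Neg 1, Pos 2])"
    by (rule embeds_with_index_rotation[OF _ _ _ _ free_group_esum_4(1,2) free_group_esum_4(1,2)])
       (auto simp: rotation_def cong_def)
  then show ?thesis unfolding free_group_esum_4(3) by simp
qed

text \<open>For \<open>c = 2\<close> an even total exponent sum is enough. The conditions modulo 2
  in one factor and modulo 4 in the other give ranks 3 and 5 and index \<open>2 * 4\<close>.\<close>

lemma embeds_F3_F5:
  "embeds_with_index (free_group_rank 3 \<times>\<times> free_group_rank 5) 8 (cyclic_group_of 4 [Pos 0, Neg 1, Neg 2, Pos 3])"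
proof -
  have "embeds_with_index (free_group_rank 3 \<times>\<times> free_group_rank 5)
      (card (rcosets\<^bsub>F2\<^esub> {u \<in> carrier F2. 2 dvd esum u}) * card (rcosets\<^bsub>F2\<^esub> {u \<in> carrier F2. 4 dvd esum u}))
      (cyclic_group_of 4 [Pos 0, Neg 1, Neg 2, Pos 3])"
  proof (rule embeds_with_index_rotation[OF _ _ _ _ free_group_esum_2(1,2) free_group_esum_4(1,2)])
    fix u v :: "nat word"
    assume "u \<in> {u \<in> carrier F2. 2 dvd esum u}" "v \<in> {u \<in> carrier F2. 4 dvd esum u}"
    then have "2 dvd esum u" "4 dvd esum v" by auto
    then show "4 dvd int 2 * (esum u + esum v)" by (simp, presburger)
  qed (auto simp: rotation_def cong_def)
  then show ?thesis unfolding free_group_esum_2(3) free_group_esum_4(3) by simp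
qed


section \<open>The flip machine\<close>

text \<open>In \<open>G\<^sub>4(x\<^sub>0 x\<^sub>1\<inverse> x\<^sub>0 x\<^sub>1)\<close> the generator \<open>x\<^sub>i\<^sub>+\<^sub>1\<close> inverts \<open>x\<^sub>i\<close>.
  The state of the machine is the set of generators which are currently inverted.\<close>

definition flip_nxt :: "(nat \<Rightarrow> bool) \<Rightarrow> nat letter \<Rightarrow> nat \<Rightarrow> bool" where
  "flip_nxt s l = s((gen l + 3) mod 4 := \<not> s ((gen l + 3) mod 4))"

definition flip_out :: "(nat \<Rightarrow> bool) \<Rightarrow> nat letter \<Rightarrow> nat letter" where
  "flip_out s l = (if s (gen l) then inv_letter l else l)"

definition KB :: "nat presentation" where
  "KB = cyclic_presentation 4 [Pos 0, Neg 1, Pos 0, Pos 1]"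

lemma generators_KB [simp]: "generators KB = {..<4}"
  by (simp add: KB_def)

lemma weq_commutator:
  assumes "weq P [Pos x, Neg y, Neg x, Pos y] []" "gen k = x" "gen l = y"
  shows "weq P [k, l, inv_letter k, inv_letter l] []"
  using weq_eqD[of P "[k, l]" "[l, k]"] commutes_letters[OF assms] by (simp add: commutes_def)

lemma weq_inverting:
  assumes "weq P [Pos x, Neg y, Pos x, Pos y] []" "gen k = x" "gen l = y"
  shows "weq P [k, l, k, inv_letter l] []"
proof -
  have "cyclic_match [k, l, k, inv_letter l] [Pos x, Neg y, Pos x, Pos y]"
    using assms(2,3) unfolding cyclic_match_4 by (cases k; cases l) auto
  then show ?thesis using assms(1) cyclic_match_weq by blast
qed

text \<open>Reading \<open>l\<close> toggles the sign of its predecessor \<open>k\<close>, so of the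
  two occurrences of \<open>k\<close> in \<open>[k, l, k, inv_letter l]\<close> exactly one is
  inverted, and inverting relators and commutators are exchanged. The state depends only on the
  generators read, which the output keeps, so the machine is its own inverse.\<close>

lemma flip_machines:
  "machine_pair KB K4 UNIV flip_nxt flip_out flip_nxt flip_out (\<lambda>_. False)"
proof -
  interpret B: wf_presentation KB unfolding KB_def by (rule wf_cyclic_4) auto
  interpret A: wf_presentation K4 unfolding K4_def by (rule wf_cyclic_4) auto
  have A: "weq K4 [k, l, inv_letter k, inv_letter l] []" if "gen k < 4" "gen l = (gen k + 1) mod 4" for k l
  proof -
    have "shift_by 4 (gen k) [Pos 0, Neg 1, Neg 0, Pos 1] \<in> relators K4"
      unfolding K4_def by (rule shift_by_relator) auto
    then show ?thesis using that by (intro weq_commutator[OF weq_relatorI]) (simp_all add: add.commute)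
  qed
  have B: "weq KB [k, l, k, inv_letter l] []" if "gen k < 4" "gen l = (gen k + 1) mod 4" for k l
  proof -
    have "shift_by 4 (gen k) [Pos 0, Neg 1, Pos 0, Pos 1] \<in> relators KB"
      unfolding KB_def by (rule shift_by_relator) auto
    then show ?thesis using that by (intro weq_inverting[OF weq_relatorI]) (simp_all add: add.commute)
  qed
  have t: "transduce flip_nxt flip_out s [k, l, m, inv_letter l] = [flip_out s k, flip_out s l, inv_letter (flip_out s m), inv_letter (flip_out s l)]"
    "run flip_nxt s [k, l, m, inv_letter l] = s"
    if "gen k < 4" "gen m = gen k" "gen l = (gen k + 1) mod 4" for s k l m
  proof -
    \<comment> \<open>Reading \<open>k\<close> toggles its predecessor, which is neither
      \<open>k\<close> nor \<open>l\<close>; reading \<open>l\<close> toggles exactly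
      \<open>k\<close>.\<close>
    have "(gen k + 3) mod 4 \<noteq> gen k" "(gen k + 3) mod 4 \<noteq> gen l" "gen l \<noteq> gen k" "(gen l + 3) mod 4 = gen k"
      using that(1) unfolding that(3) by presburger+
    then show "transduce flip_nxt flip_out s [k, l, m, inv_letter l] = [flip_out s k, flip_out s l, inv_letter (flip_out s m), inv_letter (flip_out s l)]"
      "run flip_nxt s [k, l, m, inv_letter l] = s"
      using that(2) by (simp_all add: flip_nxt_def flip_out_def fun_upd_twist)
  qed
  have rB: "\<exists>k l. gen k < 4 \<and> gen l = (gen k + 1) mod 4 \<and> r = [k, l, k, inv_letter l]"
    if r: "r \<in> relators KB" for r
  proof -
    obtain a where "a < 4" "r = shift_by 4 a [Pos 0, Neg 1, Pos 0, Pos 1]"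
      using r unfolding KB_def by (subst (asm) relators_cyclic) auto
    then show ?thesis
      by (intro exI[of _ "Pos a"] exI[of _ "Neg ((a + 1) mod 4)"]) simp
  qed
  have rA: "\<exists>k l. gen k < 4 \<and> gen l = (gen k + 1) mod 4 \<and> r = [k, l, inv_letter k, inv_letter l]"
    if r: "r \<in> relators K4" for r
  proof -
    obtain a where "a < 4" "r = shift_by 4 a [Pos 0, Neg 1, Neg 0, Pos 1]"
      using r unfolding K4_def by (subst (asm) relators_cyclic) auto
    then show ?thesis
      by (intro exI[of _ "Pos a"] exI[of _ "Neg ((a + 1) mod 4)"]) simp
  qed
  have out: "flip_out s (inv_letter l) = inv_letter (flip_out s l)" "gen (flip_out s l) = gen l" for s l
    by (simp_all add: flip_out_def)
  show ?thesis
  proof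
    show "weq K4 (transduce flip_nxt flip_out s r) []" if "r \<in> relators KB" for r s
      using rB[OF that] A by (auto simp: t out simp del: transduce.simps)
    show "weq KB (transduce flip_nxt flip_out s r) []" if "r \<in> relators K4" for r s
      using rA[OF that] B by (auto simp: t out simp del: transduce.simps)
    show "run flip_nxt s r = s" if "r \<in> relators KB" for r s
      using rB[OF that] by (auto simp: t simp del: run.simps)
    show "run flip_nxt s r = s" if "r \<in> relators K4" for r s
      using rA[OF that] by (auto simp: t simp del: run.simps)
    show "flip_nxt (flip_nxt s l) (inv_letter l) = s" for s l
      by (simp add: flip_nxt_def)
    show "flip_out (flip_nxt s l) (inv_letter l) = inv_letter (flip_out s l)" for s l
    proof -
      have "(gen l + 3) mod 4 \<noteq> gen l" by presburger
      then show ?thesis by (simp add: flip_nxt_def flip_out_def)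
    qed
  qed (simp_all add: flip_nxt_def flip_out_def)
qed

lemma run_flip:
  "u \<in> words {..<4} \<Longrightarrow> i < 4 \<Longrightarrow> run flip_nxt s u i = (s i \<noteq> odd (count_gen ((i + 1) mod 4) u))"
proof (induction u arbitrary: s)
  case (Cons l u)
  have "flip_nxt s l i = (s i \<noteq> (gen l = (i + 1) mod 4))"
  proof -
    have "gen l = 0 \<or> gen l = 1 \<or> gen l = 2 \<or> gen l = 3" "i = 0 \<or> i = 1 \<or> i = 2 \<or> i = 3"
      using Cons.prems by (auto simp: less_Suc_eq numeral_eq_Suc)
    then have "i = (gen l + 3) mod 4 \<longleftrightarrow> gen l = (i + 1) mod 4"
      by (elim disjE) simp_all
    moreover have "flip_nxt s l i = (s i \<noteq> (i = (gen l + 3) mod 4))"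
      unfolding flip_nxt_def fun_upd_apply by simp
    ultimately show ?thesis by blast
  qed
  then show ?case using Cons.IH[of "flip_nxt s l"] Cons.prems by (cases "gen l = (i + 1) mod 4"; simp; blast?)
qed simp

lemma run_flip_outside: "i \<ge> 4 \<Longrightarrow> run flip_nxt s u i = s i"
proof (induction u arbitrary: s)
  case (Cons l u)
  have "(gen l + 3) mod 4 < 4" by simp
  then have "flip_nxt s l i = s i" using Cons.prems by (auto simp: flip_nxt_def)
  then show ?case using Cons by simp
qed simp

definition all_even :: "nat word \<Rightarrow> bool" where
  "all_even u \<longleftrightarrow> (\<forall>g\<in>{0, 1, 2, 3}. even (count_gen g u))"

lemma run_flip_id: "u \<in> words {..<4} \<Longrightarrow> all_even u \<Longrightarrow> run flip_nxt s u = s"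
proof (rule ext)
  fix i assume u: "u \<in> words {..<4}" "all_even u"
  show "run flip_nxt s u i = s i"
  proof (cases "i < 4")
    case True
    have "(i + 1) mod 4 \<in> {0, 1, 2, 3}" unfolding lessThan_4[symmetric] by simp
    from bspec[OF u(2)[unfolded all_even_def] this]
    have "even (count_gen ((i + 1) mod 4) u)" .
    then show ?thesis using run_flip[OF u(1) True, of s] by simp
  qed (simp add: run_flip_outside)
qed

lemma count_gen_transduce_flip: "count_gen g (transduce flip_nxt flip_out s u) = count_gen g u"
  by (induction u arbitrary: s) (auto simp: flip_out_def)

text \<open>If all counts are even, every sign is toggled an even number of times and the state
  returns. The machine keeps the generator of each letter, so \<open>all_even\<close> describes the
  subgroup on both sides; its index is \<open>4 * 4\<close>.\<close>

lemma KB_subgroup: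
  obtains L where "subgroup L (presented_group KB)"
    "presented_group KB\<lparr>carrier := L\<rparr> \<cong> free_group_rank 5 \<times>\<times> free_group_rank 5"
    "card (rcosets\<^bsub>presented_group KB\<^esub> L) = 16"
    "\<And>u. u \<in> words {..<4} \<Longrightarrow> word_class KB u \<in> L \<longleftrightarrow> all_even u"
proof -
  interpret machine_pair KB K4 UNIV flip_nxt flip_out flip_nxt flip_out "\<lambda>_. False"
    by (rule flip_machines)
  obtain L where L: "subgroup L (presented_group K4)"
    "presented_group K4\<lparr>carrier := L\<rparr> \<cong> free_group_rank 5 \<times>\<times> free_group_rank 5"
    "card (rcosets\<^bsub>presented_group K4\<^esub> L) = 16"
    "\<And>u. u \<in> words {..<4} \<Longrightarrow> word_class K4 u \<in> L \<longleftrightarrow> all_even u"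
  proof (rule K4_subgroup[OF free_group_parities(1,2) free_group_parities(1,2)])
    fix L assume L: "subgroup L (presented_group K4)" "presented_group K4\<lparr>carrier := L\<rparr> \<cong> free_group_rank 5 \<times>\<times> free_group_rank 5"
      "card (rcosets\<^bsub>presented_group K4\<^esub> L) =
        card (rcosets\<^bsub>F2\<^esub> {u \<in> carrier F2. even (count_gen 0 u) \<and> even (count_gen 1 u)}) *
        card (rcosets\<^bsub>F2\<^esub> {u \<in> carrier F2. even (count_gen 0 u) \<and> even (count_gen 1 u)})"
      "\<And>u. u \<in> words {..<4} \<Longrightarrow> (word_class K4 u \<in> L) =
        (free_reduce (even_part u) \<in> {u \<in> carrier F2. even (count_gen 0 u) \<and> even (count_gen 1 u)} \<and>
         free_reduce (odd_part u) \<in> {u \<in> carrier F2. even (count_gen 0 u) \<and> even (count_gen 1 u)})"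
    have "(word_class K4 u \<in> L) = all_even u" if u: "u \<in> words {..<4}" for u
      unfolding L(4)[OF u] all_even_def
      using parts_words[OF u] count_gen_parts(1)[of 0 u] count_gen_parts(1)[of 1 u]
        count_gen_parts(2)[of 0 u] count_gen_parts(2)[of 1 u]
      by (auto simp: free_reduce_in_carrier)
    then show thesis using that L unfolding free_group_parities(3) by simp
  qed
  have "run flip_nxt (\<lambda>_. False) v = (\<lambda>_. False)" if "v \<in> words (generators K4)" "word_class K4 v \<in> L" for v
    using that L(4)[of v] run_flip_id[of v] by simp
  from subgroup_transfer[OF L(1) this] obtain H where H: "subgroup H (presented_group KB)"
    "presented_group KB\<lparr>carrier := H\<rparr> \<cong> presented_group K4\<lparr>carrier := L\<rparr>"
    "card (rcosets\<^bsub>presented_group KB\<^esub> H) = card (rcosets\<^bsub>presented_group K4\<^esub> L)"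
    "\<And>u. u \<in> words {..<4} \<Longrightarrow> word_class KB u \<in> H \<longleftrightarrow> word_class K4 (transduce flip_nxt flip_out (\<lambda>_. False) u) \<in> L"
    by (metis generators_KB)
  have "word_class KB u \<in> H \<longleftrightarrow> all_even u" if u: "u \<in> words {..<4}" for u
    using u transduce_words[of "\<lambda>_. False" u] by (simp add: H(4) L(4) all_even_def count_gen_transduce_flip)
  moreover have "presented_group KB\<lparr>carrier := H\<rparr> \<cong> free_group_rank 5 \<times>\<times> free_group_rank 5"
    using H(2) L(2) by (rule iso_trans)
  ultimately show thesis using that H L(3) by metis
qed

lemma even_esum: "even (esum u) \<longleftrightarrow> even (length u)"
proof (induction u)
  case (Cons l u) then show ?case by (cases l) auto
qed simp

lemma length_count_gen: "(u :: nat word) \<in> words {..<4} \<Longrightarrow> length u = count_gen 0 u + count_gen 1 u + count_gen 2 u + count_gen 3 u"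
  by (induction u) (auto simp: lessThan_4)

text \<open>Putting \<open>x_i = y_i t^2\<close> turns \<open>x_0 x_1^-1 x_0 x_3\<close> into
  \<open>y_0 y_1^-1 y_0 y_1 t^4\<close>, and \<open>t^4\<close> is trivial.\<close>

lemma embeds_F5_F5_b:
  "embeds_with_index (free_group_rank 5 \<times>\<times> free_group_rank 5) 16 (cyclic_group_of 4 [Pos 0, Neg 1, Pos 0, Pos 3])"
proof -
  interpret rotation 4 2 by unfold_locales auto
  obtain L where L: "subgroup L (presented_group KB)"
    "presented_group KB\<lparr>carrier := L\<rparr> \<cong> free_group_rank 5 \<times>\<times> free_group_rank 5"
    "card (rcosets\<^bsub>presented_group KB\<^esub> L) = 16"
    "\<And>u. u \<in> words {..<4} \<Longrightarrow> word_class KB u \<in> L \<longleftrightarrow> all_even u"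
    using KB_subgroup by blast
  have stab: "int 4 dvd int 2 * esum v" if v: "v \<in> words {..<4}" "word_class KB v \<in> L" for v
  proof -
    \<comment> \<open>All counts are even, hence so are the length and the exponent sum; twice the
      latter vanishes modulo 4.\<close>
    have "even (esum v)" using v L(4) length_count_gen by (simp add: even_esum all_even_def)
    then show ?thesis by simp presburger
  qed
  have "transduce (rot_nxt 4 2) (rot_out 4 2) s (shift_by 4 i [Pos 0, Neg 1, Pos 0, Pos 3])
     = shift_by 4 (i + s) [Pos 0, Neg 1, Pos 0, Pos 1]" if "s < 4" for s i
  proof -
    have "s \<in> {0, 1, 2, 3}" using that by (auto simp: lessThan_4[symmetric])
    then show ?thesis by (auto simp: rot_nxt_def rot_out_def mod_simps) presburger+
  qed
  note trans = this
  let ?w = "[Pos 0, Neg 1, Pos 0, Pos 3 :: nat letter]" and ?w' = "[Pos 0, Neg 1, Pos 0, Pos 1 :: nat letter]"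
  have w: "?w \<in> words {..<4}" "reduced ?w" "?w' \<in> words {..<4}" "reduced ?w'" "int 4 dvd int 2 * esum ?w"
    by auto
  obtain H where H: "subgroup H (cyclic_group_of 4 ?w)"
    "cyclic_group_of 4 ?w\<lparr>carrier := H\<rparr> \<cong> presented_group KB\<lparr>carrier := L\<rparr>"
    "card (rcosets\<^bsub>cyclic_group_of 4 ?w\<^esub> H) = card (rcosets\<^bsub>presented_group KB\<^esub> L)"
    using subgroup_transfer_cyclic[OF w trans L(1)[unfolded KB_def] stab[unfolded KB_def], folded KB_def]
    by blast
  then show ?thesis
    unfolding embeds_with_index_def by (intro exI[of _ H] conjI H(1) iso_trans[OF H(2) L(2)]) (simp only: H(3) L(3))
qed

section \<open>The derived subgroup\<close>

lemma (in wf_presentation) hom_word_class: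
  assumes M: "group M" and h: "h \<in> hom G M" and u: "u \<in> words (generators P)"
  shows "h (word_class P u) = word_value M (\<lambda>x. h (word_class P [Pos x])) u"
proof -
  interpret group_hom G M h
    using M h G.is_group by (simp add: group_hom_def group_hom_axioms_def)
  show ?thesis using u
  proof (induction u)
    case Nil
    then show ?case by (simp flip: one_G)
  next
    case (Cons l u)
    then have l: "[l] \<in> words (generators P)" "gen l \<in> generators P" by auto
    have "h (word_class P [l]) = letter_value M (\<lambda>x. h (word_class P [Pos x])) l"
    proof (cases l)
      case (Neg x)
      then have "word_class P [l] = inv\<^bsub>G\<^esub> (word_class P [Pos x])" using l by (simp add: inv_G)
      then show ?thesis using Neg l by (simp add: letter_value_def)
    qed (simp add: letter_value_def)
    moreover have "h (word_class P (l # u)) = h (word_class P [l]) \<otimes>\<^bsub>M\<^esub> h (word_class P u)"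
      using word_class_mult[of "[l]" u] l Cons.prems by (simp flip: hom_mult)
    ultimately show ?case using Cons by (simp add: word_value_Cons)
  qed
qed

text \<open>Where squares are trivial, signs do not matter, so the letter counts determine the
  value.\<close>

lemma (in comm_group) word_value_count_gen:
  assumes a: "a \<in> {..<4} \<rightarrow> carrier G" and u: "u \<in> words {..<4::nat}"
    and sq: "\<And>i. i < 4 \<Longrightarrow> a i \<otimes> a i = \<one>"
  shows "word_value G a u = a 0 [^] count_gen 0 u \<otimes> (a 1 [^] count_gen 1 u \<otimes> (a 2 [^] count_gen 2 u \<otimes> a 3 [^] count_gen 3 u))"
  using u
proof (induction u)
  case (Cons l u)
  have ac: "a 0 \<in> carrier G" "a 1 \<in> carrier G" "a 2 \<in> carrier G" "a 3 \<in> carrier G"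
    using a by auto
  have "letter_value G a l = a (gen l)"
    using Cons.prems a sq[of "gen l"] inv_equality[of "a (gen l)" "a (gen l)"] by (cases l) (auto simp: letter_value_def)
  moreover have "gen l = 0 \<or> gen l = 1 \<or> gen l = 2 \<or> gen l = 3" using Cons.prems by (auto simp: lessThan_4)
  ultimately show ?case using Cons ac
    by (elim disjE) (simp_all add: word_value_Cons m_ac)
qed simp

lemma (in comm_group) word_value_all_even:
  assumes a: "a \<in> {..<4} \<rightarrow> carrier G" and u: "u \<in> words {..<4::nat}"
    and sq: "\<And>i. i < 4 \<Longrightarrow> a i \<otimes> a i = \<one>" and "all_even u"
  shows "word_value G a u = \<one>"
proof -
  have "a i [^] count_gen i u = \<one>" if "i \<in> {0, 1, 2, 3}" for i
  proof -
    have i: "i < 4" using that by auto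
    then have ai: "a i \<in> carrier G" using a by auto
    have "even (count_gen i u)" using that \<open>all_even u\<close> by (auto simp: all_even_def)
    then obtain k where "count_gen i u = 2 * k" by (auto elim: evenE)
    moreover have "a i [^] (2::nat) = \<one>" using sq[OF i] ai by (simp add: numeral_2_eq_2)
    ultimately show ?thesis using nat_pow_pow[OF ai, of 2 k] by simp
  qed
  then show ?thesis using word_value_count_gen[OF a u sq] by simp
qed

lemma (in comm_group) square_eq_one:
  assumes "x \<in> carrier G" "y \<in> carrier G" "x \<otimes> (inv y \<otimes> (x \<otimes> (y \<otimes> \<one>))) = \<one>"
  shows "x \<otimes> x = \<one>"
  using m_lcomm[of "inv y" x y] assms by simp

text \<open>The derived subgroup is the all-even subgroup of \<open>KB_subgroup\<close>. Commutators
  have even counts; conversely, all generators have trivial squares in the abelianisation, so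
  all-even words vanish there.\<close>

lemma derived_KB:
  "card (rcosets\<^bsub>presented_group KB\<^esub> (derived (presented_group KB) (carrier (presented_group KB)))) = 16"
  "presented_group KB\<lparr>carrier := derived (presented_group KB) (carrier (presented_group KB))\<rparr>
     \<cong> free_group_rank 5 \<times>\<times> free_group_rank 5"
proof -
  interpret wf_presentation KB unfolding KB_def by (rule wf_cyclic_4) auto
  obtain L where L: "subgroup L (presented_group KB)"
    "presented_group KB\<lparr>carrier := L\<rparr> \<cong> free_group_rank 5 \<times>\<times> free_group_rank 5"
    "card (rcosets\<^bsub>presented_group KB\<^esub> L) = 16"
    "\<And>u. u \<in> words {..<4} \<Longrightarrow> word_class KB u \<in> L \<longleftrightarrow> all_even u"
    using KB_subgroup by blast
  let ?D = "derived G (carrier G)"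
  have inv: "count_gen g (inv_word u) = count_gen g u" for g and u :: "nat word"
    by (induction u) auto
  have "derived_set G (carrier G) \<subseteq> L"
    using L(4) by (auto simp: carrier_G inv_G word_class_mult all_even_def inv)
  then have "?D \<subseteq> L"
    unfolding derived_def using G.generate_subgroup_incl[OF _ L(1)] by blast
  moreover have "L \<subseteq> ?D"
  proof
    interpret D: normal ?D G by (rule G.derived_is_normal) (rule G.normal_self)
    interpret A: comm_group "G Mod ?D" by (rule G.derived_quot_is_comm_group)
    define a where "a i = ?D #>\<^bsub>G\<^esub> word_class KB [Pos i]" for i
    have hom: "(\<lambda>g. ?D #>\<^bsub>G\<^esub> g) \<in> hom G (G Mod ?D)" by (rule D.r_coset_hom_Mod)
    have val: "?D #>\<^bsub>G\<^esub> word_class KB u = word_value (G Mod ?D) a u" if "u \<in> words {..<4}" for u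
      using hom_word_class[OF A.is_group hom, of u] that by (simp add: a_def[abs_def])
    have ac: "a i \<in> carrier (G Mod ?D)" if "i < 4" for i
      using hom_in_carrier[OF hom, of "word_class KB [Pos i]"] that by (simp add: a_def)
    \<comment> \<open>In an abelian quotient a relator leaves only the square of its first
      generator.\<close>
    have sq: "a i \<otimes>\<^bsub>G Mod ?D\<^esub> a i = \<one>\<^bsub>G Mod ?D\<^esub>" if i: "i < 4" for i
    proof -
      let ?r = "shift_by 4 i [Pos 0, Neg 1, Pos 0, Pos 1]" and ?j = "(i + 1) mod 4"
      have r: "?r \<in> words {..<4}" by (rule shift_by_words) simp
      have "?r \<in> relators KB" unfolding KB_def by (rule shift_by_relator) auto
      then have "word_class KB ?r = \<one>\<^bsub>G\<^esub>"
        using r by (simp only: one_G word_class_eq_iff generators_KB words_simps weq_relatorI)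
      then have "word_value (G Mod ?D) a ?r = \<one>\<^bsub>G Mod ?D\<^esub>"
        using val[OF r] D.subset G.coset_mult_one by (simp add: FactGroup_def)
      moreover have "?r = [Pos i, Neg ?j, Pos i, Pos ?j]" using i by (simp add: add.commute)
      ultimately have "a i \<otimes>\<^bsub>G Mod ?D\<^esub> (inv\<^bsub>G Mod ?D\<^esub> a ?j \<otimes>\<^bsub>G Mod ?D\<^esub> (a i \<otimes>\<^bsub>G Mod ?D\<^esub> (a ?j \<otimes>\<^bsub>G Mod ?D\<^esub> \<one>\<^bsub>G Mod ?D\<^esub>))) = \<one>\<^bsub>G Mod ?D\<^esub>"
        by simp
      then show ?thesis using A.square_eq_one[of "a i" "a ?j"] ac i by simp
    qed
    fix C assume C: "C \<in> L"
    then obtain u where u: "u \<in> words {..<4}" "C = word_class KB u"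
      using subgroup.mem_carrier[OF L(1) C] by (auto simp: carrier_G)
    then have "all_even u" using C L(4) by simp
    then have "?D #>\<^bsub>G\<^esub> C = ?D"
      using A.word_value_all_even[of a u] u ac sq val by (auto simp: FactGroup_def)
    then show "C \<in> ?D"
      using G.rcos_self[OF subgroup.mem_carrier[OF L(1) C] D.subgroup_axioms] by simp
  qed
  ultimately have "?D = L" by blast
  then show "card (rcosets\<^bsub>G\<^esub> ?D) = 16" "G\<lparr>carrier := ?D\<rparr> \<cong> free_group_rank 5 \<times>\<times> free_group_rank 5"
    using L by simp_all
qed

lemma derived_iso:
  assumes G: "group G" and K: "group K" and "G \<cong> K"
  shows "card (rcosets\<^bsub>G\<^esub> (derived G (carrier G))) = card (rcosets\<^bsub>K\<^esub> (derived K (carrier K)))"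
    "G\<lparr>carrier := derived G (carrier G)\<rparr> \<cong> K\<lparr>carrier := derived K (carrier K)\<rparr>"
proof -
  obtain h where h: "h \<in> iso G K" using \<open>G \<cong> K\<close> by (auto simp: is_iso_def)
  interpret group_hom G K h
    using G K h by (simp add: group_hom_def group_hom_axioms_def iso_def)
  have inj: "inj_on h (carrier G)" and surj: "h ` carrier G = carrier K"
    using h by (auto simp: iso_def bij_betw_def)
  have img: "derived K (carrier K) = h ` derived G (carrier G)"
    using derived_img[of "carrier G"] surj by simp
  have "derived G (carrier G) \<subseteq> carrier G" by (rule G.derived_in_carrier) simp
  then have eq: "derived G (carrier G) = {g \<in> carrier G. h g \<in> derived K (carrier K)}"
    unfolding img using inj by (auto dest: inj_onD)
  have "subgroup (derived K (carrier K)) K" by (rule H.derived_is_subgroup) simp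
  from subgroup_iso_image[OF G K h this, folded eq]
  show "card (rcosets\<^bsub>G\<^esub> (derived G (carrier G))) = card (rcosets\<^bsub>K\<^esub> (derived K (carrier K)))"
    "G\<lparr>carrier := derived G (carrier G)\<rparr> \<cong> K\<lparr>carrier := derived K (carrier K)\<rparr>" by auto
qed

lemma embeds_with_index_iso:
  assumes G: "group G" and K: "group K" and "G \<cong> K" and "embeds_with_index A d K"
  shows "embeds_with_index A d G"
proof -
  obtain h where h: "h \<in> iso G K" using \<open>G \<cong> K\<close> by (auto simp: is_iso_def)
  obtain H where H: "subgroup H K" "card (rcosets\<^bsub>K\<^esub> H) = d" "K\<lparr>carrier := H\<rparr> \<cong> A"
    using assms(4) by (auto simp: embeds_with_index_def)
  note * = subgroup_iso_image[OF G K h H(1)]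
  show ?thesis unfolding embeds_with_index_def
    by (intro exI conjI) (rule *(1), simp add: *(3) H(2), rule iso_trans[OF *(2) H(3)])
qed

section \<open>Free quotients\<close>

lemma word_value_free_group:
  assumes "\<And>x. x \<in> X \<Longrightarrow> f x \<in> carrier (free_group Y)" "u \<in> words X"
  shows "word_value (free_group Y) f u = free_reduce (subst f u)"
  using assms(2)
proof (induction u)
  case (Cons l u)
  then have "f (gen l) \<in> carrier (free_group Y)" using assms(1) by simp
  then show ?case using Cons
    by (cases l) (simp_all add: mult_free_group inv_free_group free_reduce_append_right)
qed (simp add: one_free_group free_reduce_def)

text \<open>Send \<open>x_i\<close> to the generator \<open>i mod N\<close>: since \<open>N\<close>
  divides \<open>p\<close> the first two letters of a relator cancel, and since \<open>r\<close> is
  congruent to \<open>q\<close> the last two do. The injection \<open>k\<close> allows a basis in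
  any type, as \<open>large\<close> will require.\<close>

lemma epi_free_group:
  fixes k :: "nat \<Rightarrow> 'a"
  assumes N: "N \<ge> 1" and n: "n = M * N" "n > 0" and w: "wf_presentation (cyclic_presentation n w)"
    and w4: "w = [Pos 0, Neg p, Neg q, Pos r]" "w \<in> words {..<n}" and d: "N dvd p" "[r = q] (mod N)"
    and k: "inj_on k {..<N}"
  shows "epi (cyclic_group_of n w) (free_group (k ` {..<N})) \<noteq> {}"
proof -
  interpret wf_presentation "cyclic_presentation n w" by (rule w)
  let ?F = "free_group (k ` {..<N})"
  interpret F: group ?F by (rule group_free_group)
  define f where "f i = [Pos (k (i mod N))]" for i :: nat
  have f: "f x \<in> carrier ?F" for x using N by (auto simp: f_def carrier_free_group)
  have val: "word_value ?F f u = free_reduce (subst f u)" for u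
    by (rule word_value_free_group[of UNIV]) (auto simp: f)
  have "word_value ?F f s = \<one>\<^bsub>?F\<^esub>" if s': "s \<in> relators (cyclic_presentation n w)" for s
  proof -
    obtain i where s: "s = shift_by n i w" using s' unfolding relators_cyclic[OF w4(2)] by blast
    have mm: "x mod n mod N = x mod N" for x using n(1) by (simp add: mod_mod_cancel)
    have "f (i mod n) = f ((p + i) mod n)"
      using d(1) unfolding f_def mm by (simp add: mod_add_left_eq[symmetric, of p] dvd_imp_mod_0)
    moreover have "(r + i) mod N = (q + i) mod N"
      using d(2) by (metis cong_def mod_add_left_eq)
    then have "f ((r + i) mod n) = f ((q + i) mod n)"
      unfolding f_def mm by simp
    ultimately show ?thesis unfolding val s w4(1)
      by (simp add: f_def free_reduce_def one_free_group)
  qed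
  then obtain h where h: "h \<in> hom G ?F" "\<And>u. u \<in> words {..<n} \<Longrightarrow> h (word_class (cyclic_presentation n w) u) = free_reduce (subst f u)"
    using ex_hom[OF F.is_group, of f] f val by (metis Pi_I generators_cyclic)
  have "carrier ?F \<subseteq> h ` carrier G"
  proof
    fix u assume u: "u \<in> carrier ?F"
    define g where "g = map (map_letter (inv_into {..<N} k)) u"
    have g: "g \<in> words {..<n} \<and> subst f g = u" if "u \<in> words (k ` {..<N})"
      using that unfolding g_def
    proof (induction u)
      case (Cons l u)
      have m: "gen l \<in> k ` {..<N}" using Cons.prems by simp
      have "inv_into {..<N} k (gen l) \<in> {..<N}" "k (inv_into {..<N} k (gen l)) = gen l"
        using inv_into_into[OF m] f_inv_into_f[OF m] by auto
      moreover have "N \<le> n" using n by (cases M) auto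
      ultimately show ?case using Cons by (cases l) (auto simp: f_def)
    qed simp
    then have "u = h (word_class (cyclic_presentation n w) g)"
      using u by (simp add: h(2) carrier_free_group free_reduce_reduced)
    then show "u \<in> h ` carrier G" using g u by (auto simp: carrier_free_group)
  qed
  then have "h \<in> epi G ?F" using h(1) by (simp add: epi_iff_subset)
  then show ?thesis by blast
qed

lemma not_comm_free_group:
  assumes "x \<in> S" "y \<in> S" "x \<noteq> y"
  shows "\<not> comm_group (free_group S)"
proof
  assume "comm_group (free_group S)"
  then interpret comm_group "free_group S" .
  have "[Pos x] \<otimes>\<^bsub>free_group S\<^esub> [Pos y] = [Pos y] \<otimes>\<^bsub>free_group S\<^esub> [Pos x]"
    by (rule m_comm) (use assms in \<open>auto simp: carrier_free_group\<close>)
  then show False using assms by (simp add: mult_free_group free_reduce_def)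
qed

lemma largeI:
  fixes G :: "('a, 'b) monoid_scheme" and S :: "'a set"
  assumes G: "group G" and "epi G (free_group S) \<noteq> {}" "x \<in> S" "y \<in> S" "x \<noteq> y"
  shows "large G"
proof -
  interpret group G by (rule G)
  have "rcosets\<^bsub>G\<^esub> (carrier G) \<subseteq> {carrier G}"
    using coset_join2[OF _ subgroup_self] by (auto simp: RCOSETS_def)
  then have "finite (rcosets\<^bsub>G\<^esub> (carrier G))" by (rule finite_subset) simp
  moreover have "\<exists>S :: 'a set. \<not> comm_group (free_group S) \<and> epi (G\<lparr>carrier := carrier G\<rparr>) (free_group S) \<noteq> {}"
    using not_comm_free_group[OF assms(3-5)] assms(2) by auto
  ultimately show ?thesis unfolding large_def using subgroup_self by blast
qed

section \<open>Embedding the direct product of two free groups\<close>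

lemma (in group_hom) embeds_of_inj:
  assumes "inj_on h (carrier G)"
  shows "subgroup (h ` carrier G) H" "H\<lparr>carrier := h ` carrier G\<rparr> \<cong> G"
proof -
  show "subgroup (h ` carrier G) H" by (rule img_is_subgroup)
  have "h \<in> iso G (H\<lparr>carrier := h ` carrier G\<rparr>)"
    using assms by (auto simp: iso_def bij_betw_def hom_def)
  then show "H\<lparr>carrier := h ` carrier G\<rparr> \<cong> G" using G.iso_sym is_isoI by blast
qed

lemma subst_subst: "subst f (subst b u) = subst (\<lambda>i. subst f (b i)) u"
proof (induction u)
  case (Cons l u) then show ?case by (cases l) auto
qed simp

lemma subst_Nil: "subst (\<lambda>_. []) u = []"
proof (induction u)
  case (Cons l u) then show ?case by (cases l) auto
qed simp

lemma esum_inv_word: "esum (inv_word u) = - esum u"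
proof (induction u)
  case (Cons l u) then show ?case by (cases l) auto
qed simp

lemma esum_subst: "(\<And>x. esum (b x) = 0) \<Longrightarrow> esum (subst b u) = 0"
proof (induction u)
  case (Cons l u) then show ?case by (cases l) (auto simp: esum_inv_word)
qed simp

lemma esum_weq: "weq P u v \<Longrightarrow> (\<And>r. r \<in> relators P \<Longrightarrow> esum r = 0) \<Longrightarrow> esum u = esum v"
proof (induction rule: weq.induct)
  case (weq_cancel u l v)
  then show ?case by (cases l) auto
qed auto

text \<open>The substitution \<open>a \<mapsto> a b\<inverse>\<close>, \<open>b \<mapsto> b\<inverse> a\<close> causes no cancellation.\<close>

definition twist_gen :: "nat \<Rightarrow> nat word" where
  "twist_gen i = (if i = 0 then [Pos 0, Neg 1] else [Neg 1, Pos 0])"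

lemma twist_gen_simps [simp]:
  "twist_gen 0 = [Pos 0, Neg 1]" "twist_gen (Suc 0) = [Neg 1, Pos 0]"
  by (simp_all add: twist_gen_def)

text \<open>The image of one letter ends with the inverse of the first letter of the image of
  another only if the two letters are mutually inverse.\<close>

lemma reduced_twist:
  "u \<in> words {..<2} \<Longrightarrow> reduced u \<Longrightarrow> reduced (subst twist_gen u) \<and> (u \<noteq> [] \<longrightarrow> subst twist_gen u \<noteq> [])"
proof (induction u rule: induct_list012)
  case (3 k l u)
  have "gen k \<in> {0, 1}" "gen l \<in> {0, 1}" using 3 by auto
  moreover have "reduced (subst twist_gen (l # u))" using 3 by auto
  ultimately show ?case using "3.prems"
    by (cases k; cases l) auto
next
  case (2 k)
  then have "gen k \<in> {0, 1}" by auto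
  then show ?case by (cases k) auto
qed simp

text \<open>The generators 0, \<open>N\<close>, \<open>2 * N\<close>, \<open>3 * N\<close> commute
  along a 4-cycle. Inside each of the two opposite pairs the words \<open>x y^-1\<close> and
  \<open>y^-1 x\<close> generate a free group of exponent sum 0, so that any later twist is trivial
  on the product.\<close>

lemma embeds_F2_F2_commutator:
  assumes N: "N \<ge> 1" and n: "n = 4 * N" and p: "p = N \<or> p = 3 * N"
  defines "w \<equiv> [Pos 0, Neg p, Neg 0, Pos p]"
  obtains L where "subgroup L (cyclic_group_of n w)"
    "cyclic_group_of n w\<lparr>carrier := L\<rparr> \<cong> free_group_rank 2 \<times>\<times> free_group_rank 2"
    "\<And>v. v \<in> words {..<n} \<Longrightarrow> word_class (cyclic_presentation n w) v \<in> L \<Longrightarrow> esum v = 0"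
proof -
  let ?P = "cyclic_presentation n w"
  have w: "w \<in> words {..<n}" "reduced w" using p N n by (auto simp: w_def)
  have n0: "n > 0" using n N by simp
  interpret wf_presentation ?P
    unfolding wf_presentation_def using w by (rule well_formed_cyclic)
  interpret F2: group F2 by (rule group_free_group)
  interpret FF: group "F2 \<times>\<times> F2" by (intro DirProd_group group_free_group)
  have rel: "\<exists>a b. r = [Pos a, Neg b, Neg a, Pos b] \<and> a < n \<and> b = (a + p) mod n" if r: "r \<in> relators ?P" for r
  proof -
    obtain i where "i < n" "r = shift_by n i w" using r unfolding relators_cyclic[OF w(1)] by blast
    then show ?thesis by (auto simp: w_def add.commute)
  qed
  \<comment> \<open>Dividing by \<open>N\<close> reduces these subscripts to arithmetic modulo 4,
    for both values of \<open>p\<close> at once.\<close>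
  obtain c where c: "p = c * N" "c = 1 \<or> c = 3"
    using p by (metis mult_1)
  have sum: "(d * N + p) mod n = (d + c) mod 4 * N" for d
    unfolding c(1) n add_mult_distrib[symmetric] by (rule mod_mult_mult2)
  have far: "a \<in> {0, 2 * N} \<Longrightarrow> (a + p) mod n \<in> {N, 3 * N}" "a \<in> {N, 3 * N} \<Longrightarrow> (a + p) mod n \<in> {0, 2 * N}" for a
    using sum[of 0] sum[of 1] sum[of 2] sum[of 3] c(2) by auto
  have comm1: "commutes ?P [k] [l]" if "gen k = a" "gen l = (a + p) mod n" "a < n" for k l a
  proof -
    have "shift_by n a w \<in> relators ?P" by (rule shift_by_relator[OF n0 w(1)])
    then have "weq ?P [Pos a, Neg ((a + p) mod n), Neg a, Pos ((a + p) mod n)] []"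
      using that(3) by (auto simp: w_def add.commute dest!: weq_relatorI)
    then show ?thesis using that(1,2) by (rule commutes_letters)
  qed
  have comm: "commutes ?P [k] [l]" if "gen k \<in> {0, 2 * N}" "gen l \<in> {N, 3 * N}" for k l
  proof -
    have "gen l = (gen k + p) mod n \<or> gen k = (gen l + p) mod n"
      using that sum[of 0] sum[of 1] sum[of 2] sum[of 3] c(2) by auto
    moreover have "gen k < n" "gen l < n" using that N n by auto
    ultimately show ?thesis using comm1[of k "gen k" l] comm1[of l "gen l" k] commutes_sym by blast
  qed
  define b0 where "b0 i = (if i = 0 then [Pos 0, Neg (2 * N)] else [Neg (2 * N), Pos 0])" for i :: nat
  define b1 where "b1 i = (if i = 0 then [Pos N, Neg (3 * N)] else [Neg (3 * N), Pos N])" for i :: nat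
  have b0: "subst b0 u \<in> words {0, 2 * N}" for u by (rule subst_words[of UNIV]) (auto simp: b0_def)
  have b1: "subst b1 u \<in> words {N, 3 * N}" for u by (rule subst_words[of UNIV]) (auto simp: b1_def)
  have bw: "subst b0 u \<in> words {..<n}" "subst b1 u \<in> words {..<n}" for u
    using b0[of u] b1[of u] N n by (auto simp: words_def)
  define j where "j = (\<lambda>(u, v). word_class ?P (subst b0 u @ subst b1 v))"
  have jhom: "j \<in> hom (F2 \<times>\<times> F2) G"
  proof (rule homI)
    fix x y :: "nat word \<times> nat word"
    obtain u v u' v' where xy: "x = (u, v)" "y = (u', v')" by (cases x; cases y)
    have "commutes ?P (subst b0 u') (subst b1 v)"
    proof (rule commutes_words)
      fix k l assume "k \<in> set (subst b0 u')" "l \<in> set (subst b1 v)"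
      then show "commutes ?P [k] [l]"
        using b0[of u'] b1[of v] by (intro comm) (auto simp: words_def word_gens_def)
    qed
    then have "weq ?P (subst b0 u @ (subst b0 u' @ subst b1 v) @ subst b1 v') (subst b0 u @ (subst b1 v @ subst b0 u') @ subst b1 v')"
      unfolding commutes_def by (rule weq_context)
    then have A: "weq ?P (subst b0 u @ subst b0 u' @ subst b1 v @ subst b1 v') (subst b0 u @ subst b1 v @ subst b0 u' @ subst b1 v')"
      by simp
    have "weq ?P (subst b0 (free_reduce (u @ u'))) (subst b0 u @ subst b0 u')"
      "weq ?P (subst b1 (free_reduce (v @ v'))) (subst b1 v @ subst b1 v')"
      using free_eq_subst[OF free_reduce_idem, of b0 "u @ u'"] free_eq_subst[OF free_reduce_idem, of b1 "v @ v'"]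
      by (auto intro: weq_free_reduceI)
    then have "weq ?P (subst b0 (free_reduce (u @ u')) @ subst b1 (free_reduce (v @ v'))) (subst b0 u @ subst b0 u' @ subst b1 v @ subst b1 v')"
      using weq_append by fastforce
    from weq_trans[OF this A]
    have "weq ?P (subst b0 (free_reduce (u @ u')) @ subst b1 (free_reduce (v @ v'))) (subst b0 u @ subst b1 v @ subst b0 u' @ subst b1 v')" .
    then show "j (x \<otimes>\<^bsub>F2 \<times>\<times> F2\<^esub> y) = j x \<otimes>\<^bsub>G\<^esub> j y"
      by (simp add: xy j_def mult_free_group word_class_mult bw word_class_eq_iff)
  qed (auto simp: j_def bw)
  interpret J: group_hom "F2 \<times>\<times> F2" G j
    using jhom FF.is_group G.is_group by (simp add: group_hom_def group_hom_axioms_def)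
  have retract: "\<exists>h \<in> hom G F2. \<forall>u \<in> words {..<n}. h (word_class ?P u) = free_reduce (subst f u)"
    if f: "\<And>i. f i \<in> {[], [Pos 0], [Pos 1]}" and kill: "\<And>i. f i = [] \<or> f ((i + p) mod n) = []" for f :: "nat \<Rightarrow> nat word"
  proof -
    have fc: "f x \<in> carrier F2" for x using f[of x] by (auto simp: carrier_free_group)
    have val: "word_value F2 f u = free_reduce (subst f u)" for u
      by (rule word_value_free_group[of UNIV]) (auto simp: fc)
    \<comment> \<open>Under \<open>f\<close> a relator becomes a commutator of two words, one of
      which is empty by \<open>kill\<close>.\<close>
    have "word_value F2 f r = \<one>\<^bsub>F2\<^esub>" if r': "r \<in> relators ?P" for r
    proof -
      obtain a b where r: "r = [Pos a, Neg b, Neg a, Pos b]" "b = (a + p) mod n" using rel[OF r'] by blast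
      show ?thesis using kill[of a] f[of a] f[of b] r unfolding val
        by (auto simp: free_reduce_def one_free_group)
    qed
    then obtain h where "h \<in> hom G F2" "\<And>u. u \<in> words {..<n} \<Longrightarrow> h (word_class ?P u) = free_reduce (subst f u)"
      using ex_hom[OF F2.is_group, of f] fc val by (metis Pi_I generators_cyclic)
    then show ?thesis by blast
  qed
  have trivial: "u = []" if "u \<in> carrier F2" "free_reduce (subst twist_gen u) = []" for u
    using reduced_twist[of u] that by (auto simp: carrier_free_group free_reduce_reduced)
  have inj: "inj_on j (carrier (F2 \<times>\<times> F2))"
  proof (rule J.inj_on_one_iff[THEN iffD2], intro allI impI)
    fix x assume x: "x \<in> carrier (F2 \<times>\<times> F2)" and jx: "j x = \<one>\<^bsub>G\<^esub>"
    obtain u v where uv: "x = (u, v)" "u \<in> carrier F2" "v \<in> carrier F2" using x by auto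
    have uv': "u \<in> words {..<2}" "v \<in> words {..<2}" using uv by (auto simp: carrier_free_group)
    have one: "word_class ?P (subst b0 u @ subst b1 v) = word_class ?P []"
      using jx uv by (simp add: j_def one_G)
    \<comment> \<open>\<open>f0\<close> keeps the pair 0, \<open>2 * N\<close> and \<open>f1\<close>
      the pair \<open>N\<close>, \<open>3 * N\<close>; each kills all other generators and so
      detects one factor.\<close>
    define f0 where "f0 i = (if i = 0 then [Pos 0] else if i = 2 * N then [Pos 1] else [] :: nat word)" for i :: nat
    define f1 where "f1 i = (if i = N then [Pos 0] else if i = 3 * N then [Pos 1] else [] :: nat word)" for i :: nat
    have supp: "f0 i \<noteq> [] \<Longrightarrow> i \<in> {0, 2 * N}" "i \<in> {N, 3 * N} \<Longrightarrow> f0 i = []"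
      "f1 i \<noteq> [] \<Longrightarrow> i \<in> {N, 3 * N}" "i \<in> {0, 2 * N} \<Longrightarrow> f1 i = []" for i
      using N by (auto simp: f0_def f1_def split: if_splits)
    have k0: "f0 i = [] \<or> f0 ((i + p) mod n) = []" and k1: "f1 i = [] \<or> f1 ((i + p) mod n) = []" for i
      using supp far by blast+
    have "subst f0 (b0 i) = twist_gen i" "subst f0 (b1 i) = []"
      "subst f1 (b1 i) = twist_gen i" "subst f1 (b0 i) = []" for i
      using N by (auto simp: f0_def f1_def b0_def b1_def twist_gen_def)
    then have s0: "subst f0 (subst b0 u) = subst twist_gen u" "subst f0 (subst b1 v) = []"
      "subst f1 (subst b1 v) = subst twist_gen v" "subst f1 (subst b0 u) = []"
      unfolding subst_subst by (simp_all add: subst_Nil)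
    have "free_reduce (subst f (subst b0 u @ subst b1 v)) = []"
      if f: "\<And>i. f i \<in> {[], [Pos 0], [Pos 1]}" and kill: "\<And>i. f i = [] \<or> f ((i + p) mod n) = []" for f :: "nat \<Rightarrow> nat word"
    proof -
      obtain h where h: "\<And>u. u \<in> words {..<n} \<Longrightarrow> h (word_class ?P u) = free_reduce (subst f u)"
        using retract[of f, OF f kill] by blast
      have "free_reduce (subst f (subst b0 u @ subst b1 v)) = h (word_class ?P (subst b0 u @ subst b1 v))"
        using h[of "subst b0 u @ subst b1 v"] bw by simp
      then show ?thesis unfolding one using h[of "[]"] by (simp add: free_reduce_def)
    qed
    from this[of f0] this[of f1] k0 k1 s0 have "free_reduce (subst twist_gen u) = []" "free_reduce (subst twist_gen v) = []"
      by (auto simp: f0_def f1_def)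
    then show "x = \<one>\<^bsub>F2 \<times>\<times> F2\<^esub>" using uv trivial by (simp add: one_free_group)
  qed
  have "esum v = 0" if v: "v \<in> words {..<n}" "word_class ?P v \<in> j ` carrier (F2 \<times>\<times> F2)" for v
  proof -
    obtain u u' where "word_class ?P v = word_class ?P (subst b0 u @ subst b1 u')"
      using v(2) by (auto simp: j_def)
    then have "weq ?P v (subst b0 u @ subst b1 u')" using v bw by (simp add: word_class_eq_iff)
    moreover have "esum r = 0" if "r \<in> relators ?P" for r using rel[OF that] by auto
    ultimately have "esum v = esum (subst b0 u @ subst b1 u')" using esum_weq[of ?P] by blast
    then show ?thesis by (simp add: esum_subst b0_def b1_def)
  qed
  then show thesis using that J.embeds_of_inj[OF inj] by blast
qed

text \<open>The copy found for the commutator word has exponent sum 0, so the rotation by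
  \<open>q\<close> carries it over for every \<open>q\<close>.\<close>

lemma embeds_F2_F2:
  assumes N: "N \<ge> 1" and n4: "n = 4 * N" and p: "p = N \<or> p = 3 * N" and q: "q < n"
    and r: "[r = p + q] (mod n)" "r < n" "q \<noteq> r"
  shows "embeds_as_subgroup (free_group_rank 2 \<times>\<times> free_group_rank 2) (cyclic_group_of n [Pos 0, Neg p, Neg q, Pos r])"
proof -
  interpret rotation n q using N n4 q by unfold_locales auto
  let ?w = "[Pos 0, Neg p, Neg q, Pos r]" and ?w' = "[Pos 0, Neg p, Neg 0, Pos p]"
  obtain L where L: "subgroup L (cyclic_group_of n ?w')"
    "cyclic_group_of n ?w'\<lparr>carrier := L\<rparr> \<cong> free_group_rank 2 \<times>\<times> free_group_rank 2"
    "\<And>v. v \<in> words {..<n} \<Longrightarrow> word_class (cyclic_presentation n ?w') v \<in> L \<Longrightarrow> esum v = 0"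
    using embeds_F2_F2_commutator[OF N n4 p] by blast
  have w: "?w \<in> words {..<n}" "reduced ?w" "?w' \<in> words {..<n}" "reduced ?w'" "int n dvd int q * esum ?w"
    using N n4 p assms(4) r by auto
  have stab: "int n dvd int q * esum v" if "v \<in> words {..<n}" "word_class (cyclic_presentation n ?w') v \<in> L" for v
    using L(3)[OF that] by simp
  obtain H where H: "subgroup H (cyclic_group_of n ?w)"
    "cyclic_group_of n ?w\<lparr>carrier := H\<rparr> \<cong> cyclic_group_of n ?w'\<lparr>carrier := L\<rparr>"
    by (rule subgroup_transfer_cyclic[OF w transduce_commutator[OF r(1)] L(1) stab])
  then show ?thesis
    unfolding embeds_as_subgroup_def by (intro exI[of _ H] conjI H(1) iso_trans[OF H(2) L(2)])
qed

section \<open>Disjoint unions of copies of \<open>K_{4,4}\<close>\<close>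

section \<open>Graphs whose components are complete bipartite\<close>

lemma walk_verts: "walk G u es v \<Longrightarrow> u \<in> verts G \<and> v \<in> verts G"
  by (induction es arbitrary: u) auto

lemma walk_append: "walk G u es x \<Longrightarrow> walk G x es' v \<Longrightarrow> walk G u (es @ es') v"
  by (induction es arbitrary: u) auto

text \<open>\<open>\<kappa>\<close> names the component of a vertex and \<open>col\<close> its
  side.\<close>

locale bipartite_blocks =
  fixes \<Gamma> :: "('v, 'e) multigraph" and \<kappa> :: "'v \<Rightarrow> nat" and col :: "'v \<Rightarrow> bool"
  assumes fin: "finite (verts \<Gamma>)"
    and edge: "e \<in> edges \<Gamma> \<Longrightarrow> \<exists>u\<in>verts \<Gamma>. \<exists>v\<in>verts \<Gamma>. ends \<Gamma> e = {u, v} \<and> \<kappa> u = \<kappa> v \<and> col u \<and> \<not> col v"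
    and edge_ex1: "u \<in> verts \<Gamma> \<Longrightarrow> v \<in> verts \<Gamma> \<Longrightarrow> \<kappa> u = \<kappa> v \<Longrightarrow> col u \<Longrightarrow> \<not> col v \<Longrightarrow>
      \<exists>!e. e \<in> edges \<Gamma> \<and> ends \<Gamma> e = {u, v}"
    and card4: "u \<in> verts \<Gamma> \<Longrightarrow> card {v \<in> verts \<Gamma>. \<kappa> v = \<kappa> u \<and> col v = c} = 4"
begin

definition part :: "nat \<Rightarrow> bool \<Rightarrow> 'v set" where
  "part j c = {v \<in> verts \<Gamma>. \<kappa> v = j \<and> col v = c}"

definition block :: "nat \<Rightarrow> ('v, 'e) multigraph" where
  "block j = \<lparr>verts = {v \<in> verts \<Gamma>. \<kappa> v = j},
     edges = {e \<in> edges \<Gamma>. ends \<Gamma> e \<subseteq> {v \<in> verts \<Gamma>. \<kappa> v = j}}, ends = ends \<Gamma>\<rparr>"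

lemma block_simps [simp]:
  "verts (block j) = {v \<in> verts \<Gamma>. \<kappa> v = j}" "ends (block j) = ends \<Gamma>"
  "edges (block j) = {e \<in> edges \<Gamma>. ends \<Gamma> e \<subseteq> {v \<in> verts \<Gamma>. \<kappa> v = j}}"
  by (simp_all add: block_def)

lemma edge_step:
  "e \<in> edges \<Gamma> \<Longrightarrow> ends \<Gamma> e = {u, x} \<Longrightarrow> u \<in> verts \<Gamma> \<and> x \<in> verts \<Gamma> \<and> \<kappa> x = \<kappa> u \<and> col x \<noteq> col u"
  using edge[of e] by (auto simp: doubleton_eq_iff)

lemma edge_ex1': "u \<in> verts \<Gamma> \<Longrightarrow> v \<in> verts \<Gamma> \<Longrightarrow> \<kappa> u = \<kappa> v \<Longrightarrow> col u \<noteq> col v \<Longrightarrow>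
      \<exists>!e. e \<in> edges \<Gamma> \<and> ends \<Gamma> e = {u, v}"
  using edge_ex1[of u v] edge_ex1[of v u] by (cases "col u") (auto simp: insert_commute)

lemma part_card: "j \<in> \<kappa> ` verts \<Gamma> \<Longrightarrow> card (part j c) = 4"
  using card4 by (auto simp: part_def)

lemma part_two:
  assumes "j \<in> \<kappa> ` verts \<Gamma>"
  obtains x y where "x \<in> part j c" "y \<in> part j c" "x \<noteq> y"
proof -
  have "\<not> card (part j c) \<le> Suc 0" using part_card[OF assms, of c] by simp
  moreover have "finite (part j c)" using fin by (simp add: part_def)
  ultimately show thesis using that by (meson card_le_Suc0_iff_eq)
qed

lemma walk_invariant:
  "walk \<Gamma> u es v \<Longrightarrow> u \<in> verts \<Gamma> \<and> v \<in> verts \<Gamma> \<and> \<kappa> v = \<kappa> u \<and> (col v = col u \<longleftrightarrow> even (length es))"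
proof (induction es arbitrary: u)
  case (Cons e es)
  then obtain x where x: "e \<in> edges \<Gamma>" "ends \<Gamma> e = {u, x}" "walk \<Gamma> x es v" by auto
  show ?case using edge_step[OF x(1,2)] Cons.IH[OF x(3)] by auto
qed simp

lemma walk_block: "walk (block j) u es v \<Longrightarrow> walk \<Gamma> u es v"
  by (induction es arbitrary: u) auto

lemma adjacent_block:
  assumes "u \<in> verts (block j)" "v \<in> verts (block j)" "col u \<noteq> col v"
  obtains e where "e \<in> edges (block j)" "ends \<Gamma> e = {u, v}"
  using edge_ex1'[of u v] assms by force

lemma short_walk:
  assumes "u \<in> verts (block j)" "v \<in> verts (block j)"
  obtains es where "walk (block j) u es v" "length es \<le> 2"
proof (cases "col u = col v")
  case False
  then obtain e where e: "e \<in> edges (block j)" "ends \<Gamma> e = {u, v}" using adjacent_block[OF assms] by blast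
  have "walk (block j) u [e] v" using e assms by auto
  then show thesis using that[of "[e]"] by simp
next
  case True
  have "j \<in> \<kappa> ` verts \<Gamma>" using assms by auto
  then obtain x where "x \<in> part j (\<not> col u)" using part_two by blast
  then have x: "x \<in> verts (block j)" "col x \<noteq> col u" by (auto simp: part_def)
  obtain e where e: "e \<in> edges (block j)" "ends \<Gamma> e = {u, x}" using adjacent_block[OF assms(1) x(1)] x by blast
  obtain e' where e': "e' \<in> edges (block j)" "ends \<Gamma> e' = {x, v}" using adjacent_block[OF x(1) assms(2)] x True by blast
  have "walk (block j) u [e, e'] v" using e e' assms x by auto
  then show thesis using that[of "[e, e']"] by simp
qed

lemma components_eq: "components \<Gamma> = block ` \<kappa> ` verts \<Gamma>"
proof -
  have "{v. \<exists>es. walk \<Gamma> u es v} = {v \<in> verts \<Gamma>. \<kappa> v = \<kappa> u}" if "u \<in> verts \<Gamma>" for u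
  proof
    show "{v. \<exists>es. walk \<Gamma> u es v} \<subseteq> {v \<in> verts \<Gamma>. \<kappa> v = \<kappa> u}" using walk_invariant by blast
    show "{v \<in> verts \<Gamma>. \<kappa> v = \<kappa> u} \<subseteq> {v. \<exists>es. walk \<Gamma> u es v}"
    proof
      fix v assume "v \<in> {v \<in> verts \<Gamma>. \<kappa> v = \<kappa> u}"
      then have "u \<in> verts (block (\<kappa> u))" "v \<in> verts (block (\<kappa> u))" using that by auto
      then obtain es where "walk (block (\<kappa> u)) u es v" using short_walk by blast
      then show "v \<in> {v. \<exists>es. walk \<Gamma> u es v}" using walk_block by blast
    qed
  qed
  then show ?thesis by (simp add: components_def block_def Let_def image_image)
qed

lemma card_components: "card (components \<Gamma>) = card (\<kappa> ` verts \<Gamma>)" "finite (components \<Gamma>)"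
proof -
  have "inj_on block (\<kappa> ` verts \<Gamma>)"
  proof (rule inj_onI)
    fix j k assume "j \<in> \<kappa> ` verts \<Gamma>" "k \<in> \<kappa> ` verts \<Gamma>" "block j = block k"
    then have "{v \<in> verts \<Gamma>. \<kappa> v = j} = {v \<in> verts \<Gamma>. \<kappa> v = k}" by (metis block_simps(1))
    then show "j = k" using \<open>j \<in> \<kappa> ` verts \<Gamma>\<close> by auto
  qed
  then show "card (components \<Gamma>) = card (\<kappa> ` verts \<Gamma>)" "finite (components \<Gamma>)"
    using fin by (simp_all add: components_eq card_image)
qed

context
  fixes j assumes j: "j \<in> \<kappa> ` verts \<Gamma>"
begin

lemma connected_block: "connected_graph (block j)"
  unfolding connected_graph_def
proof (intro conjI ballI)
  show "verts (block j) \<noteq> {}" using j by auto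
  show "\<exists>es. walk (block j) u es v" if "u \<in> verts (block j)" "v \<in> verts (block j)" for u v
    using short_walk[OF that] by blast
qed

lemma bipartite_block: "bipartite (block j)"
  unfolding bipartite_def
proof (rule exI[of _ "part j True"], rule exI[of _ "part j False"], intro conjI ballI)
  fix e assume "e \<in> edges (block j)"
  then have e: "e \<in> edges \<Gamma>" "ends \<Gamma> e \<subseteq> {v \<in> verts \<Gamma>. \<kappa> v = j}" by auto
  obtain u v where "ends \<Gamma> e = {u, v}" "col u" "\<not> col v" using edge[OF e(1)] by blast
  then show "\<exists>a\<in>part j True. \<exists>b\<in>part j False. ends (block j) e = {a, b}"
    using e(2) by (auto simp: part_def)
qed (auto simp: part_def)

lemma diameter_block: "graph_diameter (block j) = enat 2"
proof (rule antisym)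
  show "graph_diameter (block j) \<le> enat 2"
    unfolding graph_diameter_def
  proof (intro SUP_least)
    fix u v assume "u \<in> verts (block j)" "v \<in> verts (block j)"
    then obtain es where "walk (block j) u es v" "length es \<le> 2" using short_walk by blast
    then show "graph_dist (block j) u v \<le> enat 2"
      unfolding graph_dist_def by (intro INF_lower2[of es]) auto
  qed
  \<comment> \<open>Distinct vertices of equal colour are joined by walks of even length only, so
    the bound 2 is attained.\<close>
  obtain x y where xy: "x \<in> part j True" "y \<in> part j True" "x \<noteq> y" using part_two[OF j] by blast
  have "enat 2 \<le> graph_dist (block j) x y"
    unfolding graph_dist_def
  proof (rule INF_greatest)
    fix es assume "es \<in> {es. walk (block j) x es y}"
    then have w: "walk (block j) x es y" by simp
    have "even (length es)" using walk_invariant[OF walk_block[OF w]] xy by (auto simp: part_def)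
    moreover have "es \<noteq> []" using w xy by auto
    ultimately have "2 \<le> length es" by (cases es; cases "tl es") auto
    then show "enat 2 \<le> enat (length es)" by simp
  qed
  also have "\<dots> \<le> graph_diameter (block j)"
    unfolding graph_diameter_def using xy
    by (intro SUP_upper2[of x] SUP_upper2[of y]) (auto simp: part_def)
  finally show "enat 2 \<le> graph_diameter (block j)" .
qed

lemma girth_block: "girth (block j) = enat 4"
proof (rule antisym)
  obtain x y where xy: "x \<in> part j True" "y \<in> part j True" "x \<noteq> y" using part_two[OF j] by blast
  obtain z w where zw: "z \<in> part j False" "w \<in> part j False" "z \<noteq> w" using part_two[OF j] by blast
  have E: "\<exists>e. e \<in> edges (block j) \<and> ends \<Gamma> e = {a, b}" if "a \<in> part j c" "b \<in> part j (\<not> c)" for a b c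
  proof -
    have "a \<in> verts (block j)" "b \<in> verts (block j)" "col a \<noteq> col b" using that by (auto simp: part_def)
    then show ?thesis using adjacent_block by blast
  qed
  obtain e1 where e1: "e1 \<in> edges (block j)" "ends \<Gamma> e1 = {x, z}" using E[of x True z] xy zw by auto
  obtain e2 where e2: "e2 \<in> edges (block j)" "ends \<Gamma> e2 = {z, y}" using E[of z False y] xy zw by auto
  obtain e3 where e3: "e3 \<in> edges (block j)" "ends \<Gamma> e3 = {y, w}" using E[of y True w] xy zw by auto
  obtain e4 where e4: "e4 \<in> edges (block j)" "ends \<Gamma> e4 = {w, x}" using E[of w False x] xy zw by auto
  have v: "x \<in> verts (block j)" "y \<in> verts (block j)" "z \<in> verts (block j)" "w \<in> verts (block j)"
    using xy zw by (auto simp: part_def)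
  have "walk (block j) x [e1, e2, e3, e4] x"
    using e1 e2 e3 e4 v by auto
  moreover have "e1 \<noteq> e2" "e2 \<noteq> e3" "e3 \<noteq> e4"
    using e1(2) e2(2) e3(2) e4(2) xy zw by (auto simp: doubleton_eq_iff part_def)
  ultimately show "girth (block j) \<le> enat 4"
    unfolding girth_def by (intro INF_lower2[of "[e1, e2, e3, e4]"]) auto
  show "enat 4 \<le> girth (block j)"
    unfolding girth_def
  proof (rule INF_greatest)
    fix es assume "es \<in> {es. es \<noteq> [] \<and> distinct_adj es \<and> (\<exists>v. walk (block j) v es v)}"
    then obtain v where es: "es \<noteq> []" "distinct_adj es" "walk (block j) v es v" by auto
    have ev: "even (length es)" using walk_invariant[OF walk_block[OF es(3)]] by simp
    have "length es \<noteq> 2"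
    proof
      assume "length es = 2"
      then obtain e f where ef: "es = [e, f]" by (auto simp: length_Suc_conv numeral_2_eq_2)
      then obtain a where a: "ends \<Gamma> e = {v, a}" "ends \<Gamma> f = {a, v}" "e \<in> edges \<Gamma>" "f \<in> edges \<Gamma>"
        using es(3) by auto
      have "e = f" using edge_ex1'[of v a] edge_step[OF a(3,1)] a by (auto simp: insert_commute)
      then show False using es(2) ef by simp
    qed
    then have "4 \<le> length es" using ev es(1) unfolding length_0_conv[symmetric] by presburger
    then show "enat 4 \<le> enat (length es)" by simp
  qed
qed

lemma degree_block: "v \<in> verts (block j) \<Longrightarrow> finite (edges \<Gamma>) \<Longrightarrow> 3 \<le> degree (block j) v"
proof -
  assume v: "v \<in> verts (block j)" and fE: "finite (edges \<Gamma>)"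
  let ?p = "part j (\<not> col v)"
  define g where "g w = (SOME e. e \<in> edges (block j) \<and> ends \<Gamma> e = {v, w})" for w
  have g: "g w \<in> edges (block j) \<and> ends \<Gamma> (g w) = {v, w}" if w: "w \<in> ?p" for w
  proof -
    have "w \<in> verts (block j)" "col v \<noteq> col w" using w by (auto simp: part_def)
    then have "\<exists>e. e \<in> edges (block j) \<and> ends \<Gamma> e = {v, w}" using adjacent_block[OF v] by blast
    then show ?thesis unfolding g_def by (rule someI_ex)
  qed
  have "inj_on g ?p"
  proof (rule inj_onI)
    fix x y assume "x \<in> ?p" "y \<in> ?p" "g x = g y"
    then have "{v, x} = {v, y}" using g by metis
    then show "x = y" by (auto simp: doubleton_eq_iff)
  qed
  then have "card (g ` ?p) = 4" using part_card[OF j] by (simp add: card_image)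
  moreover have "g ` ?p \<subseteq> {e \<in> edges (block j). v \<in> ends (block j) e}" using g by auto
  moreover have "finite {e \<in> edges (block j). v \<in> ends (block j) e}" using fE by simp
  ultimately have "4 \<le> card {e \<in> edges (block j). v \<in> ends (block j) e}" by (metis card_mono)
  then show ?thesis by (simp add: degree_def)
qed

end

text \<open>Any colour-preserving bijection of the vertices extends to the edges, because an edge is
  determined by its ends.\<close>

lemma block_iso:
  assumes j: "j \<in> \<kappa> ` verts \<Gamma>" and k: "k \<in> \<kappa> ` verts \<Gamma>"
  shows "graph_isomorphic (block j) (block k)"
proof -
  have fp: "finite (part i c)" for i c using fin by (simp add: part_def)
  have "\<exists>h. bij_betw h (part j c) (part k c)" for c
    using finite_same_card_bij[OF fp fp] part_card[OF j] part_card[OF k] by simp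
  then obtain h where h: "\<And>c. bij_betw (h c) (part j c) (part k c)" by metis
  define f where "f v = h (col v) v" for v
  have fpart: "f v \<in> part k (col v)" if "v \<in> verts (block j)" for v
    using that bij_betwE[OF h[of "col v"]] by (auto simp: f_def part_def)
  have bij: "bij_betw f (verts (block j)) (verts (block k))"
    unfolding bij_betw_def
  proof
    show inj: "inj_on f (verts (block j))"
    proof (rule inj_onI)
      fix u v assume uv: "u \<in> verts (block j)" "v \<in> verts (block j)" "f u = f v"
      then have c: "col u = col v" using fpart[of u] fpart[of v] by (simp add: part_def)
      then have "u \<in> part j (col u)" "v \<in> part j (col u)" using uv by (auto simp: part_def)
      then show "u = v" using uv(3) c h[of "col u"] by (auto simp: f_def bij_betw_def dest: inj_onD)
    qed
    show "f ` verts (block j) = verts (block k)"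
    proof
      show "f ` verts (block j) \<subseteq> verts (block k)" using fpart by (auto simp: part_def)
      show "verts (block k) \<subseteq> f ` verts (block j)"
      proof
        fix v assume "v \<in> verts (block k)"
        then have "v \<in> part k (col v)" by (simp add: part_def)
        then obtain u where u: "u \<in> part j (col v)" "v = h (col v) u"
          using h[of "col v"] by (auto simp: bij_betw_def)
        then have "col u = col v" "u \<in> verts (block j)" by (auto simp: part_def)
        then have "v = f u" using u(2) by (simp add: f_def)
        then show "v \<in> f ` verts (block j)" using \<open>u \<in> verts (block j)\<close> by blast
      qed
    qed
  qed
  define g where "g e = (THE e'. e' \<in> edges \<Gamma> \<and> ends \<Gamma> e' = f ` ends \<Gamma> e)" for e
  have ex1: "\<exists>!e'. e' \<in> edges \<Gamma> \<and> ends \<Gamma> e' = f ` ends \<Gamma> e" if e: "e \<in> edges (block j)" for e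
  proof -
    obtain u v where uv: "ends \<Gamma> e = {u, v}" "col u" "\<not> col v" "u \<in> verts (block j)" "v \<in> verts (block j)"
      using e edge[of e] by force
    then have "f u \<in> part k True" "f v \<in> part k False" using fpart by force+
    then show ?thesis using uv edge_ex1[of "f u" "f v"] by (simp add: part_def)
  qed
  have g: "g e \<in> edges \<Gamma> \<and> ends \<Gamma> (g e) = f ` ends \<Gamma> e" if "e \<in> edges (block j)" for e
    unfolding g_def by (rule theI'[OF ex1[OF that]])
  have sub: "f ` ends \<Gamma> e \<subseteq> verts (block k)" if "e \<in> edges (block j)" for e
    using that bij by (auto simp: bij_betw_def)
  have edge_inj: "e = e'" if ee: "e \<in> edges \<Gamma>" "e' \<in> edges \<Gamma>" "ends \<Gamma> e = ends \<Gamma> e'" for e e'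
  proof -
    obtain u v where uv: "ends \<Gamma> e = {u, v}" "u \<in> verts \<Gamma>" "v \<in> verts \<Gamma>" "\<kappa> u = \<kappa> v" "col u" "\<not> col v"
      using edge[OF ee(1)] by blast
    then show ?thesis using edge_ex1[of u v] ee by metis
  qed
  have "bij_betw g (edges (block j)) (edges (block k))"
    unfolding bij_betw_def
  proof
    show "inj_on g (edges (block j))"
    proof (rule inj_onI)
      fix e e' assume e: "e \<in> edges (block j)" "e' \<in> edges (block j)" "g e = g e'"
      then have "f ` ends \<Gamma> e = f ` ends \<Gamma> e'" using g by metis
      then have "ends \<Gamma> e = ends \<Gamma> e'"
        using bij e by (subst (asm) inj_on_image_eq_iff[of f "verts (block j)"]) (auto simp: bij_betw_def)
      then show "e = e'" using edge_inj e by simp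
    qed
    show "g ` edges (block j) = edges (block k)"
    proof
      show "g ` edges (block j) \<subseteq> edges (block k)"
        using g sub by force
      show "edges (block k) \<subseteq> g ` edges (block j)"
      proof
        fix e' assume e': "e' \<in> edges (block k)"
        obtain u v where uv: "ends \<Gamma> e' = {u, v}" "col u" "\<not> col v" "u \<in> verts (block k)" "v \<in> verts (block k)"
          using e' edge[of e'] by force
        have "f ` verts (block j) = verts (block k)" using bij by (simp add: bij_betw_def)
        then obtain a b where ab: "u = f a" "v = f b" "a \<in> verts (block j)" "b \<in> verts (block j)"
          using uv(4,5) by (metis imageE)
        then have "col a = col u" "col b = col v" using fpart[of a] fpart[of b] by (auto simp: part_def)
        then obtain e where e: "e \<in> edges (block j)" "ends \<Gamma> e = {a, b}"
          using adjacent_block[OF ab(3,4)] uv by auto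
        have "g e = e'" using g[OF e(1)] e' uv ab e(2) by (intro edge_inj) auto
        then show "e' \<in> g ` edges (block j)" using e(1) by blast
      qed
    qed
  qed
  then show ?thesis unfolding graph_isomorphic_def using bij g by (auto intro!: exI[of _ f] exI[of _ g])
qed

end


section \<open>Consequences of girth and diameter\<close>

lemma walk_component:
  assumes C: "C = \<lparr>verts = V, edges = {e \<in> edges \<Gamma>. ends \<Gamma> e \<subseteq> V}, ends = ends \<Gamma>\<rparr>"
    and V: "V = {v. \<exists>es. walk \<Gamma> u es v}"
  shows "walk \<Gamma> x es y \<Longrightarrow> x \<in> V \<Longrightarrow> walk C x es y"
proof (induction es arbitrary: x)
  case Nil
  then show ?case by (simp add: C)
next
  case (Cons e es)
  then obtain z where z: "e \<in> edges \<Gamma>" "ends \<Gamma> e = {x, z}" "walk \<Gamma> z es y" "x \<in> verts \<Gamma>" by auto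
  obtain fs where "walk \<Gamma> u fs x" using Cons.prems V by auto
  then have "walk \<Gamma> u (fs @ [e]) z"
    using z walk_verts[OF z(3)] by (intro walk_append) auto
  then have zV: "z \<in> V" using V by blast
  then show ?case using Cons.IH[OF z(3)] z Cons.prems by (auto simp: C)
qed

lemma bipartite_walk_parity:
  assumes "bipartite C" "walk C u es v" "walk C u fs v"
  shows "even (length es) \<longleftrightarrow> even (length fs)"
proof -
  obtain A B where AB: "A \<union> B = verts C" "A \<inter> B = {}" "\<forall>e\<in>edges C. \<exists>a\<in>A. \<exists>b\<in>B. ends C e = {a, b}"
    using assms(1) by (auto simp: bipartite_def)
  have step: "(x \<in> A) \<noteq> (z \<in> A)" if e: "e \<in> edges C" "ends C e = {x, z}" for e x z
  proof -
    obtain a b where "a \<in> A" "b \<in> B" "{x, z} = {a, b}" using AB(3) e by metis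
    then show ?thesis using AB(2) by (auto simp: doubleton_eq_iff)
  qed
  have "(u \<in> A) = (v \<in> A) \<longleftrightarrow> even (length es)" if "walk C u es v" for u es v
    using that
  proof (induction es arbitrary: u)
    case (Cons e es)
    then obtain z where z: "e \<in> edges C" "ends C e = {u, z}" "walk C z es v" by auto
    show ?case using step[OF z(1,2)] Cons.IH[OF z(3)] by auto
  qed simp
  from this[OF assms(2)] this[OF assms(3)] show ?thesis by auto
qed

text \<open>In a bipartite component the ends of a walk of length 3 have odd distance, and diameter
  2 leaves only distance 1.\<close>

lemma walk3_adjacent:
  assumes comp: "\<And>C. C \<in> components \<Gamma> \<Longrightarrow> bipartite C \<and> graph_diameter C = enat 2"
    and w: "walk \<Gamma> u [e1, e2, e3] v"
  shows "\<exists>e\<in>edges \<Gamma>. ends \<Gamma> e = {u, v}"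
proof -
  define V where "V = {v. \<exists>es. walk \<Gamma> u es v}"
  define C where "C = \<lparr>verts = V, edges = {e \<in> edges \<Gamma>. ends \<Gamma> e \<subseteq> V}, ends = ends \<Gamma>\<rparr>"
  have u: "u \<in> verts \<Gamma>" using walk_verts[OF w] by simp
  then have "C \<in> components \<Gamma>" by (auto simp: components_def C_def V_def Let_def)
  then have C: "bipartite C" "graph_diameter C = enat 2" using comp by auto
  have "walk \<Gamma> u [] u" using u by simp
  then have uV: "u \<in> V" unfolding V_def by blast
  have wC: "walk C u [e1, e2, e3] v" by (rule walk_component[OF C_def V_def w uV])
  then have vV: "v \<in> V" using walk_verts by (fastforce simp: C_def)
  have "graph_dist C u v \<le> graph_diameter C"
    unfolding graph_diameter_def using uV vV
    by (intro SUP_upper2[of u] SUP_upper2[of v]) (auto simp: C_def)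
  also have "\<dots> < enat 3" using C by simp
  finally obtain es where es: "walk C u es v" "length es < 3"
    by (auto simp: graph_dist_def INF_less_iff)
  moreover have "odd (length es)" using bipartite_walk_parity[OF C(1) es(1) wC] by simp
  ultimately have "length es = 1" by presburger
  then obtain e where "es = [e]" by (auto simp: length_Suc_conv)
  then show ?thesis using es by (auto simp: C_def)
qed

lemma girth_no_parallel:
  assumes girth: "\<And>C. C \<in> components \<Gamma> \<Longrightarrow> girth C = enat 4"
    and e: "e \<in> edges \<Gamma>" "f \<in> edges \<Gamma>" "ends \<Gamma> e = {u, v}" "ends \<Gamma> f = {u, v}" "u \<in> verts \<Gamma>" "v \<in> verts \<Gamma>"
  shows "e = f"
proof (rule ccontr)
  assume "e \<noteq> f"
  define V where "V = {v. \<exists>es. walk \<Gamma> u es v}"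
  define C where "C = \<lparr>verts = V, edges = {e \<in> edges \<Gamma>. ends \<Gamma> e \<subseteq> V}, ends = ends \<Gamma>\<rparr>"
  have "C \<in> components \<Gamma>" using e by (auto simp: components_def C_def V_def Let_def)
  then have C: "girth C = enat 4" using girth by auto
  have "walk \<Gamma> u [] u" using e by simp
  then have uV: "u \<in> V" unfolding V_def by blast
  have "walk \<Gamma> u [e, f] u" using e by (auto simp: insert_commute)
  then have "walk C u [e, f] u" using walk_component[OF C_def V_def] uV by blast
  then have "girth C \<le> enat 2"
    unfolding girth_def using \<open>e \<noteq> f\<close> by (intro INF_lower2[of "[e, f]"]) auto
  then show False using C by simp
qed

section \<open>Star graphs as circulant graphs, and the congruences forced on them\<close>

section \<open>Four-valent circulant star graphs\<close>

text \<open>Integer subscripts modulo \<open>n\<close> let differences such as \<open>- r\<close> be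
  handled without case distinctions.\<close>

definition vert :: "nat \<Rightarrow> bool \<Rightarrow> int \<Rightarrow> nat letter" where
  "vert n s x = (if s then Pos else Neg) (nat (x mod int n))"

lemma inv_vert [simp]: "inv_letter (vert n s x) = vert n (\<not> s) x"
  by (simp add: vert_def)

lemma vert_eq_iff: "n > 0 \<Longrightarrow> vert n s x = vert n s' y \<longleftrightarrow> s = s' \<and> int n dvd x - y"
  by (auto simp: vert_def mod_eq_dvd_iff[symmetric] nat_eq_iff2)

lemma mod_eq_div_diff: "X mod m = Y mod m \<Longrightarrow> Y = X + (Y div m - X div m) * m" for X Y m :: int
  using div_mult_mod_eq[of X m] div_mult_mod_eq[of Y m] unfolding left_diff_distrib by linarith

lemma dvd4_cases:
  fixes j :: int
  assumes "even j \<longleftrightarrow> b"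
  shows "4 dvd j - (if b then 0 else 1) \<or> 4 dvd j - ((if b then 0 else 1) + 2)"
proof (cases b)
  case True
  then have "4 dvd j - 0 \<or> 4 dvd j - (0 + 2)" using assms by presburger
  then show ?thesis using True by simp
next
  case False
  then have "4 dvd j - 1 \<or> 4 dvd j - (1 + 2)" using assms by presburger
  then show ?thesis using False by simp
qed

lemma walk3I:
  assumes "ends G E1 = {a, b}" "ends G E2 = {b, c}" "ends G E3 = {c, d}"
    "{E1, E2, E3} \<subseteq> edges G" "{a, b, c, d} \<subseteq> verts G"
  shows "walk G a [E1, E2, E3] d"
  using assms by auto

text \<open>Each \<open>\<epsilon> k\<close> is a family of edges obtained by translating
  subscripts. Injectivity modulo \<open>n\<close> is not assumed, since two indices might name the
  same edge.\<close>

locale circulant_star =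
  fixes n :: nat and p d e f :: int and \<Gamma> :: "(nat letter, 'e) multigraph" and \<epsilon> :: "nat \<Rightarrow> int \<Rightarrow> 'e"
  assumes n: "n > 0"
    and verts: "verts \<Gamma> = Pos ` {..<n} \<union> Neg ` {..<n}"
    and edges: "edges \<Gamma> = {\<epsilon> k x | k x. k < 4}"
    and ends: "ends \<Gamma> (\<epsilon> 0 x) = {vert n True x, vert n True (x + p)}"
      "ends \<Gamma> (\<epsilon> 1 x) = {vert n False x, vert n False (x + d)}"
      "ends \<Gamma> (\<epsilon> 2 x) = {vert n True x, vert n False (x + e)}"
      "ends \<Gamma> (\<epsilon> 3 x) = {vert n True x, vert n False (x + f)}"
    and periodic: "int n dvd x - y \<Longrightarrow> \<epsilon> k x = \<epsilon> k y"
begin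

lemmas ends_all = ends ends(2)[unfolded One_nat_def]

lemma verts_eq: "verts \<Gamma> = {vert n s x | s x. True}"
proof
  show "verts \<Gamma> \<subseteq> {vert n s x | s x. True}"
  proof
    fix v assume "v \<in> verts \<Gamma>"
    then have "gen v < n" by (auto simp: verts)
    then have "v = vert n (v = Pos (gen v)) (int (gen v))"
      by (cases v) (auto simp: vert_def nat_mod_as_int[symmetric] simp flip: zmod_int)
    then show "v \<in> {vert n s x | s x. True}" by blast
  qed
  show "{vert n s x | s x. True} \<subseteq> verts \<Gamma>"
    using n by (auto simp: verts vert_def nat_less_iff)
qed

lemma vert_in [simp]: "vert n s x \<in> verts \<Gamma>"
  by (auto simp: verts_eq)

lemma edge_cases:
  assumes "E \<in> edges \<Gamma>"
  obtains x where "E = \<epsilon> 0 x" | x where "E = \<epsilon> 1 x" | x where "E = \<epsilon> 2 x" | x where "E = \<epsilon> 3 x"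
proof -
  obtain k x where "E = \<epsilon> k x" "k < 4" using assms by (auto simp: edges)
  moreover from this have "k = 0 \<or> k = 1 \<or> k = 2 \<or> k = 3" by auto
  ultimately show thesis using that by blast
qed

lemma edge_in [simp]: "\<epsilon> 0 x \<in> edges \<Gamma>" "\<epsilon> 1 x \<in> edges \<Gamma>" "\<epsilon> (Suc 0) x \<in> edges \<Gamma>" "\<epsilon> 2 x \<in> edges \<Gamma>" "\<epsilon> 3 x \<in> edges \<Gamma>"
  unfolding edges by force+

lemma finite_edges: "finite (edges \<Gamma>)"
proof (rule finite_subset)
  show "edges \<Gamma> \<subseteq> (\<lambda>(k, x). \<epsilon> k x) ` ({..<4} \<times> {0..<int n})"
  proof
    fix E assume "E \<in> edges \<Gamma>"
    then obtain k x where "E = \<epsilon> k x" "k < 4" by (auto simp: edges)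
    moreover have "\<epsilon> k x = \<epsilon> k (x mod int n)" by (rule periodic) (simp add: minus_mod_eq_mult_div)
    ultimately show "E \<in> (\<lambda>(k, x). \<epsilon> k x) ` ({..<4} \<times> {0..<int n})"
      using n by (auto intro!: image_eqI[of _ _ "(k, x mod int n)"])
  qed
qed simp

lemma adjacent_True:
  assumes "E \<in> edges \<Gamma>" "ends \<Gamma> E = {vert n True x, vert n True y}"
  shows "int n dvd y - x - p \<or> int n dvd x - y - p"
  using assms(1)
proof (cases rule: edge_cases)
  case (1 z)
  then have "(int n dvd x - z \<and> int n dvd y - (z + p)) \<or> (int n dvd y - z \<and> int n dvd x - (z + p))"
    using assms(2) by (auto simp: ends_all doubleton_eq_iff vert_eq_iff[OF n] dvd_diff_commute)
  then show ?thesis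
    by (elim disjE conjE) (use dvd_diff[of "int n" "y - (z + p)" "x - z"] dvd_diff[of "int n" "x - (z + p)" "y - z"] in \<open>simp_all add: algebra_simps\<close>)
qed (use assms(2) in \<open>auto simp: ends_all doubleton_eq_iff vert_eq_iff[OF n]\<close>)

lemma adjacent_False:
  assumes "E \<in> edges \<Gamma>" "ends \<Gamma> E = {vert n False x, vert n False y}"
  shows "int n dvd y - x - d \<or> int n dvd x - y - d"
  using assms(1)
proof (cases rule: edge_cases)
  case (2 z)
  then have "(int n dvd x - z \<and> int n dvd y - (z + d)) \<or> (int n dvd y - z \<and> int n dvd x - (z + d))"
    using assms(2) by (auto simp: ends_all doubleton_eq_iff vert_eq_iff[OF n] dvd_diff_commute)
  then show ?thesis
    by (elim disjE conjE) (use dvd_diff[of "int n" "y - (z + d)" "x - z"] dvd_diff[of "int n" "x - (z + d)" "y - z"] in \<open>simp_all add: algebra_simps\<close>)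
qed (use assms(2) in \<open>auto simp: ends_all doubleton_eq_iff vert_eq_iff[OF n]\<close>)

lemma adjacent_mixed:
  assumes "E \<in> edges \<Gamma>" "ends \<Gamma> E = {vert n True x, vert n False y}"
  shows "int n dvd y - x - e \<or> int n dvd y - x - f"
  using assms(1)
proof (cases rule: edge_cases)
  case (3 z)
  then have "int n dvd x - z \<and> int n dvd y - (z + e)"
    using assms(2) by (auto simp: ends_all doubleton_eq_iff vert_eq_iff[OF n] dvd_diff_commute)
  then show ?thesis
    using dvd_diff[of "int n" "y - (z + e)" "x - z"] by (simp add: algebra_simps)
next
  case (4 z)
  then have "int n dvd x - z \<and> int n dvd y - (z + f)"
    using assms(2) by (auto simp: ends_all doubleton_eq_iff vert_eq_iff[OF n] dvd_diff_commute)
  then show ?thesis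
    using dvd_diff[of "int n" "y - (z + f)" "x - z"] by (simp add: algebra_simps)
qed (use assms(2) in \<open>auto simp: ends_all doubleton_eq_iff vert_eq_iff[OF n]\<close>)

text \<open>If \<open>2 * p\<close> vanishes modulo \<open>n\<close>, the edges
  \<open>\<epsilon> 0 0\<close> and \<open>\<epsilon> 0 p\<close> share their ends;
  \<open>simple\<close> declares them different, hence parallel, and girth 4 excludes the case. The
  same holds for \<open>d\<close>.\<close>

lemma necessary:
  assumes comp: "\<And>C. C \<in> components \<Gamma> \<Longrightarrow> bipartite C \<and> graph_diameter C = enat 2"
    and girth: "\<And>C. C \<in> components \<Gamma> \<Longrightarrow> girth C = enat 4"
    and simple: "int n dvd 2 * p \<Longrightarrow> \<epsilon> 0 0 \<noteq> \<epsilon> 0 p" "int n dvd 2 * d \<Longrightarrow> \<epsilon> 1 0 \<noteq> \<epsilon> 1 d"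
  obtains N :: nat where "n = 4 * N"
    "[p = int N] (mod int n) \<or> [p = - int N] (mod int n)"
    "[d = int N] (mod int n) \<or> [d = - int N] (mod int n)"
    "[e - f = 2 * int N] (mod int n)"
proof -
  have p2: "\<not> int n dvd 2 * p"
  proof
    assume a: "int n dvd 2 * p"
    then have "vert n True (p + p) = vert n True 0" by (simp add: vert_eq_iff[OF n])
    then have "\<epsilon> 0 0 = \<epsilon> 0 p"
      by (intro girth_no_parallel[OF girth, where e = "\<epsilon> 0 0" and f = "\<epsilon> 0 p" and u = "vert n True 0" and v = "vert n True p"]) (auto simp: ends_all)
    then show False using simple(1) a by simp
  qed
  have d2: "\<not> int n dvd 2 * d"
  proof
    assume a: "int n dvd 2 * d"
    then have "vert n False (d + d) = vert n False 0" by (simp add: vert_eq_iff[OF n])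
    then have "\<epsilon> 1 0 = \<epsilon> 1 d"
      using ends(2)[of 0] ends(2)[of d]
      by (intro girth_no_parallel[OF girth, where e = "\<epsilon> 1 0" and f = "\<epsilon> 1 d" and u = "vert n False 0" and v = "vert n False d"]) auto
    then show False using simple(2) a by simp
  qed
  have p4: "int n dvd 4 * p"
  proof -
    \<comment> \<open>Three steps of length \<open>p\<close> lead to \<open>3 p\<close>, so
      \<open>3 p\<close> is congruent to \<open>p\<close> or to \<open>- p\<close>;
      \<open>p2\<close> excludes the former.\<close>
    have "walk \<Gamma> (vert n True 0) [\<epsilon> 0 0, \<epsilon> 0 p, \<epsilon> 0 (p + p)] (vert n True (p + p + p))"
      by (rule walk3I[OF ends(1)[of 0, simplified] ends(1) ends(1)]) auto
    then obtain E where "E \<in> edges \<Gamma>" "ends \<Gamma> E = {vert n True 0, vert n True (p + p + p)}"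
      using walk3_adjacent[OF comp] by blast
    then show ?thesis using adjacent_True p2 dvd_minus_iff[of "int n" "4 * p"] by fastforce
  qed
  have d4: "int n dvd 4 * d"
  proof -
    have "walk \<Gamma> (vert n False 0) [\<epsilon> 1 0, \<epsilon> 1 d, \<epsilon> 1 (d + d)] (vert n False (d + d + d))"
      by (rule walk3I[OF _ ends(2) ends(2)]) (use ends(2)[of 0] in auto)
    then obtain E where "E \<in> edges \<Gamma>" "ends \<Gamma> E = {vert n False 0, vert n False (d + d + d)}"
      using walk3_adjacent[OF comp] by blast
    then show ?thesis using adjacent_False d2 dvd_minus_iff[of "int n" "4 * d"] by fastforce
  qed
  have ef: "int n dvd e - f - 2 * d"
  proof -
    \<comment> \<open>The vertex \<open>f + 2 d\<close> is adjacent to the positive vertex 0, so it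
      is congruent to \<open>e\<close> or \<open>f\<close>; the latter contradicts
      \<open>d2\<close>.\<close>
    have "walk \<Gamma> (vert n True 0) [\<epsilon> 3 0, \<epsilon> 1 f, \<epsilon> 1 (f + d)] (vert n False (f + d + d))"
      by (rule walk3I[OF _ ends(2) ends(2)]) (use ends(4)[of 0] in auto)
    then obtain E where "E \<in> edges \<Gamma>" "ends \<Gamma> E = {vert n True 0, vert n False (f + d + d)}"
      using walk3_adjacent[OF comp] by blast
    then have "int n dvd f + d + d - 0 - e \<or> int n dvd f + d + d - 0 - f" using adjacent_mixed by blast
    moreover have "f + d + d - 0 - f = 2 * d" by simp
    ultimately have "int n dvd f + d + d - 0 - e" using d2 by metis
    then have "int n dvd - (f + d + d - 0 - e)" by (rule dvd_minus_iff[THEN iffD2])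
    then show ?thesis by (simp add: algebra_simps)
  qed
  \<comment> \<open>In \<open>4 * x = n * k\<close> an even \<open>k\<close> would give
    \<open>n dvd 2 * x\<close>; an odd \<open>k\<close> forces 4 to divide \<open>n\<close>.\<close>
  have quarter: "\<exists>k. odd k \<and> 4 dvd int n \<and> x = (int n div 4) * k" if x: "int n dvd 4 * x" "\<not> int n dvd 2 * x" for x
  proof -
    obtain k where k: "4 * x = int n * k" using x(1) by (auto elim: dvdE)
    have "odd k"
    proof
      assume "even k"
      then obtain l where "k = 2 * l" by (auto elim: evenE)
      then have "2 * x = int n * l" using k by simp
      then show False using x(2) by simp
    qed
    moreover have "4 dvd int n"
    proof -
      have "coprime 4 k" using \<open>odd k\<close> coprime_power_left_iff[of 2 2 k] by simp
      moreover have "4 dvd int n * k" using k by (metis dvd_triv_left)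
      ultimately show ?thesis by (simp add: coprime_dvd_mult_left_iff)
    qed
    moreover from this have "x = (int n div 4) * k" using k by auto
    ultimately show ?thesis by blast
  qed
  obtain k where k: "odd k" "4 dvd int n" "p = (int n div 4) * k" using quarter[OF p4 p2] by blast
  obtain l where l: "odd l" "d = (int n div 4) * l" using quarter[OF d4 d2] by blast
  obtain N where N: "n = 4 * N" using k(2) by (auto simp: int_dvd_int_iff[of 4, simplified] elim: dvdE)
  have pk: "p = int N * k" "d = int N * l" using k l N by auto
  have pm: "[int N * k = int N] (mod int n) \<or> [int N * k = - int N] (mod int n)" if "odd k" for k
  proof -
    have "4 dvd k - 1 \<or> 4 dvd k + 1" using that by presburger
    then have "int n dvd int N * (k - 1) \<or> int n dvd int N * (k + 1)"
      unfolding N by (auto simp: mult.commute)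
    then show ?thesis by (simp add: cong_iff_dvd_diff algebra_simps)
  qed
  \<comment> \<open>For odd \<open>l\<close> the numbers \<open>2 * N * l\<close> and
    \<open>2 * N\<close> agree modulo \<open>4 * N\<close>, so the sign of \<open>d\<close> is lost
    here.\<close>
  have "int n dvd 2 * d - 2 * int N"
  proof -
    have "4 dvd 2 * (l - 1)" using l(1) by presburger
    then have "int N * 4 dvd int N * (2 * (l - 1))" by (rule mult_dvd_mono[OF dvd_refl])
    then show ?thesis by (simp add: N pk algebra_simps)
  qed
  from dvd_add[OF ef this] have "int n dvd e - f - 2 * int N"
    by (rule back_subst) simp
  then have "[e - f = 2 * int N] (mod int n)" by (simp only: cong_iff_dvd_diff)
  then show thesis using that N pm[OF k(1)] pm[OF l(1)] pk by blast
qed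

end

section \<open>Sufficiency: coordinates that split the circulant graph into blocks\<close>

locale circulant_blocks = circulant_star +
  fixes N :: nat
  assumes n4: "n = 4 * N"
    and pN: "[p = int N] (mod int n) \<or> [p = - int N] (mod int n)"
    and dN: "[d = int N] (mod int n) \<or> [d = - int N] (mod int n)"
    and efN: "[e - f = 2 * int N] (mod int n)"
begin

lemma N: "N > 0"
  using n n4 by simp

text \<open>Negative vertices are shifted by \<open>e\<close> so that edges of kind 2 keep the
  coordinate modulo \<open>n\<close>.\<close>

definition coord :: "nat letter \<Rightarrow> int" where
  "coord v = int (gen v) - (if v = Pos (gen v) then 0 else e)"

definition \<kappa> :: "nat letter \<Rightarrow> nat" where
  "\<kappa> v = nat (coord v mod int N)"

text \<open>Modulo \<open>n\<close>, edges of kinds 0 and 1 change the coordinate by an odd multiple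
  of \<open>N\<close> and keep the sign; edges of kinds 2 and 3 change it by an even multiple and
  flip the sign. The colour changes in every case.\<close>

definition col :: "nat letter \<Rightarrow> bool" where
  "col v \<longleftrightarrow> (even (coord v div int N) \<longleftrightarrow> v = Pos (gen v))"

definition off :: "bool \<Rightarrow> int" where
  "off s = (if s then 0 else e)"

text \<open>As \<open>n = 4 * N\<close>, passing to another representative modulo \<open>n\<close>
  changes the quotient by \<open>N\<close> by a multiple of 4, so its parity is well
  defined.\<close>

lemma shift_N:
  assumes "int n dvd a - (y + c * int N)"
  shows "a mod int N = y mod int N" "even (a div int N) \<longleftrightarrow> even (y div int N + c)"
proof -
  obtain t where "a - (y + c * int N) = int n * t" using assms by (auto elim: dvdE)
  then have a: "a = y + (c + 4 * t) * int N" using n4 by (simp add: algebra_simps)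
  show "a mod int N = y mod int N" unfolding a by simp
  show "even (a div int N) \<longleftrightarrow> even (y div int N + c)" unfolding a using N by (simp, blast)
qed

lemma is_Pos_vert: "vert n s x = Pos (gen (vert n s x)) \<longleftrightarrow> s"
  by (simp add: vert_def)

lemma vert_coord:
  "\<kappa> (vert n s x) = nat ((x - off s) mod int N)"
  "col (vert n s x) \<longleftrightarrow> (even ((x - off s) div int N) \<longleftrightarrow> s)"
proof -
  have "coord (vert n s x) = x mod int n - off s"
    using n by (simp add: coord_def is_Pos_vert off_def) (simp add: vert_def)
  moreover have "int n dvd (x mod int n - off s) - ((x - off s) + 0 * int N)"
    by (simp add: mod_eq_dvd_iff[symmetric])
  note shift_N[OF this]
  ultimately show "\<kappa> (vert n s x) = nat ((x - off s) mod int N)"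
    "col (vert n s x) \<longleftrightarrow> (even ((x - off s) div int N) \<longleftrightarrow> s)"
    by (simp_all add: \<kappa>_def col_def is_Pos_vert)
qed

lemma \<kappa>_eq_iff: "\<kappa> (vert n s x) = \<kappa> (vert n s' y) \<longleftrightarrow> (x - off s) mod int N = (y - off s') mod int N"
  using N by (simp add: vert_coord eq_nat_nat_iff)

lemma edge_flip:
  assumes "int n dvd (y - off s') - (x - off s + c * int N)" "even c \<longleftrightarrow> s \<noteq> s'"
  shows "\<kappa> (vert n s x) = \<kappa> (vert n s' y)" "col (vert n s x) \<noteq> col (vert n s' y)"
  using shift_N[OF assms(1)] assms(2) unfolding \<kappa>_eq_iff vert_coord(2) by auto

lemma congD: "[a = b] (mod int n) \<Longrightarrow> int n dvd a - b"
  by (simp add: cong_iff_dvd_diff)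

lemma step_pd:
  obtains c c' where "odd c" "odd c'" "int n dvd p - c * int N" "int n dvd d - c' * int N"
    "c = 1 \<or> c = - 1" "c' = 1 \<or> c' = - 1"
proof -
  have "\<exists>c. odd c \<and> int n dvd x - c * int N \<and> (c = 1 \<or> c = - 1)"
    if "[x = int N] (mod int n) \<or> [x = - int N] (mod int n)" for x
    using that congD[of x "int N"] congD[of x "- int N"]
    by (elim disjE) (rule exI[of _ 1], simp, rule exI[of _ "- 1"], simp)
  from this[OF pN] this[OF dN] show thesis using that by blast
qed

lemma edge_blocks:
  assumes "E \<in> edges \<Gamma>"
  shows "\<exists>u v. ends \<Gamma> E = {u, v} \<and> u \<in> verts \<Gamma> \<and> v \<in> verts \<Gamma> \<and> \<kappa> u = \<kappa> v \<and> col u \<noteq> col v"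
  using assms
proof (cases rule: edge_cases)
  case (1 x)
  obtain c where c: "odd c" "int n dvd p - c * int N" using step_pd by blast
  have "int n dvd (x + p - off True) - (x - off True + c * int N)" using c(2) by simp
  from edge_flip[OF this] c(1) show ?thesis using 1 ends(1)[of x] vert_in by blast
next
  case (2 x)
  obtain c where c: "odd c" "int n dvd d - c * int N" using step_pd by blast
  have "int n dvd (x + d - off False) - (x - off False + c * int N)" using c(2) by simp
  from edge_flip[OF this] c(1) show ?thesis using 2 ends(2)[of x] vert_in by blast
next
  case (3 x)
  have "int n dvd (x + e - off False) - (x - off True + 0 * int N)" by (simp add: off_def)
  from edge_flip[OF this] show ?thesis using 3 ends(3)[of x] vert_in by fastforce
next
  case (4 x)
  have "int n dvd - (e - f - 2 * int N)" using congD[OF efN] by (rule dvd_minus_iff[THEN iffD2])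
  then have "int n dvd (x + f - off False) - (x - off True + (- 2) * int N)" by (simp add: off_def algebra_simps)
  from edge_flip[OF this] show ?thesis using 4 ends(4)[of x] vert_in by fastforce
qed

lemma not_dvd_2N: "\<not> int n dvd 2 * int N" "\<not> int n dvd - 2 * int N"
  using N n4 zdvd_imp_le[of "int n" "2 * int N"] by auto

lemma not_dvd_2p: "\<not> int n dvd 2 * p" "\<not> int n dvd 2 * d"
proof -
  have "\<not> int n dvd 2 * x" if x: "int n dvd x - c * int N" "c = 1 \<or> c = - 1" for x c
  proof
    assume a: "int n dvd 2 * x"
    have "int n dvd 2 * (x - c * int N)" using x(1) by (rule dvd_mult)
    from dvd_diff[OF a this] have "int n dvd 2 * c * int N" by (simp add: algebra_simps)
    then show False using x(2) not_dvd_2N by auto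
  qed
  then show "\<not> int n dvd 2 * p" "\<not> int n dvd 2 * d" using step_pd by metis+
qed

text \<open>Two edges of kind 0 or 1 could have the same ends in reverse order only if
  \<open>2 * p\<close> or \<open>2 * d\<close> vanished, and edges of kinds 2 and 3 could coincide
  in their ends only if \<open>e\<close> and \<open>f\<close> did, all modulo
  \<open>n\<close>.\<close>

lemma edge_unique:
  assumes "E \<in> edges \<Gamma>" "E' \<in> edges \<Gamma>" "ends \<Gamma> E = ends \<Gamma> E'"
  shows "E = E'"
proof -
  have ef: "\<not> int n dvd e - f" "\<not> int n dvd f - e"
  proof -
    show *: "\<not> int n dvd e - f"
    proof
      assume "int n dvd e - f"
      from dvd_diff[OF this congD[OF efN]] show False using not_dvd_2N by simp
    qed
    then show "\<not> int n dvd f - e" by (simp add: dvd_diff_commute)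
  qed
  have two: "int n dvd x - y" if "(int n dvd x - y \<and> Q) \<or> (int n dvd x - (y + c) \<and> int n dvd x + c - y)"
    "\<not> int n dvd 2 * c" for x y c Q
    using that dvd_diff[of "int n" "x + c - y" "x - (y + c)"] by auto
  have mixed: "\<not> (int n dvd x - y \<and> int n dvd x + a - (y + b))" if "\<not> int n dvd a - b" for x y a b
    using that dvd_diff[of "int n" "x + a - (y + b)" "x - y"] by auto
  show ?thesis using assms(1)
  proof (cases rule: edge_cases)
    case (1 x)
    show ?thesis using assms(2)
    proof (cases rule: edge_cases)
      case y: (1 y)
      have "int n dvd x - y" using assms(3) 1 y ends_all not_dvd_2p(1)
        by (intro two[of x y _ p]) (auto simp: doubleton_eq_iff vert_eq_iff[OF n])
      then show ?thesis using periodic 1 y by simp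
    qed (use assms(3) 1 ends_all in \<open>auto simp: doubleton_eq_iff vert_eq_iff[OF n]\<close>)
  next
    case (2 x)
    show ?thesis using assms(2)
    proof (cases rule: edge_cases)
      case y: (2 y)
      have "int n dvd x - y" using assms(3) 2 y ends_all not_dvd_2p(2)
        by (intro two[of x y _ d]) (auto simp: doubleton_eq_iff vert_eq_iff[OF n])
      then show ?thesis using periodic 2 y by simp
    qed (use assms(3) 2 ends_all in \<open>auto simp: doubleton_eq_iff vert_eq_iff[OF n]\<close>)
  next
    case (3 x)
    show ?thesis using assms(2)
    proof (cases rule: edge_cases)
      case y: (3 y)
      have "int n dvd x - y" using assms(3) 3 y ends_all by (auto simp: doubleton_eq_iff vert_eq_iff[OF n])
      then show ?thesis using periodic 3 y by simp
    next
      case y: (4 y)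
      have "int n dvd x - y \<and> int n dvd x + e - (y + f)"
        using assms(3) 3 y ends_all by (auto simp: doubleton_eq_iff vert_eq_iff[OF n])
      then show ?thesis using mixed ef by blast
    qed (use assms(3) 3 ends_all in \<open>auto simp: doubleton_eq_iff vert_eq_iff[OF n]\<close>)
  next
    case (4 x)
    show ?thesis using assms(2)
    proof (cases rule: edge_cases)
      case y: (4 y)
      have "int n dvd x - y" using assms(3) 4 y ends_all by (auto simp: doubleton_eq_iff vert_eq_iff[OF n])
      then show ?thesis using periodic 4 y by simp
    next
      case y: (3 y)
      have "int n dvd x - y \<and> int n dvd x + f - (y + e)"
        using assms(3) 4 y ends_all by (auto simp: doubleton_eq_iff vert_eq_iff[OF n])
      then show ?thesis using mixed ef by blast
    qed (use assms(3) 4 ends_all in \<open>auto simp: doubleton_eq_iff vert_eq_iff[OF n]\<close>)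
  qed
qed

text \<open>An odd \<open>c\<close> is 1 or -1 modulo 4; comparing it with the sign
  \<open>c'\<close> of the step decides at which of the two vertices the edge is based.\<close>

lemma same_sign_edge:
  assumes X: "int n dvd (y - x) - c * int N" "odd c"
    and k: "\<And>z. ends \<Gamma> (\<epsilon> k z) = {vert n s z, vert n s (z + a)}"
    and a: "int n dvd a - c' * int N" "c' = 1 \<or> c' = - 1"
  shows "\<exists>z. ends \<Gamma> (\<epsilon> k z) = {vert n s x, vert n s y}"
proof -
  have "4 dvd c - c' \<or> 4 dvd c + c'" using X(2) a(2) by presburger
  then have "int n dvd (c - c') * int N \<or> int n dvd (c + c') * int N"
    unfolding n4 by (auto intro: mult_dvd_mono)
  then show ?thesis
  proof
    assume b: "int n dvd (c - c') * int N"
    have "int n dvd (y - x - c * int N) + (c - c') * int N - (a - c' * int N)"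
      using dvd_diff[OF dvd_add[OF X(1) b] a(1)] .
    then have "vert n s (x + a) = vert n s y"
      by (subst vert_eq_iff[OF n]) (simp add: algebra_simps dvd_diff_commute[of _ y])
    then show ?thesis using k[of x] by auto
  next
    assume b: "int n dvd (c + c') * int N"
    have "int n dvd (y - x - c * int N) + (c + c') * int N + (a - c' * int N)"
      using dvd_add[OF dvd_add[OF X(1) b] a(1)] .
    then have "vert n s (y + a) = vert n s x"
      by (subst vert_eq_iff[OF n]) (simp add: algebra_simps)
    then show ?thesis using k[of y] by auto
  qed
qed

text \<open>An even \<open>c\<close> is 0 or 2 modulo 4, which selects kind 2 or kind 3.\<close>

lemma mixed_sign_edge:
  assumes X: "int n dvd (y - e) - (x + c * int N)" "even c"
  shows "\<exists>k\<in>{2, 3}. ends \<Gamma> (\<epsilon> k x) = {vert n True x, vert n False y}"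
proof -
  have "4 dvd c \<or> 4 dvd c + 2" using X(2) by presburger
  then have "int n dvd c * int N \<or> int n dvd (c + 2) * int N"
    unfolding n4 by (auto intro: mult_dvd_mono)
  then show ?thesis
  proof
    assume b: "int n dvd c * int N"
    have "vert n False y = vert n False (x + e)"
      using dvd_add[OF X(1) b] by (simp add: vert_eq_iff[OF n] algebra_simps)
    then show ?thesis using ends(3)[of x] by auto
  next
    assume b: "int n dvd (c + 2) * int N"
    have "vert n False y = vert n False (x + f)"
      using dvd_add[OF dvd_add[OF X(1) b] congD[OF efN]] by (simp add: vert_eq_iff[OF n] algebra_simps)
    then show ?thesis using ends(4)[of x] by auto
  qed
qed

lemma edge_exists:
  assumes "\<kappa> (vert n s x) = \<kappa> (vert n s' y)" "col (vert n s x) \<noteq> col (vert n s' y)"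
  shows "\<exists>E\<in>edges \<Gamma>. ends \<Gamma> E = {vert n s x, vert n s' y}"
proof -
  let ?X = "x - off s" and ?Y = "y - off s'"
  define c where "c = ?Y div int N - ?X div int N"
  have Y: "?Y = ?X + c * int N" using assms(1) unfolding \<kappa>_eq_iff c_def by (rule mod_eq_div_diff)
  have par: "even c \<longleftrightarrow> s \<noteq> s'" using assms(2) unfolding vert_coord(2) c_def by auto
  consider "s" "s'" | "\<not> s" "\<not> s'" | "s" "\<not> s'" | "\<not> s" "s'" by blast
  then show ?thesis
  proof cases
    case 1
    obtain c' where c': "int n dvd p - c' * int N" "c' = 1 \<or> c' = - 1" using step_pd by blast
    have "int n dvd (y - x) - c * int N" "odd c" using Y par 1 by (simp_all add: off_def)
    from same_sign_edge[OF this ends(1) c'] show ?thesis using 1 by auto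
  next
    case 2
    obtain c' where c': "int n dvd d - c' * int N" "c' = 1 \<or> c' = - 1" using step_pd by blast
    have "int n dvd (y - x) - c * int N" "odd c" using Y par 2 by (simp_all add: off_def)
    from same_sign_edge[OF this ends(2) c'] show ?thesis using 2 by auto
  next
    case 3
    have "int n dvd (y - e) - (x + c * int N)" "even c" using Y par 3 by (simp_all add: off_def)
    from mixed_sign_edge[OF this] show ?thesis using 3 by auto
  next
    case 4
    have "int n dvd (x - e) - (y + (- c) * int N)" "even (- c)" using Y par 4 by (simp_all add: off_def)
    from mixed_sign_edge[OF this] show ?thesis using 4 by (auto simp: insert_commute)
  qed
qed

text \<open>The quotient of the coordinate by \<open>N\<close> counts modulo 4; the colour fixes its
  parity for each sign, which leaves two vertices per sign.\<close>

lemma class_card: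
  assumes "u \<in> verts \<Gamma>"
  shows "card {v \<in> verts \<Gamma>. \<kappa> v = \<kappa> u \<and> col v = c} = 4"
proof -
  obtain s x where u: "u = vert n s x" using assms by (auto simp: verts_eq)
  define r where "r = (x - off s) mod int N"
  have r: "0 \<le> r" "r < int N" using N by (simp_all add: r_def)
  define w where "w t j = vert n t (r + j * int N + off t)" for t j
  \<comment> \<open>The least quotient of the parity that colour \<open>c\<close> demands at sign
    \<open>t\<close>.\<close>
  define j0 :: "bool \<Rightarrow> int" where "j0 t = (if c = t then 0 else 1)" for t
  have w: "\<kappa> (w t j) = \<kappa> u" "col (w t j) \<longleftrightarrow> (even j \<longleftrightarrow> t)" for t j
    using r N by (simp_all add: w_def u vert_coord r_def)
  have "{v \<in> verts \<Gamma>. \<kappa> v = \<kappa> u \<and> col v = c} = {w True (j0 True), w True (j0 True + 2), w False (j0 False), w False (j0 False + 2)}"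
    (is "?L = ?R")
  proof
    show "?R \<subseteq> ?L" using w by (auto simp: w_def j0_def)
    show "?L \<subseteq> ?R"
    proof
      fix v assume v: "v \<in> ?L"
      then obtain t y where ty: "v = vert n t y" by (auto simp: verts_eq)
      let ?j = "(y - off t) div int N"
      have "(y - off t) mod int N = r" using v by (simp add: ty u \<kappa>_eq_iff r_def)
      then have "r + ?j * int N + off t = y" using div_mult_mod_eq[of "y - off t" "int N"] by linarith
      then have vy: "v = w t ?j" by (simp add: ty w_def)
      have "even ?j \<longleftrightarrow> (c = t)" using v by (auto simp: ty vert_coord)
      then have "4 dvd ?j - j0 t \<or> 4 dvd ?j - (j0 t + 2)" 
        unfolding j0_def by (rule dvd4_cases)
      then have "int n dvd (?j - j0 t) * int N \<or> int n dvd (?j - (j0 t + 2)) * int N"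
        unfolding n4 by (auto intro: mult_dvd_mono)
      then have "w t ?j = w t (j0 t) \<or> w t ?j = w t (j0 t + 2)"
        by (simp add: w_def vert_eq_iff[OF n] algebra_simps)
      then show "v \<in> ?R" using vy by (cases t) auto
    qed
  qed
  moreover have "w t j \<noteq> w t (j + 2)" for t j
    using not_dvd_2N by (simp add: w_def vert_eq_iff[OF n] algebra_simps)
  moreover have "w True i \<noteq> w False j" for i j
    by (simp add: w_def vert_eq_iff[OF n])
  ultimately show ?thesis by (simp add: card_insert_if)
qed

sublocale bipartite_blocks \<Gamma> \<kappa> col
proof
  show "finite (verts \<Gamma>)" by (simp add: verts)
  show "\<exists>u\<in>verts \<Gamma>. \<exists>v\<in>verts \<Gamma>. ends \<Gamma> E = {u, v} \<and> \<kappa> u = \<kappa> v \<and> col u \<and> \<not> col v"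
    if E: "E \<in> edges \<Gamma>" for E
  proof -
    obtain u v where uv: "ends \<Gamma> E = {u, v}" "u \<in> verts \<Gamma>" "v \<in> verts \<Gamma>" "\<kappa> u = \<kappa> v" "col u \<noteq> col v"
      using edge_blocks[OF E] by blast
    then have "ends \<Gamma> E = {v, u}" by (simp add: insert_commute)
    then show ?thesis using uv by (cases "col u") metis+
  qed
  show "\<exists>!E. E \<in> edges \<Gamma> \<and> ends \<Gamma> E = {u, v}"
    if uv: "u \<in> verts \<Gamma>" "v \<in> verts \<Gamma>" "\<kappa> u = \<kappa> v" "col u" "\<not> col v" for u v
  proof -
    obtain s x s' y where xy: "u = vert n s x" "v = vert n s' y"
      using uv(1,2) unfolding verts_eq by blast
    have "\<exists>E\<in>edges \<Gamma>. ends \<Gamma> E = {u, v}"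
      unfolding xy by (rule edge_exists) (use uv(3-5) in \<open>simp_all add: xy\<close>)
    then show ?thesis using edge_unique by metis
  qed
qed (rule class_card)

lemma card_components_N: "card (components \<Gamma>) = N"
proof -
  have "\<kappa> ` verts \<Gamma> = {..<N}"
  proof
    show "\<kappa> ` verts \<Gamma> \<subseteq> {..<N}" using N by (auto simp: \<kappa>_def nat_less_iff)
    show "{..<N} \<subseteq> \<kappa> ` verts \<Gamma>"
    proof
      fix k assume "k \<in> {..<N}"
      then have "k = \<kappa> (vert n True (int k))" by (simp add: vert_coord off_def)
      then show "k \<in> \<kappa> ` verts \<Gamma>" by auto
    qed
  qed
  then show ?thesis using card_components by simp
qed

end

section \<open>The star graph of a cyclic presentation with relators of length four\<close>

text \<open>The identified pair with \<open>x = a\<close>, \<open>y = inv_letter b\<close> and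
  \<open>u = [c, d]\<close>.\<close>

definition edge4 :: "'a letter \<Rightarrow> 'a letter \<Rightarrow> 'a letter \<Rightarrow> 'a letter \<Rightarrow> 'a word set" where
  "edge4 a b c d = {[a, b, c, d], [inv_letter b, inv_letter a, inv_letter d, inv_letter c]}"

lemma rotate_4: "(\<exists>i. z = rotate i [a, b, c, d]) \<longleftrightarrow> z \<in> {[a, b, c, d], [b, c, d, a], [c, d, a, b], [d, a, b, c]}"
proof -
  have r: "rotate 2 [a, b, c, d] = [c, d, a, b]" "rotate 3 [a, b, c, d] = [d, a, b, c]"
    by (simp_all add: numeral_eq_Suc)
  have "rotate i [a, b, c, d] \<in> {[a, b, c, d], [b, c, d, a], [c, d, a, b], [d, a, b, c]}" for i
  proof -
    have "i mod 4 = 0 \<or> i mod 4 = 1 \<or> i mod 4 = 2 \<or> i mod 4 = 3" by presburger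
    then have "rotate (i mod 4) [a, b, c, d] \<in> {[a, b, c, d], [b, c, d, a], [c, d, a, b], [d, a, b, c]}"
      by (elim disjE) (simp_all add: r)
    moreover have "length [a, b, c, d] = 4" by simp
    ultimately show ?thesis using rotate_conv_mod[of i "[a, b, c, d]"] by argo
  qed
  moreover have "\<exists>i. [a, b, c, d] = rotate i [a, b, c, d]" by (rule exI[of _ 0]) simp
  moreover have "\<exists>i. [b, c, d, a] = rotate i [a, b, c, d]" by (rule exI[of _ 1]) simp
  moreover have "\<exists>i. [c, d, a, b] = rotate i [a, b, c, d]" by (rule exI[of _ 2]) (simp add: r)
  moreover have "\<exists>i. [d, a, b, c] = rotate i [a, b, c, d]" by (rule exI[of _ 3]) (simp add: r)
  ultimately show ?thesis by blast
qed

lemma symmetrized_relators_4: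
  assumes "\<forall>r\<in>relators P. length r = 4"
  shows "z \<in> symmetrized_relators P \<longleftrightarrow> (\<exists>a b c d. [a, b, c, d] \<in> relators P \<and>
    (z \<in> {[a, b, c, d], [b, c, d, a], [c, d, a, b], [d, a, b, c]} \<or>
     z \<in> {[inv_letter d, inv_letter c, inv_letter b, inv_letter a],
       [inv_letter c, inv_letter b, inv_letter a, inv_letter d],
       [inv_letter b, inv_letter a, inv_letter d, inv_letter c],
       [inv_letter a, inv_letter d, inv_letter c, inv_letter b]}))"
    (is "_ \<longleftrightarrow> ?R")
proof -
  have four: "\<exists>a b c d. r = [a, b, c, d]" if "r \<in> relators P" for r
    using bspec[OF assms that] by (auto simp: numeral_eq_Suc length_Suc_conv)
  have "z \<in> symmetrized_relators P \<longleftrightarrow> (\<exists>r\<in>relators P. (\<exists>i. z = rotate i r) \<or> (\<exists>i. z = rotate i (inv_word r)))"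
    unfolding symmetrized_relators_def by blast
  also have "\<dots> \<longleftrightarrow> (\<exists>a b c d. [a, b, c, d] \<in> relators P \<and>
      ((\<exists>i. z = rotate i [a, b, c, d]) \<or> (\<exists>i. z = rotate i (inv_word [a, b, c, d]))))"
    using four by metis
  also have "\<dots> \<longleftrightarrow> ?R"
    by (simp only: inv_word_simps append.simps rotate_4)
  finally show ?thesis .
qed

lemma edge4_inv: "edge4 (inv_letter b) (inv_letter a) (inv_letter d) (inv_letter c) = edge4 a b c d"
  by (auto simp: edge4_def)

text \<open>Rotations of the relators suffice, because by \<open>edge4_inv\<close> the rotations of
  an inverse give the same edges.\<close>

lemma star_graph_edges_4:
  assumes "\<forall>r\<in>relators P. length r = 4"
  shows "edges (star_graph P) = {E. \<exists>a b c d. [a, b, c, d] \<in> relators P \<and>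
    E \<in> {edge4 a b c d, edge4 b c d a, edge4 c d a b, edge4 d a b c}}" (is "_ = ?R")
proof -
  have len: "length z = 4" if "z \<in> symmetrized_relators P" for z
    using that assms by (auto simp: symmetrized_relators_def inv_word_def)
  have "edges (star_graph P) = {edge4 a b c d | a b c d. [a, b, c, d] \<in> symmetrized_relators P}"
    (is "_ = ?M")
  proof
    show "edges (star_graph P) \<subseteq> ?M"
    proof
      fix E assume "E \<in> edges (star_graph P)"
      then obtain x y u where E: "x # inv_letter y # u \<in> symmetrized_relators P"
        "E = {x # inv_letter y # u, y # inv_letter x # inv_word u}" by (auto simp: star_graph_def)
      have "length u = 2" using len[OF E(1)] by simp
      then obtain c d where u: "u = [c, d]" by (auto simp: length_Suc_conv numeral_2_eq_2)
      have "E = edge4 x (inv_letter y) c d" using E(2) by (simp add: u edge4_def)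
      then show "E \<in> ?M" using E(1) u by blast
    qed
    show "?M \<subseteq> edges (star_graph P)"
    proof
      fix E assume "E \<in> ?M"
      then obtain a b c d where z: "[a, b, c, d] \<in> symmetrized_relators P" "E = edge4 a b c d" by blast
      have "a # inv_letter (inv_letter b) # [c, d] \<in> symmetrized_relators P" using z(1) by simp
      moreover have "E = {a # inv_letter (inv_letter b) # [c, d], inv_letter b # inv_letter a # inv_word [c, d]}"
        using z(2) by (simp add: edge4_def)
      ultimately have "\<exists>x y u. E = {x # inv_letter y # u, y # inv_letter x # inv_word u} \<and>
          x # inv_letter y # u \<in> symmetrized_relators P" by blast
      then show "E \<in> edges (star_graph P)" by (simp add: star_graph_def)
    qed
  qed
  also have "\<dots> = ?R"
  proof
    show "?M \<subseteq> ?R"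
    proof
      fix E assume "E \<in> ?M"
      then obtain a b c d where z: "[a, b, c, d] \<in> symmetrized_relators P" "E = edge4 a b c d" by blast
      from z(1) obtain a' b' c' d' where r: "[a', b', c', d'] \<in> relators P"
        and z': "[a, b, c, d] \<in> {[a', b', c', d'], [b', c', d', a'], [c', d', a', b'], [d', a', b', c']} \<or>
          [a, b, c, d] \<in> {[inv_letter d', inv_letter c', inv_letter b', inv_letter a'],
            [inv_letter c', inv_letter b', inv_letter a', inv_letter d'],
            [inv_letter b', inv_letter a', inv_letter d', inv_letter c'],
            [inv_letter a', inv_letter d', inv_letter c', inv_letter b']}"
        using symmetrized_relators_4[OF assms, THEN iffD1, OF z(1)] by (elim exE conjE) (rule that)
      have "E \<in> {edge4 a' b' c' d', edge4 b' c' d' a', edge4 c' d' a' b', edge4 d' a' b' c'}"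
        using z' unfolding z(2) insert_iff empty_iff list.inject
        by (elim disjE conjE FalseE) (simp_all add: edge4_inv)
      then show "E \<in> ?R" using r by blast
    qed
    show "?R \<subseteq> ?M"
    proof
      fix E assume "E \<in> ?R"
      then obtain a b c d where r: "[a, b, c, d] \<in> relators P"
        "E \<in> {edge4 a b c d, edge4 b c d a, edge4 c d a b, edge4 d a b c}" by blast
      have "[a, b, c, d] \<in> symmetrized_relators P" "[b, c, d, a] \<in> symmetrized_relators P"
        "[c, d, a, b] \<in> symmetrized_relators P" "[d, a, b, c] \<in> symmetrized_relators P"
        unfolding symmetrized_relators_4[OF assms] using r(1) by blast+
      then show "E \<in> ?M" using r(2) by blast
    qed
  qed
  finally show ?thesis .
qed

lemma ends_edge4: "ends (star_graph P) (edge4 a b c d) = {a, inv_letter b}"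
  by (simp add: star_graph_def edge4_def)

text \<open>The third letter of the defining word is positive if \<open>t\<close> holds and negative otherwise.\<close>

locale length4_presentation =
  fixes n p q r :: nat and t :: bool
  assumes n: "n > 0" and pqr: "p < n" "q < n" "r < n"
    and red: "p \<noteq> 0" "t \<Longrightarrow> q \<noteq> p" "\<not> t \<Longrightarrow> q \<noteq> r"
begin

definition w :: "nat word" where
  "w = [Pos 0, Neg p, if t then Pos q else Neg q, Pos r]"

abbreviation "P \<equiv> cyclic_presentation n w"

definition rel :: "int \<Rightarrow> nat word" where
  "rel x = [vert n True x, vert n False (x + int p), vert n t (x + int q), vert n True (x + int r)]"

lemma w_words: "w \<in> words {..<n}"
  using pqr by (auto simp: w_def)

lemma w_reduced: "reduced w" "cyclically_reduced w"
  using red by (auto simp: w_def cyclically_reduced_def)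

lemma vert_int: "vert n s (int x) = (if s then Pos else Neg) (x mod n)"
  by (simp add: vert_def zmod_int[symmetric])

lemma shift_w: "shift_by n i w = rel (int i)"
  using vert_int[of _ "i + p"] vert_int[of _ "i + q"] vert_int[of _ "i + r"] vert_int[of _ i]
  by (auto simp: w_def rel_def add.commute)

lemma vert_mod: "vert n s (x mod int n + y) = vert n s (x + y)"
  by (simp add: vert_def mod_simps)

lemma rel_mod: "rel (x mod int n) = rel x"
  using vert_mod[of _ x 0] vert_mod[of _ x] by (simp add: rel_def)

lemma relators_P: "relators P = range rel"
proof
  show "relators P \<subseteq> range rel" unfolding relators_cyclic[OF w_words] by (auto simp: shift_w)
  show "range rel \<subseteq> relators P"
  proof
    fix z assume "z \<in> range rel"
    then obtain x where "z = rel x" by blast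
    then have "z = shift_by n (nat (x mod int n)) w" using n by (simp add: shift_w rel_mod)
    then show "z \<in> relators P" using shift_by_relator[OF n w_words] by simp
  qed
qed

text \<open>Two cyclically consecutive letters \<open>a\<close>, \<open>b\<close> give an edge from
  \<open>a\<close> to the inverse of \<open>b\<close>. The sign of the third letter decides which of
  the two middle junctions joins negative vertices; its difference is \<open>d\<close>, that of the
  other one is \<open>e\<close>.\<close>

definition d :: int where
  "d = (if t then int q - int p else int r - int q)"

definition e :: int where
  "e = (if t then int r - int q else int p - int q)"

definition quad :: "nat \<Rightarrow> int \<Rightarrow> nat word set" where
  "quad j x = (let a = vert n True x; b = vert n False (x + int p); c = vert n t (x + int q); d = vert n True (x + int r)
     in [edge4 a b c d, edge4 b c d a, edge4 c d a b, edge4 d a b c] ! j)"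

text \<open>\<open>quad j x\<close> is the edge at junction \<open>j\<close> of the relator
  \<open>rel x\<close>. Here the edges are renumbered by the signs of their ends and translated so
  that the end listed first in \<open>circulant_star\<close> has subscript \<open>x\<close>.\<close>

definition \<epsilon> :: "nat \<Rightarrow> int \<Rightarrow> nat word set" where
  "\<epsilon> k x = (if k = 0 then quad 0 x
     else if k = 1 then (if t then quad 1 (x - int p) else quad 2 (x - int q))
     else if k = 2 then (if t then quad 2 (x - int q) else quad 1 (x - int q))
     else quad 3 (x - int r))"

lemma vert_cong: "int n dvd x - y \<Longrightarrow> vert n s (x + z) = vert n s (y + z)"
  by (simp add: vert_eq_iff[OF n])

lemma quad_simps:
  "quad 0 x = edge4 (vert n True x) (vert n False (x + int p)) (vert n t (x + int q)) (vert n True (x + int r))"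
  "quad (Suc 0) x = edge4 (vert n False (x + int p)) (vert n t (x + int q)) (vert n True (x + int r)) (vert n True x)"
  "quad 2 x = edge4 (vert n t (x + int q)) (vert n True (x + int r)) (vert n True x) (vert n False (x + int p))"
  "quad 3 x = edge4 (vert n True (x + int r)) (vert n True x) (vert n False (x + int p)) (vert n t (x + int q))"
  by (simp_all add: quad_def Let_def)

lemma \<epsilon>_range: "{\<epsilon> k x | k x. k < 4} = {E. \<exists>a b c d. [a, b, c, d] \<in> relators P \<and>
    E \<in> {edge4 a b c d, edge4 b c d a, edge4 c d a b, edge4 d a b c}}" (is "?L = ?R")
proof -
  have "?R = {E. \<exists>x. E \<in> {quad 0 x, quad 1 x, quad 2 x, quad 3 x}}"
    unfolding relators_P rel_def One_nat_def quad_simps by blast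
  also have "\<dots> = ?L"
  proof
    show "{E. \<exists>x. E \<in> {quad 0 x, quad 1 x, quad 2 x, quad 3 x}} \<subseteq> ?L"
    proof
      fix E assume "E \<in> {E. \<exists>x. E \<in> {quad 0 x, quad 1 x, quad 2 x, quad 3 x}}"
      then obtain x where "E \<in> {quad 0 x, quad 1 x, quad 2 x, quad 3 x}" by blast
      then have E: "E = quad 0 x \<or> E = quad 1 x \<or> E = quad 2 x \<or> E = quad 3 x" by blast
      have "quad 0 x = \<epsilon> 0 x" "quad 3 x = \<epsilon> 3 (x + int r)"
        "quad 1 x = (if t then \<epsilon> 1 (x + int p) else \<epsilon> 2 (x + int q))"
        "quad 2 x = (if t then \<epsilon> 2 (x + int q) else \<epsilon> 1 (x + int q))"
        unfolding \<epsilon>_def by simp_all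
      then have "\<exists>k y. k \<in> {0, 1, 2, 3} \<and> E = \<epsilon> k y"
        using E unfolding insert_iff by metis
      then show "E \<in> ?L" by fastforce
    qed
    show "?L \<subseteq> {E. \<exists>x. E \<in> {quad 0 x, quad 1 x, quad 2 x, quad 3 x}}"
    proof
      fix E assume "E \<in> ?L"
      then obtain k x where "E = \<epsilon> k x" by blast
      then have "E = quad 0 x \<or> E = quad 1 (x - int p) \<or> E = quad 2 (x - int q) \<or> E = quad 1 (x - int q) \<or> E = quad 3 (x - int r)"
        unfolding \<epsilon>_def by argo
      then show "E \<in> {E. \<exists>x. E \<in> {quad 0 x, quad 1 x, quad 2 x, quad 3 x}}" by blast
    qed
  qed
  finally show ?thesis ..
qed

sublocale star: circulant_star n "int p" d e "- int r" "star_graph P" \<epsilon>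
proof
  show "edges (star_graph P) = {\<epsilon> k x | k x. k < 4}"
    unfolding \<epsilon>_range by (rule star_graph_edges_4) (auto simp: relators_P rel_def)
  show "verts (star_graph P) = Pos ` {..<n} \<union> Neg ` {..<n}" by (simp add: star_graph_def)
  show "\<epsilon> k x = \<epsilon> k y" if "int n dvd x - y" for k x y
  proof -
    have "quad j (x - z) = quad j (y - z)" "quad j x = quad j y" for j z
      using vert_cong[OF that, of _ 0] vert_cong[OF that] vert_cong[of "x - z" "y - z"] vert_cong[of "x - z" "y - z" _ 0] that
      by (simp_all add: quad_def)
    note q = this
    show ?thesis unfolding \<epsilon>_def q ..
  qed
  show "n > 0" by (rule n)
  fix x
  show "ends (star_graph P) (\<epsilon> 0 x) = {vert n True x, vert n True (x + int p)}"
    "ends (star_graph P) (\<epsilon> 3 x) = {vert n True x, vert n False (x + - int r)}"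
    unfolding \<epsilon>_def quad_simps by (simp_all add: quad_simps ends_edge4)
  show "ends (star_graph P) (\<epsilon> 1 x) = {vert n False x, vert n False (x + d)}"
    unfolding \<epsilon>_def d_def One_nat_def quad_simps by (cases t) (simp_all add: ends_edge4 algebra_simps)
  show "ends (star_graph P) (\<epsilon> 2 x) = {vert n True x, vert n False (x + e)}"
    unfolding \<epsilon>_def e_def One_nat_def quad_simps by (cases t) (simp_all add: ends_edge4 algebra_simps insert_commute)
qed

lemma special_iff:
  "special 2 4 \<nu> P \<longleftrightarrow> 1 \<le> \<nu> \<and> finite (components (star_graph P)) \<and> card (components (star_graph P)) = \<nu> \<and>
    (\<forall>C\<in>components (star_graph P). \<forall>D\<in>components (star_graph P). graph_isomorphic C D) \<and>
    (\<forall>C\<in>components (star_graph P).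
       connected_graph C \<and> bipartite C \<and> graph_diameter C = enat 2 \<and> girth C = enat 4 \<and>
       (\<forall>v\<in>verts C. 3 \<le> degree C v))"
proof -
  have "length z = 4" "z \<in> carrier (free_group {..<n})" "cyclically_reduced z" if z: "z \<in> relators P" for z
  proof -
    obtain i where i: "z = shift_by n i w" using z unfolding relators_cyclic[OF w_words] by blast
    show "length z = 4" by (simp add: i shift_by_def w_def)
    have red: "reduced z" unfolding i using reduced_shift_by[OF w_words w_reduced(1)] .
    then show "z \<in> carrier (free_group {..<n})"
      using shift_by_words[OF n] by (simp add: carrier_free_group i)
    show "cyclically_reduced z" using red by (simp add: cyclically_reduced_def i w_def)
  qed
  moreover have "finite (relators P)" by (simp add: cyclic_presentation_def)
  ultimately show ?thesis by (auto simp: special_def)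
qed

lemma special_char:
  assumes simple: "int n dvd 2 * int p \<Longrightarrow> \<epsilon> 0 0 \<noteq> \<epsilon> 0 (int p)" "int n dvd 2 * d \<Longrightarrow> \<epsilon> 1 0 \<noteq> \<epsilon> 1 d"
  shows "special 2 4 \<nu> P \<longleftrightarrow> n = 4 * \<nu> \<and>
    ([int p = int \<nu>] (mod int n) \<or> [int p = - int \<nu>] (mod int n)) \<and>
    ([d = int \<nu>] (mod int n) \<or> [d = - int \<nu>] (mod int n)) \<and> [e + int r = 2 * int \<nu>] (mod int n)"
    (is "?L \<longleftrightarrow> ?R \<nu>")
proof
  assume R: "?R \<nu>"
  then have R': "n = 4 * \<nu>" "[int p = int \<nu>] (mod int n) \<or> [int p = - int \<nu>] (mod int n)"
    "[d = int \<nu>] (mod int n) \<or> [d = - int \<nu>] (mod int n)" "[e - - int r = 2 * int \<nu>] (mod int n)"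
    unfolding diff_minus_eq_add by blast+
  interpret circulant_blocks n "int p" d e "- int r" "star_graph P" \<epsilon> \<nu>
    by unfold_locales (fact R')+
  have "1 \<le> \<nu>" using N by simp
  then show ?L
    unfolding special_iff using card_components(2) card_components_N
    by (auto simp: components_eq block_iso connected_block bipartite_block diameter_block girth_block
        intro!: degree_block star.finite_edges)
next
  assume L: ?L
  then have comp: "bipartite C \<and> graph_diameter C = enat 2" "girth C = enat 4" if "C \<in> components (star_graph P)" for C
    using that unfolding special_iff by auto
  obtain N where RN: "n = 4 * N" "[int p = int N] (mod int n) \<or> [int p = - int N] (mod int n)"
    "[d = int N] (mod int n) \<or> [d = - int N] (mod int n)" "[e - - int r = 2 * int N] (mod int n)"
    by (rule star.necessary[OF comp simple])
  interpret circulant_blocks n "int p" d e "- int r" "star_graph P" \<epsilon> N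
    by unfold_locales (fact RN)+
  \<comment> \<open>The congruences just found split the graph into \<open>N\<close> components,
    which identifies \<open>N\<close> with \<open>\<nu>\<close>.\<close>
  have "N = \<nu>" using L card_components_N unfolding special_iff by simp
  then show "?R \<nu>" using RN unfolding diff_minus_eq_add by simp
qed

end

section \<open>From congruences to triples of subscripts\<close>

section \<open>Characterisation of the special presentations\<close>

lemma edge4_eqD:
  "edge4 a b c d = edge4 a' b' c' d' \<Longrightarrow> [a', b', c', d'] = [a, b, c, d] \<or>
    [a', b', c', d'] = [inv_letter b, inv_letter a, inv_letter d, inv_letter c]"
proof -
  assume "edge4 a b c d = edge4 a' b' c' d'"
  moreover have "[a', b', c', d'] \<in> edge4 a' b' c' d'" by (simp add: edge4_def)
  ultimately have "[a', b', c', d'] \<in> edge4 a b c d" by simp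
  then show ?thesis unfolding edge4_def insert_iff empty_iff by simp
qed

context length4_presentation
begin

lemma not_dvd: "\<not> int n dvd int p" "t \<Longrightarrow> \<not> int n dvd int q - int p" "\<not> t \<Longrightarrow> \<not> int n dvd int r - int q"
proof -
  have eq: "x = y" if "int n dvd int x - int y" "x < n" "y < n" for x y
    using that by (metis cong_iff_dvd_diff cong_int_iff cong_less_modulus_unique_nat)
  show "\<not> int n dvd int p" using eq[of p 0] pqr n red by auto
  show "\<not> int n dvd int q - int p" if t using eq[of q p] pqr red that by auto
  show "\<not> int n dvd int r - int q" if "\<not> t" using eq[of r q] pqr red that by auto
qed

text \<open>Under these congruences \<open>rel p\<close> is \<open>x_p x_0^-1 x_r^-1 x_q\<close>,
  and conjugating its inverse by \<open>x_0 x_p^-1\<close> gives \<open>rel 0\<close>.\<close>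

lemma redundant:
  assumes t: "\<not> t" and p2: "int n dvd 2 * int p" and pq: "int n dvd int p + int q - int r"
  shows "\<not> non_redundant P"
proof -
  interpret F: group "free_group {..<n}" by (rule group_free_group)
  have F: "generators P = {..<n}" by simp
  let ?T = "vert n True" and ?F = "vert n False"
  have r0: "rel 0 = [?T 0, ?F (int p), ?F (int q), ?T (int r)]" unfolding rel_def using t by simp
  have "?F (int p + int p) = ?F 0" "?F (int p + int q) = ?F (int r)"
    using p2 pq by (simp_all add: vert_eq_iff[OF n])
  moreover have "?T (int p + int r) = ?T (int q)"
    by (subst vert_eq_iff[OF n]) (use dvd_diff[OF p2 pq] in \<open>simp add: algebra_simps\<close>)
  ultimately have r1: "rel (int p) = [?T (int p), ?F 0, ?F (int r), ?T (int q)]" unfolding rel_def using t by simp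
  have red0: "reduced z" "z \<in> carrier (free_group {..<n})" if "z \<in> relators P" for z
  proof -
    obtain i where i: "z = shift_by n i w" using \<open>z \<in> relators P\<close> unfolding relators_cyclic[OF w_words] by blast
    show "reduced z" unfolding i using reduced_shift_by[OF w_words w_reduced(1)] .
    then show "z \<in> carrier (free_group {..<n})" using shift_by_words[OF n] by (simp add: carrier_free_group i)
  qed
  have R: "rel 0 \<in> relators P" "rel (int p) \<in> relators P" by (auto simp: relators_P)
  let ?g = "[?T 0, ?F (int p)]"
  have g: "?g \<in> carrier (free_group {..<n})"
  proof -
    have "gen (vert n s x) < n" for s x using n by (cases s) (simp_all add: vert_def nat_less_iff)
    moreover have "?F (int p) \<noteq> ?F 0" using not_dvd(1) by (simp add: vert_eq_iff[OF n])
    ultimately show ?thesis by (simp add: carrier_free_group)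
  qed
  have "?g \<otimes>\<^bsub>free_group {..<n}\<^esub> inv\<^bsub>free_group {..<n}\<^esub> (rel (int p)) \<otimes>\<^bsub>free_group {..<n}\<^esub> inv\<^bsub>free_group {..<n}\<^esub> ?g
      = free_reduce (?g @ inv_word (rel (int p)) @ inv_word ?g)"
    using g red0(2)[OF R(2)] by (simp only: inv_free_group mult_free_group free_reduce_append_left append_assoc)
  also have "?g @ inv_word (rel (int p)) @ inv_word ?g
      = (rel 0 @ [?T 0]) @ ?F (int p) # inv_letter (?F (int p)) # [?F 0]"
    by (simp add: r0 r1)
  also have "free_reduce \<dots> = free_reduce (rel 0 @ ?T 0 # inv_letter (?T 0) # [])"
    by (subst free_reduce_cancel) simp
  also have "\<dots> = rel 0"
    unfolding free_reduce_cancel using red0(1)[OF R(1)] by (simp add: free_reduce_reduced)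
  finally have "conjugate_in (free_group {..<n}) (rel 0) (inv\<^bsub>free_group {..<n}\<^esub> (rel (int p)))"
    unfolding conjugate_in_def using g by metis
  moreover have "rel 0 \<noteq> rel (int p)"
    using not_dvd(1) by (simp add: r0 r1 vert_eq_iff[OF n])
  ultimately have "freely_redundant P (rel 0)"
    unfolding freely_redundant_def Let_def F using R(2) by blast
  then show ?thesis using R(1) by (auto simp: non_redundant_def)
qed

text \<open>The two edges can only be equal through the inverse word, since the subscripts
  \<open>p\<close> and \<open>d\<close> are nonzero modulo \<open>n\<close>. Comparing the remaining
  letters gives the congruences of \<open>redundant\<close>.\<close>

lemma simple_False:
  assumes t: "\<not> t" and "non_redundant P"
  shows "int n dvd 2 * int p \<Longrightarrow> \<epsilon> 0 0 \<noteq> \<epsilon> 0 (int p)" "int n dvd 2 * d \<Longrightarrow> \<epsilon> 1 0 \<noteq> \<epsilon> 1 d"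
proof -
  show "\<epsilon> 0 0 \<noteq> \<epsilon> 0 (int p)" if p2: "int n dvd 2 * int p"
  proof
    assume "\<epsilon> 0 0 = \<epsilon> 0 (int p)"
    then have "quad 0 0 = quad 0 (int p)" by (simp add: \<epsilon>_def)
    from edge4_eqD[OF this[unfolded quad_simps]]
    have "int n dvd int p + int q - int r"
      using t not_dvd(1) by (auto simp: vert_eq_iff[OF n])
    then show False using redundant[OF t p2] assms(2) by simp
  qed
  show "\<epsilon> 1 0 \<noteq> \<epsilon> 1 d" if d2: "int n dvd 2 * d"
  proof
    have d: "d = int r - int q" unfolding d_def using t by simp
    assume "\<epsilon> 1 0 = \<epsilon> 1 d"
    then have "quad 2 (0 - int q) = quad 2 (d - int q)" using t unfolding \<epsilon>_def by simp
    from edge4_eqD[OF this[unfolded quad_simps]]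
    have "int n dvd d - int q - (int p - int q)"
      using t not_dvd(3)[OF t, folded d] by (auto simp: vert_eq_iff[OF n])
    then have a: "int n dvd d - int p" by simp
    then have "int n dvd - (d - int p)" by (rule dvd_minus_iff[THEN iffD2])
    then have pq: "int n dvd int p + int q - int r" by (simp add: d algebra_simps)
    have "int n dvd 2 * (d - int p)" using a by (rule dvd_mult)
    from dvd_diff[OF d2 this] have "int n dvd 2 * int p" by (simp add: algebra_simps)
    then show False using redundant[OF t _ pq] assms(2) by simp
  qed
qed

text \<open>Equality through the inverse word would identify a word of exponent sum 2 with one of
  exponent sum -2; direct equality would make \<open>p\<close> or \<open>d\<close> vanish modulo
  \<open>n\<close>.\<close>

lemma simple_True:
  assumes t: t
  shows "int n dvd 2 * int p \<Longrightarrow> \<epsilon> 0 0 \<noteq> \<epsilon> 0 (int p)" "int n dvd 2 * d \<Longrightarrow> \<epsilon> 1 0 \<noteq> \<epsilon> 1 d"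
proof -
  show "\<epsilon> 0 0 \<noteq> \<epsilon> 0 (int p)"
  proof
    assume "\<epsilon> 0 0 = \<epsilon> 0 (int p)"
    then have "quad 0 0 = quad 0 (int p)" by (simp add: \<epsilon>_def)
    from edge4_eqD[OF this[unfolded quad_simps]] show False
      using t not_dvd(1) by (auto simp: vert_eq_iff[OF n])
  qed
  show "\<epsilon> 1 0 \<noteq> \<epsilon> 1 d"
  proof
    have d: "d = int q - int p" unfolding d_def using t by simp
    assume "\<epsilon> 1 0 = \<epsilon> 1 d"
    then have "quad (Suc 0) (0 - int p) = quad (Suc 0) (d - int p)" using t unfolding \<epsilon>_def by simp
    from edge4_eqD[OF this[unfolded quad_simps]] show False
      using t not_dvd(2)[OF t, folded d] by (auto simp: vert_eq_iff[OF n])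
  qed
qed

lemma Gcd_gens: "irreducible_cyclic n w \<Longrightarrow> g dvd n \<Longrightarrow> g dvd p \<Longrightarrow> g dvd q \<Longrightarrow> g dvd r \<Longrightarrow> g = 1"
proof -
  assume "irreducible_cyclic n w" and g: "g dvd n" "g dvd p" "g dvd q" "g dvd r"
  then have "Gcd (insert n (word_gens w)) = 1" by (simp add: irreducible_cyclic_def)
  moreover have "g dvd Gcd (insert n (word_gens w))"
    by (rule Gcd_greatest) (use g in \<open>auto simp: w_def word_gens_def\<close>)
  ultimately show "g = 1" by simp
qed

end

text \<open>The numbers \<open>p\<close> and \<open>r - q\<close>, each \<open>\<nu>\<close> or
  \<open>- \<nu>\<close>, must add up to \<open>2 * \<nu>\<close> modulo \<open>4 * \<nu>\<close>,
  so they coincide, and \<open>s\<close> is \<open>- q\<close>.\<close>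

lemma special_a_iff:
  fixes n \<nu> p q r :: nat
  defines "w \<equiv> [Pos 0, Neg p, Neg q, Pos r]"
  assumes "n \<ge> 1" "p < n" "q < n" "r < n"
    and cr: "cyclically_reduced w" and ir: "irreducible_cyclic n w" and nr: "non_redundant (cyclic_presentation n w)"
  shows "special 2 4 \<nu> (cyclic_presentation n w) \<longleftrightarrow>
            n = 4 * \<nu> \<and>
            (\<exists>s::int. gcd s (int \<nu>) = 1 \<and>
               ([int p = int \<nu>] (mod int n) \<and> [int q = - s] (mod int n) \<and>
                  [int r = int \<nu> - s] (mod int n) \<or>
                [int p = 3 * int \<nu>] (mod int n) \<and> [int q = - s] (mod int n) \<and>
                  [int r = 3 * int \<nu> - s] (mod int n)))" (is "?L \<longleftrightarrow> n = 4 * \<nu> \<and> ?R")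
proof -
  interpret l: length4_presentation n p q r False
    by unfold_locales (use assms in \<open>auto simp: w_def cyclically_reduced_def\<close>)
  have w: "l.w = w" by (simp add: l.w_def w_def)
  have sp: "?L \<longleftrightarrow> n = 4 * \<nu> \<and>
    ([int p = int \<nu>] (mod int n) \<or> [int p = - int \<nu>] (mod int n)) \<and>
    ([int r - int q = int \<nu>] (mod int n) \<or> [int r - int q = - int \<nu>] (mod int n)) \<and> [int p - int q + int r = 2 * int \<nu>] (mod int n)"
    using l.special_char[OF l.simple_False, of \<nu>] nr unfolding w l.d_def l.e_def by simp
  have "(([int p = int \<nu>] (mod int n) \<or> [int p = - int \<nu>] (mod int n)) \<and>
    ([int r - int q = int \<nu>] (mod int n) \<or> [int r - int q = - int \<nu>] (mod int n)) \<and> [int p - int q + int r = 2 * int \<nu>] (mod int n)) \<longleftrightarrow> ?R"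
    (is "?M \<longleftrightarrow> ?R") if n4: "n = 4 * \<nu>"
  proof
    have n0: "int n dvd 4 * int \<nu>" using n4 by simp
    assume M: ?M
    then have e: "int n dvd int p - int q + int r - 2 * int \<nu>" by (simp add: cong_iff_dvd_diff)
    have disj: "([int p = int \<nu>] (mod int n) \<and> [int r = int \<nu> - (- int q)] (mod int n)) \<or>
        ([int p = 3 * int \<nu>] (mod int n) \<and> [int r = 3 * int \<nu> - (- int q)] (mod int n))"
    proof (cases "[int p = int \<nu>] (mod int n)")
      case True
      then have a: "int n dvd int p - int \<nu>" by (simp add: cong_iff_dvd_diff)
      have "int n dvd int r - (int \<nu> - (- int q))" using dvd_diff[OF e a] by (rule back_subst) simp
      then show ?thesis using True by (simp only: cong_iff_dvd_diff) simp
    next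
      case False
      then have a: "int n dvd int p + int \<nu>" using M by (simp add: cong_iff_dvd_diff)
      have "int n dvd int p - 3 * int \<nu>" using dvd_diff[OF a n0] by (rule back_subst) simp
      moreover have "int n dvd int r - (3 * int \<nu> - (- int q))" using dvd_diff[OF e a] by (rule back_subst) simp
      ultimately show ?thesis by (simp only: cong_iff_dvd_diff) simp
    qed
    \<comment> \<open>Modulo \<open>n\<close>, \<open>p\<close> is a multiple of
      \<open>\<nu>\<close> and \<open>r\<close> is \<open>p + q\<close>, so a common divisor of
      \<open>q\<close> and \<open>\<nu>\<close> divides all subscripts and \<open>n\<close>;
      irreducibility makes it 1.\<close>
    have "gcd q \<nu> = 1"
    proof (rule l.Gcd_gens)
      let ?g = "gcd q \<nu>"
      have g: "int ?g dvd int \<nu>" "int ?g dvd int q" "int ?g dvd int n" by (auto simp: n4)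
      have "int ?g dvd int p" "int ?g dvd int r"
      proof -
        \<comment> \<open>\<open>k\<close> is 1 or 3, according to the two alternatives.\<close>
        obtain k :: int where k: "int n dvd int p - k * int \<nu>" "int n dvd int r - (k * int \<nu> + int q)"
          using disj by (metis cong_iff_dvd_diff diff_minus_eq_add mult_1)
        have "int ?g dvd (int p - k * int \<nu>) + k * int \<nu>" "int ?g dvd (int r - (k * int \<nu> + int q)) + (k * int \<nu> + int q)"
          by (intro dvd_add dvd_mult g dvd_trans[OF g(3) k(1)] dvd_trans[OF g(3) k(2)])+
        then show "int ?g dvd int p" "int ?g dvd int r" by simp_all
      qed
      then show "?g dvd p" "?g dvd r" by simp_all
      show "?g dvd n" by (simp add: n4)
      show "irreducible_cyclic n l.w" using ir w by simp
    qed simp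
    then have "gcd (- int q) (int \<nu>) = 1" by (simp add: gcd_int_int_eq)
    then show ?R using disj by (intro exI[of _ "- int q"]) auto
  next
    have n0: "int n dvd 4 * int \<nu>" using n4 by simp
    assume ?R
    then obtain s where s: "[int p = int \<nu>] (mod int n) \<and> [int q = - s] (mod int n) \<and>
                  [int r = int \<nu> - s] (mod int n) \<or>
                [int p = 3 * int \<nu>] (mod int n) \<and> [int q = - s] (mod int n) \<and>
                  [int r = 3 * int \<nu> - s] (mod int n)" by blast
    then show ?M
    proof
      assume "[int p = int \<nu>] (mod int n) \<and> [int q = - s] (mod int n) \<and> [int r = int \<nu> - s] (mod int n)"
      then have a: "int n dvd int p - int \<nu>" "int n dvd int q - (- s)" "int n dvd int r - (int \<nu> - s)"
        by (simp_all only: cong_iff_dvd_diff)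
      have b: "int n dvd int r - int q - int \<nu>" using dvd_diff[OF a(3,2)] by (rule back_subst) simp
      have "int n dvd int p - int q + int r - 2 * int \<nu>" using dvd_add[OF a(1) b] by (rule back_subst) simp
      then show ?M using a(1) b by (simp only: cong_iff_dvd_diff) simp
    next
      assume "[int p = 3 * int \<nu>] (mod int n) \<and> [int q = - s] (mod int n) \<and> [int r = 3 * int \<nu> - s] (mod int n)"
      then have a: "int n dvd int p - 3 * int \<nu>" "int n dvd int q - (- s)" "int n dvd int r - (3 * int \<nu> - s)"
        by (simp_all only: cong_iff_dvd_diff)
      have p: "int n dvd int p - (- int \<nu>)" using dvd_add[OF a(1) n0] by (rule back_subst) simp
      have b: "int n dvd int r - int q - 3 * int \<nu>" using dvd_diff[OF a(3,2)] by (rule back_subst) simp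
      have c: "int n dvd int r - int q - (- int \<nu>)" using dvd_add[OF b n0] by (rule back_subst) simp
      have "int n dvd int p - int q + int r - 2 * int \<nu>" using dvd_add[OF p b] by (rule back_subst) simp
      then show ?M using p c by (simp only: cong_iff_dvd_diff) simp
    qed
  qed
  then show ?thesis unfolding sp by (rule conj_cong[OF refl])
qed

lemma less_4_cases: "x < 4 \<Longrightarrow> x = 0 \<or> x = 1 \<or> x = 2 \<or> x = 3" for x :: nat
  by auto

lemma special_b_tuples:
  fixes p q r :: nat
  assumes "p < 4" "q < 4" "r < 4"
  shows "([int p = 1] (mod 4) \<or> [int p = - 1] (mod 4)) \<and>
    ([int q - int p = 1] (mod 4) \<or> [int q - int p = - 1] (mod 4)) \<and> [int r - int q + int r = 2] (mod 4) \<longleftrightarrow>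
    (p, q, r) \<in> {(1, 0, 1), (3, 0, 3)} \<or> (p, q, r) \<in> {(1, 0, 3), (3, 0, 1)} \<or>
    (p, q, r) \<in> {(1, 2, 0), (3, 2, 0), (1, 2, 2), (3, 2, 2)}"
proof -
  have "\<forall>p\<in>{0, 1, 2, 3}. \<forall>q\<in>{0, 1, 2, 3}. \<forall>r\<in>{0, 1, 2, 3 :: nat}.
    (int p mod 4 = 1 \<or> int p mod 4 = 3) \<and>
    ((int q - int p) mod 4 = 1 \<or> (int q - int p) mod 4 = 3) \<and> (int r - int q + int r) mod 4 = 2 \<longleftrightarrow>
    (p, q, r) \<in> {(1, 0, 1), (3, 0, 3)} \<or> (p, q, r) \<in> {(1, 0, 3), (3, 0, 1)} \<or>
    (p, q, r) \<in> {(1, 2, 0), (3, 2, 0), (1, 2, 2), (3, 2, 2)}"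
    by simp
  note brute = this
  have p: "p \<in> {0, 1, 2, 3}" and q: "q \<in> {0, 1, 2, 3}" and r: "r \<in> {0, 1, 2, 3}"
    unfolding lessThan_4[symmetric] using assms by simp_all
  have c: "[x = 1] (mod 4) \<longleftrightarrow> x mod 4 = 1" "[x = - 1] (mod 4) \<longleftrightarrow> x mod 4 = 3" "[x = 2] (mod 4) \<longleftrightarrow> x mod 4 = 2"
    for x :: int by (simp_all add: cong_def)
  show ?thesis unfolding c using bspec[OF bspec[OF bspec[OF brute p] q] r] .
qed

text \<open>The congruences make \<open>\<nu>\<close> divide all subscripts, so irreducibility
  leaves \<open>\<nu> = 1\<close> and \<open>n = 4\<close>; a check of 64 triples remains.\<close>

lemma special_b_iff:
  fixes n \<nu> p q r :: nat
  defines "w \<equiv> [Pos 0, Neg p, Pos q, Pos r]"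
  assumes "n \<ge> 1" "p < n" "q < n" "r < n"
    and cr: "cyclically_reduced w" and ir: "irreducible_cyclic n w"
  shows "special 2 4 \<nu> (cyclic_presentation n w) \<longleftrightarrow>
            \<nu> = 1 \<and> n = 4 \<and>
            ((p, q, r) \<in> {(1, 0, 1), (3, 0, 3)} \<or>
             (p, q, r) \<in> {(1, 0, 3), (3, 0, 1)} \<or>
             (p, q, r) \<in> {(1, 2, 0), (3, 2, 0), (1, 2, 2), (3, 2, 2)})" (is "?L \<longleftrightarrow> \<nu> = 1 \<and> n = 4 \<and> ?T")
proof -
  interpret l: length4_presentation n p q r True
    by unfold_locales (use assms in \<open>auto simp: w_def cyclically_reduced_def\<close>)
  have w: "l.w = w" by (simp add: l.w_def w_def)
  have sp: "?L \<longleftrightarrow> n = 4 * \<nu> \<and>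
    ([int p = int \<nu>] (mod int n) \<or> [int p = - int \<nu>] (mod int n)) \<and>
    ([int q - int p = int \<nu>] (mod int n) \<or> [int q - int p = - int \<nu>] (mod int n)) \<and> [int r - int q + int r = 2 * int \<nu>] (mod int n)"
    (is "_ \<longleftrightarrow> n = 4 * \<nu> \<and> ?M")
    using l.special_char[OF l.simple_True, of \<nu>] unfolding w l.d_def l.e_def by simp
  have A: "\<nu> = 1" if n4: "n = 4 * \<nu>" and M: ?M
  proof -
    have "\<exists>c::int. odd c \<and> x = c * int \<nu>" if "[x = int \<nu>] (mod int n) \<or> [x = - int \<nu>] (mod int n)" for x
    proof -
      have "\<exists>e::int. odd e \<and> int n dvd x - e * int \<nu>"
        using that by (elim disjE) (rule exI[of _ 1], simp add: cong_iff_dvd_diff, rule exI[of _ "- 1"], simp add: cong_iff_dvd_diff)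
      then obtain e where e: "odd e" "int n dvd x - e * int \<nu>" by blast
      then obtain k where "x - e * int \<nu> = int n * k" by (auto elim: dvdE)
      then show ?thesis by (intro exI[of _ "e + 4 * k"]) (simp add: e(1) n4 algebra_simps)
    qed
    then obtain a b where ab: "odd a" "odd b" "int p = a * int \<nu>" "int q - int p = b * int \<nu>"
      using M by metis
    obtain k where k: "int r - int q + int r - 2 * int \<nu> = int n * k"
      using M by (auto simp: cong_iff_dvd_diff elim: dvdE)
    \<comment> \<open>Here \<open>e + r\<close> is \<open>2 * r - q\<close>. As a sum of two odd
      multiples, \<open>q\<close> is an even multiple of \<open>\<nu>\<close>, so the congruence can
      be halved and \<open>r\<close> is a multiple of \<open>\<nu>\<close> as well.\<close>
    have q: "int q = (a + b) * int \<nu>" using ab by (simp add: algebra_simps)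
    have "even (a + b)" using ab by simp
    then obtain c where c: "a + b = 2 * c" by (rule evenE)
    have "2 * int r = 2 * ((c + 1 + 2 * k) * int \<nu>)" using k q c by (simp add: n4 algebra_simps)
    then have r: "int r = (c + 1 + 2 * k) * int \<nu>" by simp
    have "int \<nu> dvd int p" "int \<nu> dvd int q" "int \<nu> dvd int r" using ab(3) q r by simp_all
    then have "\<nu> dvd p" "\<nu> dvd q" "\<nu> dvd r" by simp_all
    then show ?thesis using l.Gcd_gens[of \<nu>] ir w n4 by simp
  qed
  have B: "?M \<longleftrightarrow> ?T" if n: "n = 4" "\<nu> = 1"
  proof -
    have "p < 4" "q < 4" "r < 4" using \<open>p < n\<close> \<open>q < n\<close> \<open>r < n\<close> n by simp_all
    then show ?thesis unfolding n using special_b_tuples[of p q r] by simp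
  qed
  show ?thesis unfolding sp
  proof
    assume a: "n = 4 * \<nu> \<and> ?M"
    have nu: "\<nu> = 1" by (rule A[OF conjunct1[OF a] conjunct2[OF a]])
    have n4: "n = 4" using conjunct1[OF a] unfolding nu by simp
    show "\<nu> = 1 \<and> n = 4 \<and> ?T" by (intro conjI nu n4 iffD1[OF B[OF n4 nu] conjunct2[OF a]])
  next
    assume a: "\<nu> = 1 \<and> n = 4 \<and> ?T"
    note nu = conjunct1[OF a] and n4 = conjunct1[OF conjunct2[OF a]]
    have "n = 4 * \<nu>" unfolding nu n4 by simp
    moreover have ?M by (rule iffD2[OF B[OF n4 nu] conjunct2[OF conjunct2[OF a]]])
    ultimately show "n = 4 * \<nu> \<and> ?M" by (rule conjI)
  qed
qed

section \<open>Isomorphisms between the presentations with four generators\<close>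

definition neg4 :: "nat letter \<Rightarrow> nat letter" where
  "neg4 = map_letter (\<lambda>i. (4 - i) mod 4)"

lemma neg4_simps [simp]: "neg4 (Pos i) = Pos ((4 - i) mod 4)" "neg4 (Neg i) = Neg ((4 - i) mod 4)"
  by (simp_all add: neg4_def)

lemma neg4:
  "neg4 (inv_letter l) = inv_letter (neg4 l)" "gen l < 4 \<Longrightarrow> gen (neg4 l) < 4" "gen l < 4 \<Longrightarrow> neg4 (neg4 l) = l"
proof -
  have "neg4 (neg4 l) = l" if "gen l \<in> {0, 1, 2, 3}"
    using that by (cases l) auto
  then show "gen l < 4 \<Longrightarrow> neg4 (neg4 l) = l" by (metis lessThan_4 lessThan_iff)
qed (cases l; simp)+

lemma iso_1_3_0: "cyclic_group_of 4 [Pos 0, Neg 1, Neg 3, Pos 0] \<cong> cyclic_group_of 4 [Pos 0, Neg 1, Neg 1, Pos 2]"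
  by (rule cyclic_4_iso[of _ _ neg4]) (auto simp: cyclic_match_4 neg4)

text \<open>The identity works: \<open>x_0 x_3^-1 x_1^-1 x_0\<close> is a rotation of the inverse of
  \<open>x_3 x_0^-2 x_1\<close>, a shift of the other word.\<close>

lemma iso_3_1_0: "cyclic_group_of 4 [Pos 0, Neg 3, Neg 1, Pos 0] \<cong> cyclic_group_of 4 [Pos 0, Neg 1, Neg 1, Pos 2]"
  by (rule cyclic_4_iso[of _ _ "\<lambda>l. l"]) (auto simp: cyclic_match_4)

lemma iso_3_0_3: "cyclic_group_of 4 [Pos 0, Neg 3, Neg 0, Pos 3] \<cong> cyclic_group_of 4 [Pos 0, Neg 1, Neg 0, Pos 1]"
  by (rule cyclic_4_iso[of _ _ neg4]) (auto simp: cyclic_match_4 neg4)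

lemma iso_3_3_2: "cyclic_group_of 4 [Pos 0, Neg 3, Neg 3, Pos 2] \<cong> cyclic_group_of 4 [Pos 0, Neg 1, Neg 1, Pos 2]"
  by (rule cyclic_4_iso[of _ _ neg4]) (auto simp: cyclic_match_4 neg4)

lemma iso_3_2_1: "cyclic_group_of 4 [Pos 0, Neg 3, Neg 2, Pos 1] \<cong> cyclic_group_of 4 [Pos 0, Neg 1, Neg 2, Pos 3]"
  by (rule cyclic_4_iso[of _ _ neg4]) (auto simp: cyclic_match_4 neg4)

lemma iso_b_3_0_3: "cyclic_group_of 4 [Pos 0, Neg 3, Pos 0, Pos 3] \<cong> cyclic_group_of 4 [Pos 0, Neg 1, Pos 0, Pos 1]"
  by (rule cyclic_4_iso[of _ _ neg4]) (auto simp: cyclic_match_4 neg4)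

lemma iso_b_3_0_1: "cyclic_group_of 4 [Pos 0, Neg 3, Pos 0, Pos 1] \<cong> cyclic_group_of 4 [Pos 0, Neg 1, Pos 0, Pos 3]"
  by (rule cyclic_4_iso[of _ _ neg4]) (auto simp: cyclic_match_4 neg4)

lemma iso_b_1_2_0: "cyclic_group_of 4 [Pos 0, Neg 1, Pos 2, Pos 0] \<cong> cyclic_group_of 4 [Pos 0, Pos 0, Neg 1, Pos 2]"
  by (rule cyclic_4_iso[of _ _ "\<lambda>l. l"]) (auto simp: cyclic_match_4)

lemma iso_b_3_2_0: "cyclic_group_of 4 [Pos 0, Neg 3, Pos 2, Pos 0] \<cong> cyclic_group_of 4 [Pos 0, Pos 0, Neg 1, Pos 2]"
  by (rule cyclic_4_iso[of _ _ neg4]) (auto simp: cyclic_match_4 neg4)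

lemma iso_b_1_2_2: "cyclic_group_of 4 [Pos 0, Neg 1, Pos 2, Pos 2] \<cong> cyclic_group_of 4 [Pos 0, Pos 0, Neg 1, Pos 2]"
  by (rule cyclic_4_iso[of _ _ "\<lambda>l. inv_letter (neg4 l)"]) (auto simp: cyclic_match_4 neg4)

lemma iso_b_3_2_2: "cyclic_group_of 4 [Pos 0, Neg 3, Pos 2, Pos 2] \<cong> cyclic_group_of 4 [Pos 0, Pos 0, Neg 1, Pos 2]"
  by (rule cyclic_4_iso[of _ _ inv_letter]) (auto simp: cyclic_match_4)

lemma cong_imp_eq: "[int x = y] (mod int n) \<Longrightarrow> 0 \<le> y \<Longrightarrow> y < int n \<Longrightarrow> x < n \<Longrightarrow> int x = y"
  by (simp add: cong_def)

section \<open>Properties of the groups in case (a), and the case analysis by triples\<close>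

lemma special_a_consequences:
  fixes n \<nu> p q r :: nat
  defines "G \<equiv> cyclic_group_of n [Pos 0, Neg p, Neg q, Pos r]"
  assumes nu: "\<nu> \<ge> 1" and n: "n = 4 * \<nu>" and pqr: "p < n" "q < n" "r < n"
    and cr: "cyclically_reduced [Pos 0, Neg p, Neg q, Pos r]"
    and s: "[int p = int \<nu>] (mod int n) \<and> [int q = - s] (mod int n) \<and> [int r = int \<nu> - s] (mod int n) \<or>
      [int p = 3 * int \<nu>] (mod int n) \<and> [int q = - s] (mod int n) \<and> [int r = 3 * int \<nu> - s] (mod int n)"
  shows "embeds_as_subgroup (free_group_rank 2 \<times>\<times> free_group_rank 2) G"
    and "epi G (free_group_rank \<nu>) \<noteq> {}"
    and "\<nu> > 1 \<Longrightarrow> large G"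
    and "p = \<nu> \<or> p = 3 * \<nu>" and "[r = p + q] (mod n)"
proof -
  let ?w = "[Pos 0, Neg p, Neg q, Pos r]"
  have red: "p \<noteq> 0" "q \<noteq> r" using cr by (auto simp: cyclically_reduced_def)
  have "p = \<nu> \<and> [int r = int p + int q] (mod int n) \<or> p = 3 * \<nu> \<and> [int r = int p + int q] (mod int n)"
    using s
  proof (elim disjE conjE)
    assume a: "[int p = int \<nu>] (mod int n)" "[int q = - s] (mod int n)" "[int r = int \<nu> - s] (mod int n)"
    have "p = \<nu>" using cong_imp_eq[OF a(1)] n nu pqr by simp
    moreover have "[int r = int \<nu> + int q] (mod int n)"
      using cong_trans[OF a(3) cong_add[OF cong_refl cong_sym[OF a(2)], of "int \<nu>", simplified]] .
    ultimately show ?thesis by simp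
  next
    assume a: "[int p = 3 * int \<nu>] (mod int n)" "[int q = - s] (mod int n)" "[int r = 3 * int \<nu> - s] (mod int n)"
    have "int p = 3 * int \<nu>" using cong_imp_eq[OF a(1)] n nu pqr by simp
    moreover have "[int r = 3 * int \<nu> + int q] (mod int n)"
      using cong_trans[OF a(3) cong_add[OF cong_refl cong_sym[OF a(2)], of "3 * int \<nu>", simplified]] .
    ultimately show ?thesis by auto
  qed
  then show p: "p = \<nu> \<or> p = 3 * \<nu>" and r: "[r = p + q] (mod n)"
    by (auto simp flip: cong_int_iff)
  show "embeds_as_subgroup (free_group_rank 2 \<times>\<times> free_group_rank 2) G"
    unfolding G_def by (rule embeds_F2_F2[OF nu n p pqr(2) r pqr(3) red(2)])
  have w: "?w \<in> words {..<n}" "reduced ?w" using pqr red n nu by auto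
  have wf: "wf_presentation (cyclic_presentation n ?w)"
    unfolding wf_presentation_def using w by (rule well_formed_cyclic)
  have d: "\<nu> dvd p" using p by auto
  have "[r = p + q] (mod \<nu>)" using r by (rule cong_dvd_modulus_nat) (simp add: n)
  moreover have "[p + q = 0 + q] (mod \<nu>)" by (intro cong_add cong_refl) (simp add: cong_0_iff d)
  ultimately have rq: "[r = q] (mod \<nu>)" using cong_trans by fastforce
  have n0: "n > 0" using n nu by simp
  note epi = epi_free_group[OF nu n n0 wf refl w(1) d rq]
  show "epi G (free_group_rank \<nu>) \<noteq> {}"
    using epi[of "\<lambda>i. i"] unfolding G_def by simp
  show "large G" if "\<nu> > 1"
  proof -
    \<comment> \<open>\<open>large\<close> asks for a basis in the type of the elements of
      \<open>G\<close>, which are sets of words; singletons of one-letter words serve as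
      names.\<close>
    let ?k = "\<lambda>i. {[Pos i]} :: nat word set"
    have "inj_on ?k {..<\<nu>}" by (auto simp: inj_on_def)
    moreover have "group G" unfolding G_def using wf by (rule wf_presentation.group_G)
    ultimately show ?thesis
      using epi[of ?k] that unfolding G_def
      by (intro largeI[of _ "?k ` {..<\<nu>}" "?k 0" "?k 1"]) auto
  qed
qed

theorem corollary6p4:
  fixes n \<nu> p q r :: nat
  assumes "n \<ge> 1" and "\<nu> \<ge> 1" and "p < n" and "q < n" and "r < n"
  shows
    "(let w = [Pos 0, Neg p, Neg q, Pos r];
          P = cyclic_presentation n w;
          G = presented_group P
      in cyclically_reduced w \<and> irreducible_cyclic n w \<and> non_redundant P \<longrightarrow>
         (special 2 4 \<nu> P \<longleftrightarrow>
            n = 4 * \<nu> \<and>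
            (\<exists>s::int. gcd s (int \<nu>) = 1 \<and>
               ([int p = int \<nu>] (mod int n) \<and> [int q = - s] (mod int n) \<and>
                  [int r = int \<nu> - s] (mod int n) \<or>
                [int p = 3 * int \<nu>] (mod int n) \<and> [int q = - s] (mod int n) \<and>
                  [int r = 3 * int \<nu> - s] (mod int n)))) \<and>
         (special 2 4 \<nu> P \<longrightarrow>
            embeds_as_subgroup (free_group_rank 2 \<times>\<times> free_group_rank 2) G \<and>
            epi G (free_group_rank \<nu>) \<noteq> {} \<and>
            (\<nu> > 1 \<longrightarrow> large G)) \<and>
         (special 2 4 \<nu> P \<and> \<nu> = 1 \<longrightarrow>
            (G \<cong> cyclic_group_of 4 [Pos 0, Neg 1, Neg 0, Pos 1] \<and>
             cyclic_group_of 4 [Pos 0, Neg 1, Neg 0, Pos 1]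
               \<cong> free_group_rank 2 \<times>\<times> free_group_rank 2) \<or>
            (G \<cong> cyclic_group_of 4 [Pos 0, Neg 1, Neg 1, Pos 2] \<and>
             embeds_with_index (free_group_rank 5 \<times>\<times> free_group_rank 5) 16
               (cyclic_group_of 4 [Pos 0, Neg 1, Neg 1, Pos 2])) \<or>
            (G \<cong> cyclic_group_of 4 [Pos 0, Neg 1, Neg 2, Pos 3] \<and>
             embeds_with_index (free_group_rank 3 \<times>\<times> free_group_rank 5) 8
               (cyclic_group_of 4 [Pos 0, Neg 1, Neg 2, Pos 3]))))
     \<and>
     (let w = [Pos 0, Neg p, Pos q, Pos r];
          P = cyclic_presentation n w;
          G = presented_group P
      in cyclically_reduced w \<and> irreducible_cyclic n w \<longrightarrow>
         (special 2 4 \<nu> P \<longleftrightarrow>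
            \<nu> = 1 \<and> n = 4 \<and>
            ((p, q, r) \<in> {(1, 0, 1), (3, 0, 3)} \<or>
             (p, q, r) \<in> {(1, 0, 3), (3, 0, 1)} \<or>
             (p, q, r) \<in> {(1, 2, 0), (3, 2, 0), (1, 2, 2), (3, 2, 2)})) \<and>
         (n = 4 \<and> (p, q, r) \<in> {(1, 0, 1), (3, 0, 3)} \<longrightarrow>
            G \<cong> cyclic_group_of 4 [Pos 0, Neg 1, Pos 0, Pos 1] \<and>
            card (rcosets\<^bsub>G\<^esub> (derived G (carrier G))) = 16 \<and>
            G\<lparr>carrier := derived G (carrier G)\<rparr>
              \<cong> free_group_rank 5 \<times>\<times> free_group_rank 5) \<and>
         (n = 4 \<and> (p, q, r) \<in> {(1, 0, 3), (3, 0, 1)} \<longrightarrow>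
            G \<cong> cyclic_group_of 4 [Pos 0, Neg 1, Pos 0, Pos 3] \<and>
            embeds_with_index (free_group_rank 5 \<times>\<times> free_group_rank 5) 16 G) \<and>
         (n = 4 \<and> (p, q, r) \<in> {(1, 2, 0), (3, 2, 0), (1, 2, 2), (3, 2, 2)} \<longrightarrow>
            G \<cong> cyclic_group_of 4 [Pos 0, Pos 0, Neg 1, Pos 2]))"
proof -
  let ?wa = "[Pos 0, Neg p, Neg q, Pos r]" and ?wb = "[Pos 0, Neg p, Pos q, Pos r]"
  let ?Ga = "cyclic_group_of n ?wa" and ?Gb = "cyclic_group_of n ?wb"
  let ?arith = "\<lambda>s. [int p = int \<nu>] (mod int n) \<and> [int q = - s] (mod int n) \<and> [int r = int \<nu> - s] (mod int n) \<or>
      [int p = 3 * int \<nu>] (mod int n) \<and> [int q = - s] (mod int n) \<and> [int r = 3 * int \<nu> - s] (mod int n)"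
  have a_iff: "special 2 4 \<nu> (cyclic_presentation n ?wa) \<longleftrightarrow> n = 4 * \<nu> \<and> (\<exists>s. gcd s (int \<nu>) = 1 \<and> ?arith s)"
    if "cyclically_reduced ?wa" "irreducible_cyclic n ?wa" "non_redundant (cyclic_presentation n ?wa)"
    by (rule special_a_iff[OF assms(1,3,4,5) that])
  have a_embed: "embeds_as_subgroup (free_group_rank 2 \<times>\<times> free_group_rank 2) ?Ga \<and> epi ?Ga (free_group_rank \<nu>) \<noteq> {} \<and> (\<nu> > 1 \<longrightarrow> large ?Ga)"
    if "n = 4 * \<nu>" "cyclically_reduced ?wa" "?arith s" for s
    using special_a_consequences[OF assms(2) that(1) assms(3,4,5) that(2,3)] by blast
  have K4: "cyclic_group_of 4 [Pos 0, Neg 1, Neg 0, Pos 1] \<cong> free_group_rank 2 \<times>\<times> free_group_rank 2"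
    unfolding K4_def[symmetric] by (rule K4_iso) (rule is_isoI)
  have a_cases: "(?Ga \<cong> cyclic_group_of 4 [Pos 0, Neg 1, Neg 0, Pos 1]) \<or>
      (?Ga \<cong> cyclic_group_of 4 [Pos 0, Neg 1, Neg 1, Pos 2]) \<or> (?Ga \<cong> cyclic_group_of 4 [Pos 0, Neg 1, Neg 2, Pos 3])"
    if n: "n = 4 * \<nu>" and nu: "\<nu> = 1" and cr: "cyclically_reduced ?wa" and s: "?arith s" for s
  proof -
    have p: "p = 1 \<or> p = 3" and r: "[r = p + q] (mod n)"
      using special_a_consequences(4,5)[OF assms(2) n assms(3,4,5) cr s] nu by auto
    have n4: "n = 4" using n nu by simp
    have "r mod 4 = (p + q) mod 4" using r unfolding cong_def n4 .
    then have r': "r = (p + q) mod 4" using assms(5) unfolding n4 by (simp only: mod_less)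
    have q: "q = 0 \<or> q = 1 \<or> q = 2 \<or> q = 3" using assms(4) n4 by (intro less_4_cases) simp
    \<comment> \<open>The values \<open>q = 0\<close>, \<open>q\<close> odd and \<open>q = 2\<close>
      lead to (i), (ii) and (iii) respectively.\<close>
    have E: "(p, q, r) = (1, 0, 1) \<or> (p, q, r) = (1, 1, 2) \<or> (p, q, r) = (1, 2, 3) \<or> (p, q, r) = (1, 3, 0) \<or>
      (p, q, r) = (3, 0, 3) \<or> (p, q, r) = (3, 1, 0) \<or> (p, q, r) = (3, 2, 1) \<or> (p, q, r) = (3, 3, 2)"
      using p q unfolding r' by (elim disjE; hypsubst; simp)
    then show ?thesis
      unfolding n4 prod.inject
      by (elim disjE conjE; hypsubst)
         (use iso_refl iso_1_3_0 iso_3_0_3 iso_3_1_0 iso_3_2_1 iso_3_3_2 in blast)+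
  qed
  have b_iff: "special 2 4 \<nu> (cyclic_presentation n ?wb) \<longleftrightarrow>
            \<nu> = 1 \<and> n = 4 \<and>
            ((p, q, r) \<in> {(1, 0, 1), (3, 0, 3)} \<or>
             (p, q, r) \<in> {(1, 0, 3), (3, 0, 1)} \<or>
             (p, q, r) \<in> {(1, 2, 0), (3, 2, 0), (1, 2, 2), (3, 2, 2)})"
    if "cyclically_reduced ?wb" "irreducible_cyclic n ?wb"
    by (rule special_b_iff[OF assms(1,3,4,5) that])
  have grp: "group (cyclic_group_of 4 v)" if "v \<in> words {..<4}" "reduced v" for v
    using wf_presentation.group_G wf_cyclic_4 that by blast
  have b1: "?Gb \<cong> cyclic_group_of 4 [Pos 0, Neg 1, Pos 0, Pos 1] \<and>
            card (rcosets\<^bsub>?Gb\<^esub> (derived ?Gb (carrier ?Gb))) = 16 \<and>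
            ?Gb\<lparr>carrier := derived ?Gb (carrier ?Gb)\<rparr> \<cong> free_group_rank 5 \<times>\<times> free_group_rank 5"
    if n: "n = 4" and t: "(p, q, r) \<in> {(1, 0, 1), (3, 0, 3)}"
  proof -
    have c: "p = 1 \<and> q = 0 \<and> r = 1 \<or> p = 3 \<and> q = 0 \<and> r = 3" using t by simp
    have iso: "?Gb \<cong> cyclic_group_of 4 [Pos 0, Neg 1, Pos 0, Pos 1]"
      using c unfolding n by (elim disjE conjE; hypsubst) (use iso_refl iso_b_3_0_3 in blast)+
    have G: "group ?Gb" unfolding n by (rule grp) (use c in auto)
    have B: "group (presented_group KB)" unfolding KB_def by (rule grp) auto
    note D = derived_iso[OF G B iso[folded KB_def]]
    show ?thesis
      by (intro conjI iso iso_trans[OF D(2) derived_KB(2)]) (simp only: D(1) derived_KB(1))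
  qed
  have b2: "?Gb \<cong> cyclic_group_of 4 [Pos 0, Neg 1, Pos 0, Pos 3] \<and>
            embeds_with_index (free_group_rank 5 \<times>\<times> free_group_rank 5) 16 ?Gb"
    if n: "n = 4" and t: "(p, q, r) \<in> {(1, 0, 3), (3, 0, 1)}"
  proof -
    have c: "p = 1 \<and> q = 0 \<and> r = 3 \<or> p = 3 \<and> q = 0 \<and> r = 1" using t by simp
    have iso: "?Gb \<cong> cyclic_group_of 4 [Pos 0, Neg 1, Pos 0, Pos 3]"
      using c unfolding n by (elim disjE conjE; hypsubst) (use iso_refl iso_b_3_0_1 in blast)+
    have G: "group ?Gb" unfolding n by (rule grp) (use c in auto)
    have B: "group (cyclic_group_of 4 [Pos 0, Neg 1, Pos 0, Pos 3])" by (rule grp) auto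
    show ?thesis by (intro conjI iso embeds_with_index_iso[OF G B iso embeds_F5_F5_b])
  qed
  have b3: "?Gb \<cong> cyclic_group_of 4 [Pos 0, Pos 0, Neg 1, Pos 2]"
    if n: "n = 4" and t: "(p, q, r) \<in> {(1, 2, 0), (3, 2, 0), (1, 2, 2), (3, 2, 2)}"
  proof -
    have c: "p = 1 \<and> q = 2 \<and> r = 0 \<or> p = 3 \<and> q = 2 \<and> r = 0 \<or> p = 1 \<and> q = 2 \<and> r = 2 \<or> p = 3 \<and> q = 2 \<and> r = 2"
      using t by simp
    then show ?thesis
      unfolding n by (elim disjE conjE; hypsubst)
        (use iso_b_1_2_0 iso_b_3_2_0 iso_b_1_2_2 iso_b_3_2_2 in blast)+
  qed
  have a_special: "n = 4 * \<nu> \<and> cyclically_reduced ?wa \<and> (\<exists>s. ?arith s)"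
    if "special 2 4 \<nu> (cyclic_presentation n ?wa)"
      "cyclically_reduced ?wa \<and> irreducible_cyclic n ?wa \<and> non_redundant (cyclic_presentation n ?wa)"
    using a_iff that by blast
  show ?thesis
    unfolding Let_def
  proof (intro conjI impI, goal_cases)
    case 1
    show ?case by (rule a_iff[OF conjunct1[OF 1] conjunct1[OF conjunct2[OF 1]] conjunct2[OF conjunct2[OF 1]]])
  next
    case 2
    then show ?case using a_special a_embed by blast
  next
    case 3
    then show ?case using a_special a_embed by blast
  next
    case 4
    then show ?case using a_special a_embed by blast
  next
    case 5
    then have "\<exists>s. n = 4 * \<nu> \<and> \<nu> = 1 \<and> cyclically_reduced ?wa \<and> ?arith s" using a_special by blast
    then show ?case using a_cases K4 embeds_F5_F5_a embeds_F3_F5 by blast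
  next
    case 6
    show ?case by (rule b_iff[OF conjunct1[OF 6] conjunct2[OF 6]])
  next
    case 7
    show ?case by (rule conjunct1[OF b1[OF conjunct1[OF 7(2)] conjunct2[OF 7(2)]]])
  next
    case 8
    show ?case by (rule conjunct1[OF conjunct2[OF b1[OF conjunct1[OF 8(2)] conjunct2[OF 8(2)]]]])
  next
    case 9
    show ?case by (rule conjunct2[OF conjunct2[OF b1[OF conjunct1[OF 9(2)] conjunct2[OF 9(2)]]]])
  next
    case 10
    show ?case by (rule conjunct1[OF b2[OF conjunct1[OF 10(2)] conjunct2[OF 10(2)]]])
  next
    case 11
    show ?case by (rule conjunct2[OF b2[OF conjunct1[OF 11(2)] conjunct2[OF 11(2)]]])
  next
    case 12
    show ?case by (rule b3[OF conjunct1[OF 12(2)] conjunct2[OF 12(2)]])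
  qed
qed

end
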